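(* If $n\ge3$ and if $g$ is an Einstein metric on an $n$-manifold $M$ with $\operatorname{Ric}(g)=2\lambda(n-1)g$, then the operators $P_{2k}$ are given for $k\ge1$ by $$P_{2k}=\prod_{j=1}^k\left(-\Delta+2\lambda c_j\right),\qquad c_j=\left(\tfrac n2+j-1\right)\left(\tfrac n2-j\right).$$
   Context: $g$ is a smooth pseudo-Riemannian metric, $\lambda\in\mathbb R$ is constant, and $\Delta=\nabla^i\nabla_i$ is the Laplacian of $g$ on functions. The operators $P_{2k}$ (GJMS operators) for an Einstein metric $g$ on a manifold $M$ of dimension $n\ge3$ with $\operatorname{Ric}(g)=2\lambda(n-1)g$ are defined in the following way. Consider the metric $$\tilde g=2\rho\,dt^2+2t\,dt\,d\rho+t^2(1+\lambda\rho)^2g$$ on a neighborhood of $\mathbb R_+\times M\times\{0\}$ in $\mathbb R_+\times M\times\mathbb R$ with coordinates $(t,x,\rho)$; this is a Ricci-flat ambient metric for $(M,[g])$ in normal form relative to $g$ (used in all dimensions $n\ge3$ and for all $k\ge1$). Let $\tilde\Delta$ be its Laplacian. Fix $k\ge1$ and set $w=-n/2+k$. Given $f_0\in C^\infty(M)$, consider extensions $u=t^wf(x,\rho)$ with $f$ smooth and $f(x,0)=f_0(x)$. The equation $\tilde\Delta u=0$ is equivalent to $$-2\rho f''+\left(2k-2-\frac{2n\lambda\rho}{1+\lambda\rho}\right)f'+\frac{1}{(1+\lambda\rho)^2}\Delta f+\frac{\lambda n(-n/2+k)}{1+\lambda\rho}f=0,\qquad{}'=\partial_\rho .$$ The derivatives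 $\partial_\rho^mf|_{\rho=0}$, $1\le m\le k-1$, are determined successively by differentiating this equation in $\rho$ at $\rho=0$; the expression obtained by applying $\partial_\rho^{k-1}|_{\rho=0}$ to the left hand side depends only on these previously determined derivatives, hence defines a linear differential operator acting on $f_0$ (the obstruction to a formal harmonic extension). $P_{2k}$ is the constant multiple of this operator normalized to have principal part $(-\Delta)^k$. *)

theory Defs
  imports "HOL-Analysis.Analysis"
begin

section \<open>Smooth functions and partial derivatives on open subsets of coordinate space\<close>

text \<open>Only meant for open \<open>S\<close>: the derivatives are taken in the full neighbourhood of a point.\<close>

fun C_k_on :: "nat \<Rightarrow> 'a::real_normed_vector set \<Rightarrow> ('a \<Rightarrow> 'b::real_normed_vector) \<Rightarrow> bool" where
  "C_k_on 0 S f \<longleftrightarrow> continuous_on S f"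
| "C_k_on (Suc m) S f \<longleftrightarrow>
     (\<forall>x\<in>S. f differentiable at x) \<and> (\<forall>v. C_k_on m S (\<lambda>x. frechet_derivative f (at x) v))"

definition smooth_on :: "'a::real_normed_vector set \<Rightarrow> ('a \<Rightarrow> 'b::real_normed_vector) \<Rightarrow> bool" where
  "smooth_on S f \<longleftrightarrow> (\<forall>m. C_k_on m S f)"

definition pd :: "'n::finite \<Rightarrow> (real^'n \<Rightarrow> real) \<Rightarrow> real^'n \<Rightarrow> real" where
  "pd i f x = frechet_derivative f (at x) (axis i 1)"

definition pds :: "'n::finite list \<Rightarrow> (real^'n \<Rightarrow> real) \<Rightarrow> real^'n \<Rightarrow> real" where
  "pds l f = foldr pd l f"

section \<open>Pseudo-Riemannian geometry in local coordinates\<close>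

text \<open>Here \<open>G x\<close> is the matrix \<open>(g\<^sub>i\<^sub>j)\<close> of the metric at the coordinate point \<open>x\<close>.\<close>

definition christoffel ::
  "(real^'n \<Rightarrow> real^'n^'n) \<Rightarrow> 'n::finite \<Rightarrow> 'n \<Rightarrow> 'n \<Rightarrow> real^'n \<Rightarrow> real" where
  "christoffel G k i j x =
     (\<Sum>l\<in>UNIV. matrix_inv (G x) $ k $ l *
        (pd i (\<lambda>y. G y $ j $ l) x + pd j (\<lambda>y. G y $ i $ l) x - pd l (\<lambda>y. G y $ i $ j) x)) / 2"

text \<open>The sign is such that round spheres have positive Ricci curvature.\<close>

definition coord_ricci ::
  "(real^'n \<Rightarrow> real^'n^'n) \<Rightarrow> 'n::finite \<Rightarrow> 'n \<Rightarrow> real^'n \<Rightarrow> real" where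
  "coord_ricci G i j x =
     (\<Sum>k\<in>UNIV. pd k (christoffel G k i j) x - pd j (christoffel G k i k) x
        + (\<Sum>l\<in>UNIV. christoffel G k k l x * christoffel G l i j x
                    - christoffel G k j l x * christoffel G l i k x))"

definition coord_laplacian ::
  "(real^'n \<Rightarrow> real^'n^'n) \<Rightarrow> (real^'n::finite \<Rightarrow> real) \<Rightarrow> real^'n \<Rightarrow> real" where
  "coord_laplacian G f x =
     (\<Sum>i\<in>UNIV. \<Sum>j\<in>UNIV. matrix_inv (G x) $ i $ j *
        (pd i (pd j f) x - (\<Sum>k\<in>UNIV. christoffel G k i j x * pd k f x)))"

section \<open>Smooth manifolds and metrics\<close>

text \<open>An atlas is a family of charts \<open>(U, \<phi>)\<close>; the underlying manifold is the union of the
  chart domains, with the topology inherited from the ambient type.\<close>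

type_synonym ('i, 'm, 'n) atlas = "'i \<Rightarrow> 'm set \<times> ('m \<Rightarrow> real^'n)"

definition chart_dom :: "('i, 'm, 'n::finite) atlas \<Rightarrow> 'i \<Rightarrow> 'm set" where
  "chart_dom A a = fst (A a)"

definition chart :: "('i, 'm, 'n::finite) atlas \<Rightarrow> 'i \<Rightarrow> 'm \<Rightarrow> real^'n" where
  "chart A a = snd (A a)"

definition param :: "('i, 'm, 'n::finite) atlas \<Rightarrow> 'i \<Rightarrow> real^'n \<Rightarrow> 'm" where
  "param A a = inv_into (chart_dom A a) (chart A a)"

definition manifold_of :: "('i, 'm, 'n::finite) atlas \<Rightarrow> 'm set" where
  "manifold_of A = (\<Union>a. chart_dom A a)"

definition smooth_atlas ::
  "('i, 'm::{t2_space,second_countable_topology}, 'n::finite) atlas \<Rightarrow> bool" where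
  "smooth_atlas A \<longleftrightarrow>
     (\<forall>a. open (chart_dom A a) \<and> open (chart A a ` chart_dom A a) \<and>
          homeomorphism (chart_dom A a) (chart A a ` chart_dom A a) (chart A a) (param A a)) \<and>
     (\<forall>a b. smooth_on (chart A a ` (chart_dom A a \<inter> chart_dom A b)) (chart A b \<circ> param A a))"

definition smooth_function :: "('i, 'm, 'n::finite) atlas \<Rightarrow> ('m \<Rightarrow> real) \<Rightarrow> bool" where
  "smooth_function A f \<longleftrightarrow> (\<forall>a. smooth_on (chart A a ` chart_dom A a) (f \<circ> param A a))"

text \<open>A tensor field of type (0,2) is given by its component matrices, as functions of the
  coordinates, in every chart. A metric is a symmetric, non-degenerate, smooth such family that
  transforms as a tensor.\<close>

type_synonym ('i, 'n) tensor2 = "'i \<Rightarrow> real^'n \<Rightarrow> real^'n^'n"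

definition pseudo_riemannian_metric ::
  "('i, 'm, 'n::finite) atlas \<Rightarrow> ('i, 'n) tensor2 \<Rightarrow> bool" where
  "pseudo_riemannian_metric A g \<longleftrightarrow>
     (\<forall>a. (\<forall>i j. smooth_on (chart A a ` chart_dom A a) (\<lambda>x. g a x $ i $ j)) \<and>
          (\<forall>x \<in> chart A a ` chart_dom A a. transpose (g a x) = g a x \<and> invertible (g a x))) \<and>
     (\<forall>a b. \<forall>p \<in> chart_dom A a \<inter> chart_dom A b.
        let J = matrix (frechet_derivative (chart A b \<circ> param A a) (at (chart A a p)))
        in g a (chart A a p) = transpose J ** g b (chart A b p) ** J)"

definition einstein_with ::
  "('i, 'm, 'n::finite) atlas \<Rightarrow> ('i, 'n) tensor2 \<Rightarrow> real \<Rightarrow> bool" where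
  "einstein_with A g c \<longleftrightarrow>
     (\<forall>a. \<forall>x \<in> chart A a ` chart_dom A a. \<forall>i j. coord_ricci (g a) i j x = c * g a x $ i $ j)"

text \<open>The Laplacian is computed in some chart around the point; for a metric on a smooth
  manifold the choice does not matter.\<close>

definition laplacian ::
  "('i, 'm, 'n::finite) atlas \<Rightarrow> ('i, 'n) tensor2 \<Rightarrow> ('m \<Rightarrow> real) \<Rightarrow> 'm \<Rightarrow> real" where
  "laplacian A g f p =
     (let a = (SOME a. p \<in> chart_dom A a) in coord_laplacian (g a) (f \<circ> param A a) (chart A a p))"

section \<open>Linear differential operators\<close>

text \<open>The operator \<open>D\<close> has order at most \<open>m\<close>. Lists of indices play the role of
  multi-indices; the resulting redundancy of the coefficients is harmless.\<close>

definition diff_op ::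
  "('i, 'm, 'n::finite) atlas \<Rightarrow> nat \<Rightarrow> (('m \<Rightarrow> real) \<Rightarrow> 'm \<Rightarrow> real) \<Rightarrow> bool" where
  "diff_op A m D \<longleftrightarrow>
     (\<forall>a. \<exists>c :: 'n list \<Rightarrow> real^'n \<Rightarrow> real.
        (\<forall>l. smooth_on (chart A a ` chart_dom A a) (c l)) \<and>
        (\<forall>f. smooth_function A f \<longrightarrow> (\<forall>p \<in> chart_dom A a.
           D f p = (\<Sum>l | length l \<le> m. c l (chart A a p) * pds l (f \<circ> param A a) (chart A a p)))))"

text \<open>For operators of order \<open>m \<ge> 1\<close>.\<close>

definition same_principal_part ::
  "('i, 'm, 'n::finite) atlas \<Rightarrow> nat \<Rightarrow> (('m \<Rightarrow> real) \<Rightarrow> 'm \<Rightarrow> real) \<Rightarrow>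
     (('m \<Rightarrow> real) \<Rightarrow> 'm \<Rightarrow> real) \<Rightarrow> bool" where
  "same_principal_part A m D E \<longleftrightarrow>
     diff_op A m D \<and> diff_op A m E \<and> diff_op A (m - 1) (\<lambda>f p. D f p - E f p)"

section \<open>The ambient metric\<close>

text \<open>Coordinate indices of the ambient space, for \<open>t\<close>, \<open>x\<^sup>i\<close> and \<open>\<rho>\<close>.\<close>

datatype 'n amb = AmbT | AmbX 'n | AmbR

instance amb :: (finite) finite
proof
  have "(UNIV :: 'a amb set) = {AmbT, AmbR} \<union> range AmbX"
    by (auto intro: amb.exhaust)
  then show "finite (UNIV :: 'a amb set)"
    by (metis finite.emptyI finite.insertI finite_UnI finite_imageI finite)
qed

text \<open>The ambient space is the neighbourhood of \<open>\<real>\<^sub>+ \<times> M \<times> {0}\<close> given by \<open>t > 0\<close> and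
  \<open>1 + \<lambda>\<rho> > 0\<close>, where the ambient metric is non-degenerate.\<close>

definition ambient_atlas ::
  "('i, 'm, 'n::finite) atlas \<Rightarrow> real \<Rightarrow> ('i, real \<times> 'm \<times> real, 'n amb) atlas" where
  "ambient_atlas A lam a =
     ({0<..} \<times> chart_dom A a \<times> {\<rho>. 1 + lam * \<rho> > 0},
      \<lambda>(t, p, \<rho>). \<chi> I. case I of AmbT \<Rightarrow> t | AmbX i \<Rightarrow> chart A a p $ i | AmbR \<Rightarrow> \<rho>)"

text \<open>Components of \<open>2\<rho> dt\<^sup>2 + 2t dt d\<rho> + t\<^sup>2 (1 + \<lambda>\<rho>)\<^sup>2 g\<close>.\<close>

definition ambient_metric :: "('i, 'n::finite) tensor2 \<Rightarrow> real \<Rightarrow> ('i, 'n amb) tensor2" where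
  "ambient_metric g lam a X =
     (let t = X $ AmbT; x = (\<chi> i. X $ AmbX i); \<rho> = X $ AmbR in
      \<chi> I J. case (I, J) of
          (AmbT, AmbT) \<Rightarrow> 2 * \<rho>
        | (AmbT, AmbR) \<Rightarrow> t
        | (AmbR, AmbT) \<Rightarrow> t
        | (AmbX i, AmbX j) \<Rightarrow> t\<^sup>2 * (1 + lam * \<rho>)\<^sup>2 * g a x $ i $ j
        | _ \<Rightarrow> 0)"

section \<open>GJMS operators of an Einstein metric\<close>

definition gjms_weight :: "('i, 'm, 'n::finite) atlas \<Rightarrow> nat \<Rightarrow> real" where
  "gjms_weight A k = - real CARD('n) / 2 + real k"

text \<open>The function of \<open>(p, \<rho>)\<close> obtained by applying the Laplacian of the ambient metric to
  \<open>t\<^sup>w f\<close> and multiplying by \<open>t\<^sup>2\<^sup>-\<^sup>w\<close>. It does not depend on \<open>t\<close> and is therefore evaluated at \<open>t = 1\<close>. Explicitly it is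
  \<open>-2\<rho>f'' + (2k - 2 - 2n\<lambda>\<rho>/(1+\<lambda>\<rho>))f' + \<Delta>f/(1+\<lambda>\<rho>)\<^sup>2 + \<lambda>n(-n/2+k)f/(1+\<lambda>\<rho>)\<close>.\<close>

definition harmonic_lhs ::
  "('i, 'm, 'n::finite) atlas \<Rightarrow> ('i, 'n) tensor2 \<Rightarrow> real \<Rightarrow> nat \<Rightarrow>
     ('m \<Rightarrow> real \<Rightarrow> real) \<Rightarrow> 'm \<Rightarrow> real \<Rightarrow> real" where
  "harmonic_lhs A g lam k f p \<rho> =
     laplacian (ambient_atlas A lam) (ambient_metric g lam)
       (\<lambda>(t, q, r). t powr gjms_weight A k * f q r) (1, p, \<rho>)"

text \<open>Smooth extensions \<open>f\<close> of \<open>f0\<close> whose derivatives of order at most \<open>k - 1\<close> at \<open>\<rho> = 0\<close> are the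
  ones dictated by the \<open>\<rho>\<close>-derivatives of orders \<open>0, \<dots>, k - 2\<close> of the equation.\<close>

definition harmonic_extension ::
  "('i, 'm, 'n::finite) atlas \<Rightarrow> ('i, 'n) tensor2 \<Rightarrow> real \<Rightarrow> nat \<Rightarrow>
     ('m \<Rightarrow> real) \<Rightarrow> ('m \<Rightarrow> real \<Rightarrow> real) \<Rightarrow> bool" where
  "harmonic_extension A g lam k f0 f \<longleftrightarrow>
     smooth_function (ambient_atlas A lam) (\<lambda>(t, p, \<rho>). f p \<rho>) \<and>
     (\<forall>p \<in> manifold_of A. f p 0 = f0 p) \<and>
     (\<forall>m < k - 1. \<forall>p \<in> manifold_of A. (deriv ^^ m) (harmonic_lhs A g lam k f p) 0 = 0)"

definition obstruction ::
  "('i, 'm, 'n::finite) atlas \<Rightarrow> ('i, 'n) tensor2 \<Rightarrow> real \<Rightarrow> nat \<Rightarrow>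
     ('m \<Rightarrow> real) \<Rightarrow> 'm \<Rightarrow> real" where
  "obstruction A g lam k f0 p =
     (THE v. \<exists>f. harmonic_extension A g lam k f0 f \<and>
                 v = (deriv ^^ (k - 1)) (harmonic_lhs A g lam k f p) 0)"

definition minus_laplacian ::
  "('i, 'm, 'n::finite) atlas \<Rightarrow> ('i, 'n) tensor2 \<Rightarrow> ('m \<Rightarrow> real) \<Rightarrow> 'm \<Rightarrow> real" where
  "minus_laplacian A g f p = - laplacian A g f p"

text \<open>\<open>gjms A g lam k\<close> is the operator \<open>P\<^sub>2\<^sub>k\<close>.\<close>

definition gjms ::
  "('i, 'm, 'n::finite) atlas \<Rightarrow> ('i, 'n) tensor2 \<Rightarrow> real \<Rightarrow> nat \<Rightarrow>
     ('m \<Rightarrow> real) \<Rightarrow> 'm \<Rightarrow> real" where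
  "gjms A g lam k f p =
     (THE c. same_principal_part A (2 * k)
               (\<lambda>h q. c * obstruction A g lam k h q) (minus_laplacian A g ^^ k))
     * obstruction A g lam k f p"

text \<open>The composition of \<open>L 1, \<dots>, L k\<close>, with \<open>L 1\<close> outermost.\<close>

definition op_prod :: "nat \<Rightarrow> (nat \<Rightarrow> ('m \<Rightarrow> real) \<Rightarrow> 'm \<Rightarrow> real) \<Rightarrow> ('m \<Rightarrow> real) \<Rightarrow> 'm \<Rightarrow> real" where
  "op_prod k L = foldr (\<lambda>j T. L j \<circ> T) [1..<Suc k] id"

end

theory Submission
  imports Defs
begin

text \<open>Put \<open>u = 1 + \<lambda>\<rho>\<close>, \<open>z = \<rho> / u\<close>, \<open>w = k - n/2\<close> and write the extension as \<open>f = u\<^sup>w h(z)\<close>. The equation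
  \<open>t\<^sup>2\<^sup>-\<^sup>w \<Delta>\<^sub>a\<^sub>m\<^sub>b (t\<^sup>w f) = 0\<close> becomes the hypergeometric equation
  \<open>- 2 z (1 - \<lambda> z) h'' + 2 (k - 1) (1 - 2 \<lambda> z) h' + (\<Delta> + \<lambda> w (2 k + n - 2)) h = 0\<close>,
  whose recursion for \<open>h = \<Sum> b\<^sub>m z\<^sup>m\<close> has only two terms:
  \<open>2 (m + 1) (k - m - 1) b\<^sub>m\<^sub>+\<^sub>1 = (- \<Delta> + 2 \<lambda> c\<^sub>k\<^sub>-\<^sub>m) b\<^sub>m\<close>. The truncation of the series at \<open>m < k\<close> solves the
  equation up to the single term \<open>u\<^sup>w\<^sup>-\<^sup>2 (\<Delta> - 2 \<lambda> c\<^sub>1) b\<^sub>k\<^sub>-\<^sub>1 z\<^sup>k\<^sup>-\<^sup>1\<close>, so the obstruction is a non-zero multiple of the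
  product of the operators \<open>- \<Delta> + 2 \<lambda> c\<^sub>j\<close>. The normalizing constant is unique because \<open>(- \<Delta>)\<^sup>k\<close> does
  not have order \<open>2 k - 1\<close>.\<close>

section \<open>Calculus of smooth functions\<close>

text \<open>Put r = t \<rho> and s = t + \<lambda> r = t u. The ambient metric becomes 2 dt dr + s^2
  g, and t^w f = s^w h(r / s): this is the origin of the factor u^w and of the variable z. For
  \<lambda> \<noteq> 0, exchanging t and \<lambda> r is the symmetry z -> 1/\<lambda> - z of the
  resulting equation. \<open>obstruction\<close> is a definite description, so an extension has to
  exist and the value must not depend on it. The truncated series is smooth wherever u > 0, hence a
  genuine extension and not only a formal jet. For independence, let the difference of two
  extensions vanish at \<rho> = 0 with its derivatives up to order m. The m-th derivative of the
  equation is then 2 (k - 1 - m) times the derivative of order m + 1. This factor is non-zero for m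
  < k - 1, which determines the jet, and zero at m = k - 1, which removes the free k-th derivative.
  The recursion applies the factor with c_k first and the one with c_1 last, which is the order of
  \<open>op_prod\<close>. The metric may be indefinite, so powers of the Laplacian need not be
  elliptic; their order is detected by a single covector that is not null.\<close>

lemma frechet_derivative_eqI:
  "(f has_derivative f') (at x) \<Longrightarrow> frechet_derivative f (at x) v = f' v"
  using frechet_derivative_at by metis

lemma frechet_derivative_has:
  "f differentiable at x \<Longrightarrow> (f has_derivative frechet_derivative f (at x)) (at x)"
  using frechet_derivative_works by blast

lemma differentiable_cong_open:
  assumes "open S" "x \<in> S" "\<And>y. y \<in> S \<Longrightarrow> f y = g y" "f differentiable at x"
  shows "g differentiable at x" "frechet_derivative g (at x) = frechet_derivative f (at x)"
proof -
  have "(g has_derivative frechet_derivative f (at x)) (at x)"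
    using has_derivative_transform_within_open[OF frechet_derivative_has[OF assms(4)] assms(1,2)] assms(3)
    by metis
  then show "g differentiable at x" "frechet_derivative g (at x) = frechet_derivative f (at x)"
    using frechet_derivative_at[of g] by (auto simp: differentiable_def)
qed

text \<open>Openness of \<open>S\<close> lets an identity on \<open>S\<close> be differentiated. The
  closure rules below rest on this: a derivative is exchanged for an explicit formula to which the
  induction hypothesis applies.\<close>

lemma C_k_on_cong:
  assumes "open S" "\<And>x. x \<in> S \<Longrightarrow> f x = g x" "C_k_on m S f"
  shows "C_k_on m S g"
  using assms(2,3)
proof (induction m arbitrary: f g)
  case 0
  then show ?case
    by (metis C_k_on.simps(1) continuous_on_cong)
next
  case (Suc m)
  then have d: "f differentiable at x" if "x \<in> S" for x
    using that by auto
  show ?case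
    unfolding C_k_on.simps
  proof (intro conjI ballI allI)
    show "g differentiable at x" if "x \<in> S" for x
      using differentiable_cong_open(1)[OF assms(1) that Suc.prems(1) d[OF that]] by blast
    show "C_k_on m S (\<lambda>x. frechet_derivative g (at x) v)" for v
    proof (rule Suc.IH)
      show "C_k_on m S (\<lambda>x. frechet_derivative f (at x) v)"
        using Suc.prems(2) by simp
      show "frechet_derivative f (at x) v = frechet_derivative g (at x) v" if "x \<in> S" for x
        using differentiable_cong_open(2)[OF assms(1) that Suc.prems(1) d[OF that]] by simp
    qed
  qed
qed

text \<open>Continuity at level 0 comes from differentiability. The product rule needs this
  monotonicity because the derivative of \<open>f * g\<close> still contains \<open>f\<close> and
  \<open>g\<close> undifferentiated.\<close>

lemma C_k_on_SucD: "C_k_on (Suc m) S f \<Longrightarrow> C_k_on m S f"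
proof (induction m arbitrary: f)
  case 0
  then show ?case
    by (auto intro!: continuous_at_imp_continuous_on differentiable_imp_continuous_within)
next
  case (Suc m)
  then show ?case by (auto simp del: C_k_on.simps simp: C_k_on.simps(2)[of _ S])
qed

lemma C_k_on_subset: "C_k_on m S f \<Longrightarrow> T \<subseteq> S \<Longrightarrow> C_k_on m T f"
  by (induction m arbitrary: f) (auto intro: continuous_on_subset)

lemma C_k_on_const: "C_k_on m S (\<lambda>x. c)"
  by (induction m arbitrary: c) auto

lemma C_k_on_add:
  assumes "open S" "C_k_on m S f" "C_k_on m S g"
  shows "C_k_on m S (\<lambda>x. f x + g x)"
  using assms(2,3)
proof (induction m arbitrary: f g)
  case 0
  then show ?case by (auto intro: continuous_intros)
next
  case (Suc m)
  have "C_k_on m S (\<lambda>x. frechet_derivative (\<lambda>x. f x + g x) (at x) v)" for v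
    by (rule C_k_on_cong[OF assms(1), where f = "\<lambda>x. frechet_derivative f (at x) v + frechet_derivative g (at x) v"])
      (use Suc in \<open>auto intro!: frechet_derivative_eqI[symmetric] has_derivative_add frechet_derivative_has\<close>)
  then show ?case
    using Suc by auto
qed

lemma C_k_on_mult:
  fixes f g :: "'a::real_normed_vector \<Rightarrow> real"
  assumes "open S" "C_k_on m S f" "C_k_on m S g"
  shows "C_k_on m S (\<lambda>x. f x * g x)"
  using assms(2,3)
proof (induction m arbitrary: f g)
  case 0
  then show ?case by (auto intro: continuous_intros)
next
  case (Suc m)
  have "C_k_on m S (\<lambda>x. frechet_derivative (\<lambda>x. f x * g x) (at x) v)" for v
  proof (rule C_k_on_cong[OF assms(1)])
    show "f x * frechet_derivative g (at x) v + frechet_derivative f (at x) v * g x =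
        frechet_derivative (\<lambda>x. f x * g x) (at x) v" if "x \<in> S" for x
      by (rule frechet_derivative_eqI[symmetric]) 
        (use Suc that in \<open>auto intro!: has_derivative_mult frechet_derivative_has\<close>)
    show "C_k_on m S (\<lambda>x. f x * frechet_derivative g (at x) v + frechet_derivative f (at x) v * g x)"
      using C_k_on_SucD[OF Suc.prems(1)] C_k_on_SucD[OF Suc.prems(2)] Suc.prems
      by (intro C_k_on_add[OF assms(1)] Suc.IH) auto
  qed
  then show ?case
    using Suc by auto
qed

text \<open>Smoothness is a fixed point of differentiation, so later arguments differentiate
  repeatedly without counting levels.\<close>

lemma smooth_on_iff:
  "smooth_on S f \<longleftrightarrow>
     (\<forall>x\<in>S. f differentiable at x) \<and> (\<forall>v. smooth_on S (\<lambda>x. frechet_derivative f (at x) v))"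
proof
  assume l: "smooth_on S f"
  have "C_k_on (Suc m) S f" for m
    using l unfolding smooth_on_def by blast
  then show "(\<forall>x\<in>S. f differentiable at x) \<and> (\<forall>v. smooth_on S (\<lambda>x. frechet_derivative f (at x) v))"
    unfolding smooth_on_def by simp
next
  assume r: "(\<forall>x\<in>S. f differentiable at x) \<and> (\<forall>v. smooth_on S (\<lambda>x. frechet_derivative f (at x) v))"
  show "smooth_on S f"
    unfolding smooth_on_def
  proof
    show "C_k_on m S f" for m
    proof (cases m)
      case 0
      then show ?thesis
        using r by (auto intro!: continuous_at_imp_continuous_on differentiable_imp_continuous_within)
    next
      case (Suc l)
      then show ?thesis using r by (simp add: smooth_on_def)
    qed
  qed
qed

lemma smooth_on_differentiable: "smooth_on S f \<Longrightarrow> x \<in> S \<Longrightarrow> f differentiable at x"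
  using smooth_on_iff by blast

lemma smooth_on_frechet: "smooth_on S f \<Longrightarrow> smooth_on S (\<lambda>x. frechet_derivative f (at x) v)"
  using smooth_on_iff by blast

lemma smooth_on_continuous: "smooth_on S f \<Longrightarrow> continuous_on S f"
  unfolding smooth_on_def using C_k_on.simps(1) by blast

lemma smooth_on_cong:
  assumes "open S" "\<And>x. x \<in> S \<Longrightarrow> f x = g x"
  shows "smooth_on S f \<longleftrightarrow> smooth_on S g"
  using C_k_on_cong[of S f g] C_k_on_cong[of S g f] assms unfolding smooth_on_def by metis

lemma smooth_on_subset: "smooth_on S f \<Longrightarrow> T \<subseteq> S \<Longrightarrow> smooth_on T f"
  using C_k_on_subset unfolding smooth_on_def by blast

lemma smooth_on_const: "smooth_on S (\<lambda>x. c)"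
  by (simp add: smooth_on_def C_k_on_const)

lemma smooth_on_linear:
  assumes "bounded_linear f"
  shows "smooth_on S f"
proof -
  have d: "(f has_derivative f) (at x)" for x
    by (rule bounded_linear_imp_has_derivative[OF assms])
  have 1: "\<forall>x\<in>S. f differentiable at x"
    using d differentiableI by blast
  have "frechet_derivative f (at x) v = f v" for x v
    by (rule frechet_derivative_eqI[OF d])
  then have "\<forall>v. smooth_on S (\<lambda>x. frechet_derivative f (at x) v)"
    by (simp add: smooth_on_const)
  with 1 show ?thesis
    by (subst smooth_on_iff) (rule conjI)
qed

lemma smooth_on_add: "open S \<Longrightarrow> smooth_on S f \<Longrightarrow> smooth_on S g \<Longrightarrow> smooth_on S (\<lambda>x. f x + g x)"
  by (simp add: smooth_on_def C_k_on_add)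

lemma smooth_on_mult:
  fixes f g :: "'a::real_normed_vector \<Rightarrow> real"
  shows "open S \<Longrightarrow> smooth_on S f \<Longrightarrow> smooth_on S g \<Longrightarrow> smooth_on S (\<lambda>x. f x * g x)"
  by (simp add: smooth_on_def C_k_on_mult)

lemma smooth_on_uminus:
  fixes f :: "'a::real_normed_vector \<Rightarrow> real"
  shows "open S \<Longrightarrow> smooth_on S f \<Longrightarrow> smooth_on S (\<lambda>x. - f x)"
  using smooth_on_mult[OF _ smooth_on_const[of S "-1::real"], of f] by simp

lemma smooth_on_diff:
  fixes f g :: "'a::real_normed_vector \<Rightarrow> real"
  shows "open S \<Longrightarrow> smooth_on S f \<Longrightarrow> smooth_on S g \<Longrightarrow> smooth_on S (\<lambda>x. f x - g x)"
  using smooth_on_add[OF _ _ smooth_on_uminus, of S f g] by simp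

lemma smooth_on_sum:
  "open S \<Longrightarrow> (\<And>i. i \<in> I \<Longrightarrow> smooth_on S (f i)) \<Longrightarrow> smooth_on S (\<lambda>x. \<Sum>i\<in>I. f i x)"
  by (induction I rule: infinite_finite_induct) (auto simp: smooth_on_const intro: smooth_on_add)

lemma smooth_on_prod:
  fixes f :: "'i \<Rightarrow> 'a::real_normed_vector \<Rightarrow> real"
  shows "open S \<Longrightarrow> (\<And>i. i \<in> I \<Longrightarrow> smooth_on S (f i)) \<Longrightarrow> smooth_on S (\<lambda>x. \<Prod>i\<in>I. f i x)"
  by (induction I rule: infinite_finite_induct) (auto simp: smooth_on_const intro: smooth_on_mult)

lemma smooth_on_power:
  fixes f :: "'a::real_normed_vector \<Rightarrow> real"
  shows "open S \<Longrightarrow> smooth_on S f \<Longrightarrow> smooth_on S (\<lambda>x. f x ^ m)"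
  by (induction m) (auto simp: smooth_on_const intro: smooth_on_mult)

text \<open>The derivative of \<open>g \<circ> f\<close> is a derivative of \<open>g\<close> in a
  direction that moves with \<open>x\<close>, whereas \<open>C_k_on\<close> speaks of fixed
  directions. Expanding along \<open>Basis\<close> gives a sum of products: derivatives of the
  components of \<open>f\<close> times derivatives of \<open>g\<close> in fixed directions. The
  induction hypothesis covers the latter after composition with \<open>f\<close>.\<close>

lemma smooth_on_compose:
  fixes f :: "'a::real_normed_vector \<Rightarrow> 'b::euclidean_space" and g :: "'b \<Rightarrow> real"
  assumes "open S" and f: "\<And>b. b \<in> Basis \<Longrightarrow> smooth_on S (\<lambda>x. f x \<bullet> b)"
    and "f ` S \<subseteq> T" and g: "smooth_on T g"
  shows "smooth_on S (\<lambda>x. g (f x))"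
proof -
  have fd: "f differentiable at x" if "x \<in> S" for x
    using smooth_on_differentiable[OF f that] by (simp add: differentiable_componentwise_within[of f x UNIV])
  have "C_k_on m S (\<lambda>x. g (f x))" if "C_k_on m T g" for m
    using that
  proof (induction m arbitrary: g)
    case 0
    have "continuous_on S f"
      using fd by (auto intro!: continuous_at_imp_continuous_on differentiable_imp_continuous_within)
    with 0 show ?case
      using assms(3) by (simp add: continuous_on_compose2[of T g S f])
  next
    case (Suc m)
    have gd: "g differentiable at (f x)" if "x \<in> S" for x
      using Suc.prems that assms(3) by (simp add: image_subset_iff)
    have hd: "((\<lambda>x. g (f x)) has_derivative 
       (\<lambda>v. frechet_derivative g (at (f x)) (frechet_derivative f (at x) v))) (at x)" if "x \<in> S" for x
      using has_derivative_compose[OF frechet_derivative_has[OF fd[OF that]] frechet_derivative_has[OF gd[OF that]]] .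
    have "C_k_on m S (\<lambda>x. frechet_derivative (\<lambda>x. g (f x)) (at x) v)" for v
    proof (rule C_k_on_cong[OF assms(1)])
      show "(\<Sum>b\<in>Basis. frechet_derivative (\<lambda>x. f x \<bullet> b) (at x) v * frechet_derivative g (at (f x)) b)
        = frechet_derivative (\<lambda>x. g (f x)) (at x) v" if "x \<in> S" for x
      proof -
        have l: "linear (frechet_derivative g (at (f x)))"
          using gd[OF that] linear_frechet_derivative by blast
        have "frechet_derivative (\<lambda>x. f x \<bullet> b) (at x) v = frechet_derivative f (at x) v \<bullet> b" for b
          by (rule frechet_derivative_eqI, intro has_derivative_inner_left frechet_derivative_has fd that)
        then have "(\<Sum>b\<in>Basis. frechet_derivative (\<lambda>x. f x \<bullet> b) (at x) v * frechet_derivative g (at (f x)) b)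
          = frechet_derivative g (at (f x)) (\<Sum>b\<in>Basis. (frechet_derivative f (at x) v \<bullet> b) *\<^sub>R b)"
          by (simp add: linear_sum[OF l] linear_scale[OF l])
        then show ?thesis
          by (simp add: euclidean_representation frechet_derivative_eqI[OF hd[OF that], of v])
      qed
      have *: "C_k_on m S (\<lambda>x. \<Sum>b\<in>B. frechet_derivative (\<lambda>x. f x \<bullet> b) (at x) v * frechet_derivative g (at (f x)) b)"
        if "finite B" "B \<subseteq> Basis" for B
        using that
      proof (induction B)
        case empty
        then show ?case by (simp add: C_k_on_const)
      next
        case (insert b B)
        have "C_k_on m S (\<lambda>x. frechet_derivative (\<lambda>x. f x \<bullet> b) (at x) v)"
          using smooth_on_frechet[OF f] insert.prems unfolding smooth_on_def by blast
        moreover have "C_k_on m S (\<lambda>x. frechet_derivative g (at (f x)) b)"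
          by (rule Suc.IH) (use Suc.prems in simp)
        ultimately show ?case
          using insert by (simp add: C_k_on_add C_k_on_mult assms(1))
      qed
      show "C_k_on m S (\<lambda>x. \<Sum>b\<in>Basis. frechet_derivative (\<lambda>x. f x \<bullet> b) (at x) v * frechet_derivative g (at (f x)) b)"
        by (rule *[OF finite_Basis subset_refl])
    qed
    then show ?case
      using hd unfolding C_k_on.simps differentiable_def by blast
  qed
  then show ?thesis
    using g unfolding smooth_on_def by blast
qed


lemma smooth_on_inner_left:
  assumes "open S" "smooth_on S f"
  shows "smooth_on S (\<lambda>x. f x \<bullet> b)"
proof -
  have "C_k_on m S (\<lambda>x. f x \<bullet> b)" if "C_k_on m S f" for m
    using that
  proof (induction m arbitrary: f)
    case 0
    then show ?case by (auto intro: continuous_intros)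
  next
    case (Suc m)
    have hd: "((\<lambda>x. f x \<bullet> b) has_derivative (\<lambda>v. frechet_derivative f (at x) v \<bullet> b)) (at x)" if "x \<in> S" for x
      by (intro has_derivative_inner_left frechet_derivative_has) (use Suc that in auto)
    have "C_k_on m S (\<lambda>x. frechet_derivative (\<lambda>x. f x \<bullet> b) (at x) v)" for v
      by (rule C_k_on_cong[OF assms(1), where f = "\<lambda>x. frechet_derivative f (at x) v \<bullet> b"])
        (use Suc frechet_derivative_eqI[OF hd] in auto)
    then show ?case
      using hd by (auto simp: differentiable_def)
  qed
  then show ?thesis
    using assms(2) unfolding smooth_on_def by blast
qed

text \<open>The derivative of \<open>1 / f\<close> contains \<open>1 / f\<close> again, so the
  induction runs over the level with \<open>f\<close> fixed and otherwise uses only that the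
  derivatives of \<open>f\<close> are smooth.\<close>

lemma smooth_on_inverse:
  fixes f :: "'a::real_normed_vector \<Rightarrow> real"
  assumes "open S" "smooth_on S f" "\<And>x. x \<in> S \<Longrightarrow> f x \<noteq> 0"
  shows "smooth_on S (\<lambda>x. inverse (f x))"
  unfolding smooth_on_def
proof
  have hd: "((\<lambda>x. inverse (f x)) has_derivative 
      (\<lambda>v. - (inverse (f x) * frechet_derivative f (at x) v * inverse (f x)))) (at x)" if "x \<in> S" for x
    by (intro Deriv.has_derivative_inverse frechet_derivative_has smooth_on_differentiable[OF assms(2)] assms(3) that)
  show "C_k_on m S (\<lambda>x. inverse (f x))" for m
  proof (induction m)
    case 0
    then show ?case
      using assms(3) by (auto intro!: continuous_on_inverse smooth_on_continuous[OF assms(2)])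
  next
    case (Suc m)
    have "C_k_on m S (\<lambda>x. frechet_derivative (\<lambda>x. inverse (f x)) (at x) v)" for v
    proof (rule C_k_on_cong[OF assms(1)])
      show "(-1) * (inverse (f x) * frechet_derivative f (at x) v * inverse (f x)) =
         frechet_derivative (\<lambda>x. inverse (f x)) (at x) v" if "x \<in> S" for x
        using frechet_derivative_eqI[OF hd[OF that], of v] by simp
      show "C_k_on m S (\<lambda>x. (-1) * (inverse (f x) * frechet_derivative f (at x) v * inverse (f x)))"
        using smooth_on_frechet[OF assms(2)] Suc
        by (intro C_k_on_mult assms(1) C_k_on_const) (simp_all add: smooth_on_def)
    qed
    then show ?case
      using hd by (auto simp: differentiable_def)
  qed
qed

lemma smooth_on_divide:
  fixes f g :: "'a::real_normed_vector \<Rightarrow> real"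
  assumes "open S" "smooth_on S f" "smooth_on S g" "\<And>x. x \<in> S \<Longrightarrow> g x \<noteq> 0"
  shows "smooth_on S (\<lambda>x. f x / g x)"
  using smooth_on_mult[OF assms(1,2) smooth_on_inverse[OF assms(1,3,4)]] by (simp add: divide_inverse)

text \<open>Differentiation lowers the exponent, hence the induction is over all \<open>a\<close> at
  once.\<close>

lemma smooth_on_powr:
  fixes f :: "'a::real_normed_vector \<Rightarrow> real"
  assumes "open S" "smooth_on S f" "\<And>x. x \<in> S \<Longrightarrow> f x > 0"
  shows "smooth_on S (\<lambda>x. f x powr a)"
proof -
  have hd: "((\<lambda>x. f x powr a) has_derivative 
      (\<lambda>v. a * f x powr (a - 1) * frechet_derivative f (at x) v)) (at x)" if "x \<in> S" for x a
  proof -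
    have "((\<lambda>y. y powr a) has_derivative (*) (a * f x powr (a - 1))) (at (f x))"
      using has_real_derivative_powr[OF assms(3)[OF that], of a] by (simp add: has_field_derivative_def)
    from has_derivative_compose[OF frechet_derivative_has[OF smooth_on_differentiable[OF assms(2) that]] this]
    show ?thesis .
  qed
  have "C_k_on m S (\<lambda>x. f x powr a)" for m
  proof (induction m arbitrary: a)
    case 0
    then show ?case
      using assms(3) by (auto intro!: continuous_on_powr smooth_on_continuous[OF assms(2)] simp: less_imp_neq)
       (metis less_irrefl)
  next
    case (Suc m)
    have "C_k_on m S (\<lambda>x. frechet_derivative (\<lambda>x. f x powr a) (at x) v)" for v
    proof (rule C_k_on_cong[OF assms(1)])
      show "a * f x powr (a - 1) * frechet_derivative f (at x) v =
         frechet_derivative (\<lambda>x. f x powr a) (at x) v" if "x \<in> S" for x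
        using frechet_derivative_eqI[OF hd[OF that], of a v] by simp
      show "C_k_on m S (\<lambda>x. a * f x powr (a - 1) * frechet_derivative f (at x) v)"
        using smooth_on_frechet[OF assms(2)] Suc
        by (auto simp: smooth_on_def intro!: C_k_on_mult assms(1) C_k_on_const)
    qed
    then show ?case
      using hd by (auto simp: differentiable_def)
  qed
  then show ?thesis
    by (simp add: smooth_on_def)
qed

section \<open>Symmetry of mixed second derivatives\<close>

lemma second_difference_mvt:
  fixes f :: "'a::real_normed_vector \<Rightarrow> real"
  assumes "smooth_on S f" "ball x r \<subseteq> S" "h > 0" "h * (norm u + norm v) < r"
  shows "\<exists>y\<in>ball x r. f (x + h *\<^sub>R u + h *\<^sub>R v) - f (x + h *\<^sub>R u) - f (x + h *\<^sub>R v) + f x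
     = h * h * frechet_derivative (\<lambda>y. frechet_derivative f (at y) u) (at y) v"
proof -
  have line: "((\<lambda>s. g (a + s *\<^sub>R w)) has_real_derivative frechet_derivative g (at (a + s *\<^sub>R w)) w) (at s)"
    if "smooth_on S g" "a + s *\<^sub>R w \<in> S" for g :: "'a \<Rightarrow> real" and a w s
  proof -
    have g: "(g has_derivative frechet_derivative g (at (a + s *\<^sub>R w))) (at (a + s *\<^sub>R w))"
      by (intro frechet_derivative_has smooth_on_differentiable[OF that(1)] that(2))
    have "((\<lambda>s. a + s *\<^sub>R w) has_derivative (\<lambda>h. h *\<^sub>R w)) (at s)"
      by (auto intro!: derivative_eq_intros)
    from has_derivative_compose[OF this g]
    show ?thesis
      using linear_scale[OF has_derivative_linear[OF g]]
      by (simp add: has_field_derivative_def mult_commute_abs)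
  qed
  have inb: "x + s *\<^sub>R u + t *\<^sub>R v \<in> ball x r" if "0 \<le> s" "s \<le> h" "0 \<le> t" "t \<le> h" for s t
  proof -
    have "norm (s *\<^sub>R u + t *\<^sub>R v) \<le> s * norm u + t * norm v"
      using norm_triangle_ineq[of "s *\<^sub>R u" "t *\<^sub>R v"] that by simp
    also have "\<dots> \<le> h * norm u + h * norm v"
      using that by (intro add_mono mult_right_mono) auto
    finally show ?thesis
      using assms(4) by (simp add: dist_norm norm_minus_commute algebra_simps)
  qed
  define fu where "fu = (\<lambda>y. frechet_derivative f (at y) u)"
  have fu: "smooth_on S fu"
    unfolding fu_def by (rule smooth_on_frechet[OF assms(1)])
  \<comment> \<open>The mean value theorem is used twice: first for the increment in direction
    \<open>v\<close> as a function of the parameter \<open>s\<close> along \<open>u\<close>, then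
    for the derivative in direction \<open>u\<close> along \<open>v\<close>.\<close>
  have d1: "((\<lambda>s. f (x + h *\<^sub>R v + s *\<^sub>R u) - f (x + s *\<^sub>R u)) has_real_derivative
      fu (x + h *\<^sub>R v + s *\<^sub>R u) - fu (x + s *\<^sub>R u)) (at s)" if "0 \<le> s" "s \<le> h" for s
    unfolding fu_def
    using inb[of s h] inb[of s 0] that assms(2,3)
    by (intro DERIV_diff line[OF assms(1)]) (auto simp: algebra_simps)
  obtain s where s: "0 < s" "s < h" and
    1: "(f (x + h *\<^sub>R v + h *\<^sub>R u) - f (x + h *\<^sub>R u)) - (f (x + h *\<^sub>R v + 0 *\<^sub>R u) - f (x + 0 *\<^sub>R u))
       = (h - 0) * (fu (x + h *\<^sub>R v + s *\<^sub>R u) - fu (x + s *\<^sub>R u))"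
    using MVT2[OF assms(3) d1] by blast
  have d2: "((\<lambda>t. fu (x + s *\<^sub>R u + t *\<^sub>R v)) has_real_derivative
      frechet_derivative fu (at (x + s *\<^sub>R u + t *\<^sub>R v)) v) (at t)" if "0 \<le> t" "t \<le> h" for t
    using inb[of s t] s that assms(2) by (intro line[OF fu]) auto
  obtain t where t: "0 < t" "t < h" and
    2: "fu (x + s *\<^sub>R u + h *\<^sub>R v) - fu (x + s *\<^sub>R u + 0 *\<^sub>R v)
       = (h - 0) * frechet_derivative fu (at (x + s *\<^sub>R u + t *\<^sub>R v)) v"
    using MVT2[OF assms(3) d2] by blast
  have e: "x + h *\<^sub>R v + s *\<^sub>R u = x + s *\<^sub>R u + h *\<^sub>R v" "x + h *\<^sub>R v + h *\<^sub>R u = x + h *\<^sub>R u + h *\<^sub>R v"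
    by (simp_all add: algebra_simps)
  have "f (x + h *\<^sub>R u + h *\<^sub>R v) - f (x + h *\<^sub>R u) - f (x + h *\<^sub>R v) + f x
     = h * h * frechet_derivative fu (at (x + s *\<^sub>R u + t *\<^sub>R v)) v"
    using 1 2 unfolding e by (simp add: algebra_simps)
  moreover have "x + s *\<^sub>R u + t *\<^sub>R v \<in> ball x r"
    using inb[of s t] s t by simp
  ultimately show ?thesis
    unfolding fu_def by blast
qed

text \<open>The second difference over a parallelogram is symmetric in \<open>u\<close> and
  \<open>v\<close>, and by the mean value theorem it is h^2 times either mixed derivative at some
  nearby point. Continuity of both mixed derivatives then excludes a gap between them at
  \<open>x\<close>.\<close>

lemma frechet_derivative_commute:
  fixes f :: "'a::real_normed_vector \<Rightarrow> real"
  assumes "open S" "smooth_on S f" "x \<in> S"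
  shows "frechet_derivative (\<lambda>y. frechet_derivative f (at y) u) (at x) v =
         frechet_derivative (\<lambda>y. frechet_derivative f (at y) v) (at x) u"
proof (rule ccontr)
  define D where "D = (\<lambda>u v y. frechet_derivative (\<lambda>y. frechet_derivative f (at y) u) (at y) v)"
  assume "\<not> ?thesis"
  then have ne: "D u v x \<noteq> D v u x"
    by (simp add: D_def)
  have D: "isCont (D a b) x" for a b
    using smooth_on_continuous[OF smooth_on_frechet[OF smooth_on_frechet[OF assms(2)]]] assms(1,3)
    unfolding D_def by (metis continuous_on_eq_continuous_at)
  \<comment> \<open>Half the gap: the two equal values found below would lie within \<open>e\<close>
    of two numbers that are \<open>2 * e\<close> apart.\<close>
  define e where "e = \<bar>D u v x - D v u x\<bar> / 2"
  have "e > 0" using ne by (simp add: e_def)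
  obtain r1 where r1: "r1 > 0" "\<And>y. dist y x < r1 \<Longrightarrow> dist (D u v y) (D u v x) < e"
    using D[of u v] \<open>e > 0\<close> unfolding continuous_at_eps_delta by blast
  obtain r2 where r2: "r2 > 0" "\<And>y. dist y x < r2 \<Longrightarrow> dist (D v u y) (D v u x) < e"
    using D[of v u] \<open>e > 0\<close> unfolding continuous_at_eps_delta by blast
  obtain r3 where r3: "r3 > 0" "ball x r3 \<subseteq> S"
    using assms(1,3) openE by blast
  define r where "r = min r1 (min r2 r3)"
  have r: "r > 0" "ball x r \<subseteq> S"
    using r1 r2 r3 by (auto simp: r_def)
  \<comment> \<open>The summand 1 keeps the denominator positive when \<open>u\<close> and
    \<open>v\<close> are both zero.\<close>
  define h where "h = r / (2 * (norm u + norm v + 1))"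
  have h: "h > 0" 
    using r(1) unfolding h_def by (intro divide_pos_pos) (auto intro: add_nonneg_pos)
  have half: "r / (2 * w) * w = r / 2" if "w > 0" for w
    using that by simp
  have "h * (norm u + norm v) \<le> h * (norm u + norm v + 1)"
    using h by simp
  also have "\<dots> = r / 2"
    unfolding h_def by (rule half) (auto intro: add_nonneg_pos)
  finally have h2: "h * (norm u + norm v) < r" "h * (norm v + norm u) < r"
    using r(1) by (auto simp: add.commute)
  obtain y where y: "y \<in> ball x r" 
    "f (x + h *\<^sub>R u + h *\<^sub>R v) - f (x + h *\<^sub>R u) - f (x + h *\<^sub>R v) + f x = h * h * D u v y"
    using second_difference_mvt[OF assms(2) r(2) h h2(1)] unfolding D_def by blast
  obtain z where z: "z \<in> ball x r" 
    "f (x + h *\<^sub>R v + h *\<^sub>R u) - f (x + h *\<^sub>R v) - f (x + h *\<^sub>R u) + f x = h * h * D v u z"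
    using second_difference_mvt[OF assms(2) r(2) h h2(2)] unfolding D_def by blast
  have e: "x + h *\<^sub>R v + h *\<^sub>R u = x + h *\<^sub>R u + h *\<^sub>R v"
    by simp
  have "h * h * D u v y = h * h * D v u z"
    using y(2) z(2)[unfolded e] by linarith
  then have "D u v y = D v u z"
    using h by simp
  moreover have "\<bar>D u v y - D u v x\<bar> < e" "\<bar>D v u z - D v u x\<bar> < e"
    using y(1) z(1) r1(2)[of y] r2(2)[of z] by (auto simp: r_def dist_real_def dist_commute)
  moreover have "2 * e = \<bar>D u v x - D v u x\<bar>"
    by (simp add: e_def)
  ultimately show False
    by linarith
qed

subsection \<open>Partial derivatives\<close>

lemma pd_eqI: "(f has_derivative f') (at x) \<Longrightarrow> pd i f x = f' (axis i 1)"
  unfolding pd_def by (rule frechet_derivative_eqI)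

lemma smooth_on_pd: "smooth_on S f \<Longrightarrow> smooth_on S (pd i f)"
  unfolding pd_def[abs_def] by (rule smooth_on_frechet)

text \<open>No differentiability is assumed: \<open>frechet_derivative\<close> is a choice among all
  derivatives at \<open>x\<close>, and both functions have the same ones, possibly none.\<close>

lemma pd_cong:
  assumes "open S" "x \<in> S" "\<And>y. y \<in> S \<Longrightarrow> f y = g y"
  shows "pd i f x = pd i g x"
proof -
  have "(f has_derivative D) (at x) \<longleftrightarrow> (g has_derivative D) (at x)" for D
    using has_derivative_transform_within_open[OF _ assms(1,2)] assms(3) by metis
  then show ?thesis
    unfolding pd_def frechet_derivative_def by simp
qed

lemma pd_const [simp]: "pd i (\<lambda>x. c) x = 0"
  by (simp add: pd_def)

lemma pd_add:
  "f differentiable at x \<Longrightarrow> g differentiable at x \<Longrightarrow> pd i (\<lambda>x. f x + g x) x = pd i f x + pd i g x"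
  unfolding pd_def by (intro frechet_derivative_eqI has_derivative_add frechet_derivative_has)

lemma pd_diff:
  "f differentiable at x \<Longrightarrow> g differentiable at x \<Longrightarrow> pd i (\<lambda>x. f x - g x) x = pd i f x - pd i g x"
  unfolding pd_def by (intro frechet_derivative_eqI has_derivative_diff frechet_derivative_has)

lemma pd_mult:
  "f differentiable at x \<Longrightarrow> g differentiable at x \<Longrightarrow> pd i (\<lambda>x. f x * g x) x = f x * pd i g x + pd i f x * g x"
  unfolding pd_def by (intro frechet_derivative_eqI has_derivative_mult frechet_derivative_has)

lemma pd_sum:
  "(\<And>j. j \<in> I \<Longrightarrow> f j differentiable at x) \<Longrightarrow> pd i (\<lambda>x. \<Sum>j\<in>I. f j x) x = (\<Sum>j\<in>I. pd i (f j) x)"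
  unfolding pd_def by (intro frechet_derivative_eqI has_derivative_sum frechet_derivative_has)

lemma pd_cmult:
  "f differentiable at x \<Longrightarrow> pd i (\<lambda>x. c * f x) x = c * pd i f x"
  unfolding pd_def by (intro frechet_derivative_eqI has_derivative_mult_right frechet_derivative_has)

lemma pd_compose:
  fixes f :: "real^'n::finite \<Rightarrow> real^'m::finite"
  assumes f: "\<And>j. (\<lambda>x. f x $ j) differentiable at x" and g: "g differentiable at (f x)"
  shows "pd i (\<lambda>x. g (f x)) x = (\<Sum>j\<in>UNIV. pd j g (f x) * pd i (\<lambda>x. f x $ j) x)"
proof -
  let ?g = "frechet_derivative g (at (f x))"
  have "(f has_derivative (\<lambda>v. \<chi> j. frechet_derivative (\<lambda>x. f x $ j) (at x) v)) (at x)"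
    by (subst has_derivative_componentwise_within)
      (use frechet_derivative_has[OF f] in \<open>auto simp: Basis_vec_def inner_axis\<close>)
  from has_derivative_compose[OF this frechet_derivative_has[OF g]]
  have "pd i (\<lambda>x. g (f x)) x = ?g (\<chi> j. pd i (\<lambda>x. f x $ j) x)"
    by (subst pd_eqI) (auto simp: pd_def)
  also have "(\<chi> j. pd i (\<lambda>x. f x $ j) x) = (\<Sum>j\<in>UNIV. pd i (\<lambda>x. f x $ j) x *\<^sub>R axis j 1)"
    by (simp add: vec_eq_iff axis_def if_distrib cong: if_cong)
  also have "?g \<dots> = (\<Sum>j\<in>UNIV. pd i (\<lambda>x. f x $ j) x *\<^sub>R ?g (axis j 1))"
    using linear_frechet_derivative[OF g] by (simp add: linear_sum linear_scale)
  finally show ?thesis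
    by (simp add: pd_def mult.commute)
qed

lemma pd_commute:
  "open S \<Longrightarrow> smooth_on S f \<Longrightarrow> x \<in> S \<Longrightarrow> pd i (pd j f) x = pd j (pd i f) x"
  unfolding pd_def[abs_def] by (rule frechet_derivative_commute)

lemma pds_Nil [simp]: "pds [] f = f"
  and pds_Cons [simp]: "pds (i # l) f = pd i (pds l f)"
  by (simp_all add: pds_def)

lemma smooth_on_pds: "smooth_on S f \<Longrightarrow> smooth_on S (pds l f)"
  by (induction l) (auto intro: smooth_on_pd)

lemma pds_cong:
  assumes "open S" "\<And>y. y \<in> S \<Longrightarrow> f y = g y" "x \<in> S"
  shows "pds l f x = pds l g x"
  using assms(3) by (induction l arbitrary: x) (auto intro: assms(2) pd_cong[OF assms(1)])

lemma pd_pds_commute: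
  assumes "open S" "smooth_on S f" "x \<in> S"
  shows "pd i (pds l f) x = pds l (pd i f) x"
  using assms(3)
proof (induction l arbitrary: x)
  case (Cons j l)
  have "pd i (pds (j # l) f) x = pd j (pd i (pds l f)) x"
    using pd_commute[OF assms(1) smooth_on_pds[OF assms(2)] Cons.prems] by simp
  also have "\<dots> = pd j (pds l (pd i f)) x"
    by (rule pd_cong[OF assms(1) Cons.prems Cons.IH])
  finally show ?case by simp
qed simp

lemma smooth_on_vec_nth: "smooth_on S (\<lambda>x::real^'n::finite. x $ i)"
  by (rule smooth_on_linear) (rule bounded_linear_vec_nth)

lemma pd_vec_nth [simp]: "pd i (\<lambda>x::real^'n::finite. x $ j) x = (if i = j then 1 else 0)"
  by (subst pd_eqI[OF bounded_linear_imp_has_derivative[OF bounded_linear_vec_nth]]) (simp add: axis_def)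

lemma smooth_on_compose_vec:
  fixes f :: "'a::real_normed_vector \<Rightarrow> real^'n::finite" and g :: "real^'n \<Rightarrow> real"
  assumes "open S" "\<And>j. smooth_on S (\<lambda>x. f x $ j)" "f ` S \<subseteq> T" "smooth_on T g"
  shows "smooth_on S (\<lambda>x. g (f x))"
  by (rule smooth_on_compose[OF assms(1) _ assms(3,4)]) (use assms(2) in \<open>auto simp: Basis_vec_def inner_axis\<close>)

lemma smooth_on_nth:
  fixes f :: "'a::real_normed_vector \<Rightarrow> real^'n::finite"
  shows "open S \<Longrightarrow> smooth_on S f \<Longrightarrow> smooth_on S (\<lambda>x. f x $ j)"
  using smooth_on_inner_left[of S f "axis j 1"] by (simp add: inner_axis)

subsection \<open>Higher derivatives in one variable\<close>

lemma smooth_on_deriv: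
  fixes f :: "real \<Rightarrow> real"
  assumes "open S" "smooth_on S f"
  shows "smooth_on S (deriv f)"
    and "x \<in> S \<Longrightarrow> (f has_field_derivative deriv f x) (at x)"
proof -
  have d: "(f has_field_derivative frechet_derivative f (at x) 1) (at x)" if "x \<in> S" for x
  proof -
    let ?D = "frechet_derivative f (at x)"
    have h: "(f has_derivative ?D) (at x)"
      by (intro frechet_derivative_has smooth_on_differentiable[OF assms(2) that])
    have "?D v = ?D 1 * v" for v
      using linear_scale[OF has_derivative_linear[OF h], of v 1] by (simp add: mult.commute)
    then have "?D = (*) (?D 1)"
      by (rule ext)
    then show ?thesis
      unfolding has_field_derivative_def using h by metis
  qed
  then have e: "deriv f x = frechet_derivative f (at x) 1" if "x \<in> S" for x
    using that DERIV_imp_deriv by blast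
  show "smooth_on S (deriv f)"
    by (rule iffD2[OF smooth_on_cong[OF assms(1) e] smooth_on_frechet[OF assms(2), of 1]])
  show "x \<in> S \<Longrightarrow> (f has_field_derivative deriv f x) (at x)"
    using d e by simp
qed

lemma smooth_on_higher_deriv:
  fixes f :: "real \<Rightarrow> real"
  assumes "open S" "smooth_on S f"
  shows "smooth_on S ((deriv ^^ m) f)"
  by (induction m) (auto simp: assms smooth_on_deriv)

lemma higher_deriv_cong:
  fixes f :: "real \<Rightarrow> real"
  assumes "open S" "\<And>x. x \<in> S \<Longrightarrow> f x = g x" "x \<in> S"
  shows "(deriv ^^ m) f x = (deriv ^^ m) g x"
  using assms(3)
proof (induction m arbitrary: x)
  case (Suc m)
  have "\<forall>\<^sub>F y in nhds x. (deriv ^^ m) f y = (deriv ^^ m) g y"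
    using eventually_nhds_in_open[OF assms(1) Suc.prems] by eventually_elim (rule Suc.IH)
  then show ?case
    using deriv_cong_ev by auto
qed (use assms in auto)

lemma higher_deriv_Suc': "(deriv ^^ Suc m) f = (deriv ^^ m) (deriv f)"
  by (simp add: funpow_swap1)

lemma higher_deriv_add:
  fixes f g :: "real \<Rightarrow> real"
  assumes "open S" "smooth_on S f" "smooth_on S g" "x \<in> S"
  shows "(deriv ^^ m) (\<lambda>x. f x + g x) x = (deriv ^^ m) f x + (deriv ^^ m) g x"
  using assms(2,3)
proof (induction m arbitrary: f g)
  case (Suc m)
  have "(deriv ^^ m) (deriv (\<lambda>x. f x + g x)) x = (deriv ^^ m) (\<lambda>x. deriv f x + deriv g x) x"
    by (rule higher_deriv_cong[OF assms(1) _ assms(4)])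
      (intro DERIV_imp_deriv DERIV_add smooth_on_deriv(2)[OF assms(1)] Suc.prems)
  also have "\<dots> = (deriv ^^ m) (deriv f) x + (deriv ^^ m) (deriv g) x"
    by (intro Suc.IH smooth_on_deriv(1) assms(1) Suc.prems)
  finally show ?case
    by (simp only: higher_deriv_Suc')
qed auto

text \<open>The Leibniz rule with first factor \<open>x\<close> stops after two terms. At 0 it
  leaves \<open>m\<close> times the derivative of order \<open>m - 1\<close>, which is the
  contribution of the singular term \<rho> f'' of the equation.\<close>

lemma higher_deriv_mult_left:
  fixes f :: "real \<Rightarrow> real"
  assumes "open S" "smooth_on S f" "x \<in> S"
  shows "(deriv ^^ m) (\<lambda>x. x * f x) x = x * (deriv ^^ m) f x + real m * (deriv ^^ (m - 1)) f x"
  using assms(3)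
proof (induction m arbitrary: x)
  case (Suc m)
  have *: "((deriv ^^ j) f has_field_derivative (deriv ^^ Suc j) f x) (at x)" for j
    using smooth_on_deriv(2)[OF assms(1) smooth_on_higher_deriv[OF assms(1,2)] Suc.prems] by simp
  have "(deriv ^^ Suc m) (\<lambda>x. x * f x) x =
      deriv (\<lambda>x. x * (deriv ^^ m) f x + real m * (deriv ^^ (m - 1)) f x) x"
    using higher_deriv_cong[OF assms(1) Suc.IH Suc.prems, where m = 1] by simp
  also have "\<dots> = x * (deriv ^^ Suc m) f x + real (Suc m) * (deriv ^^ m) f x"
  proof (rule DERIV_imp_deriv)
    \<comment> \<open>At \<open>m = 0\<close> the truncated index \<open>m - 1\<close> is wrong, but
      the factor \<open>real m\<close> vanishes.\<close>
    have "real m * (deriv ^^ Suc (m - 1)) f x = real m * (deriv ^^ m) f x"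
      by (cases m) auto
    then show "((\<lambda>x. x * (deriv ^^ m) f x + real m * (deriv ^^ (m - 1)) f x) has_field_derivative
        x * (deriv ^^ Suc m) f x + real (Suc m) * (deriv ^^ m) f x) (at x)"
      by (auto intro!: derivative_eq_intros * simp del: funpow.simps simp: algebra_simps)
  qed
  finally show ?case by simp
qed simp

lemma higher_deriv_cmult:
  fixes f :: "real \<Rightarrow> real"
  assumes "open S" "smooth_on S f" "x \<in> S"
  shows "(deriv ^^ m) (\<lambda>x. c * f x) x = c * (deriv ^^ m) f x"
  using assms(2)
proof (induction m arbitrary: f)
  case (Suc m)
  have "(deriv ^^ m) (deriv (\<lambda>x. c * f x)) x = (deriv ^^ m) (\<lambda>x. c * deriv f x) x"
    by (rule higher_deriv_cong[OF assms(1) _ assms(3)])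
      (intro DERIV_imp_deriv DERIV_cmult smooth_on_deriv(2)[OF assms(1)] Suc.prems)
  also have "\<dots> = c * (deriv ^^ m) (deriv f) x"
    by (intro Suc.IH smooth_on_deriv(1) assms(1) Suc.prems)
  finally show ?case
    by (simp only: higher_deriv_Suc')
qed auto

text \<open>At a zero of order \<open>N\<close> only the Leibniz term with all derivatives on
  \<open>f\<close> survives. The first part extracts the leading coefficient of a function \<rho>^K
  \<psi>(\<rho>); the second one discards the regular terms of the equation at \<rho> = 0.\<close>

lemma higher_deriv_mult_vanishing:
  fixes f g :: "real \<Rightarrow> real"
  assumes "open S" "smooth_on S f" "smooth_on S g" "x \<in> S"
    and "\<And>j. j < N \<Longrightarrow> (deriv ^^ j) f x = 0"
  shows "(deriv ^^ N) (\<lambda>x. f x * g x) x = (deriv ^^ N) f x * g x"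
    and "j < N \<Longrightarrow> (deriv ^^ j) (\<lambda>x. f x * g x) x = 0"
proof -
  have *: "(deriv ^^ N) (\<lambda>x. f x * g x) x = (deriv ^^ N) f x * g x"
    if "smooth_on S f" "smooth_on S g" "\<And>j. j < N \<Longrightarrow> (deriv ^^ j) f x = 0" for N and f g :: "real \<Rightarrow> real"
    using that
  proof (induction N arbitrary: f g)
    case (Suc N)
    have "(deriv ^^ Suc N) (\<lambda>x. f x * g x) x = (deriv ^^ N) (deriv (\<lambda>x. f x * g x)) x"
      by (simp only: higher_deriv_Suc')
    also have "\<dots> = (deriv ^^ N) (\<lambda>x. deriv f x * g x + f x * deriv g x) x"
      by (rule higher_deriv_cong[OF assms(1) _ assms(4)], rule DERIV_imp_deriv)
        (auto intro!: derivative_eq_intros smooth_on_deriv(2)[OF assms(1)] Suc.prems)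
    also have "\<dots> = (deriv ^^ N) (\<lambda>x. deriv f x * g x) x + (deriv ^^ N) (\<lambda>x. f x * deriv g x) x"
      by (intro higher_deriv_add[OF assms(1)] smooth_on_mult smooth_on_deriv(1) assms Suc.prems)
    also have "(deriv ^^ N) (\<lambda>x. deriv f x * g x) x = (deriv ^^ N) (deriv f) x * g x"
    proof (intro Suc.IH smooth_on_deriv(1) assms(1) Suc.prems)
      show "(deriv ^^ j) (deriv f) x = 0" if "j < N" for j
        using Suc.prems(3)[of "Suc j"] that by (simp only: higher_deriv_Suc')
    qed
    also have "(deriv ^^ N) (\<lambda>x. f x * deriv g x) x = (deriv ^^ N) f x * deriv g x"
      by (intro Suc.IH smooth_on_deriv(1) assms(1) Suc.prems) (use Suc.prems(3) in auto)
    also have "(deriv ^^ N) f x = 0"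
      using Suc.prems(3) by auto
    finally show ?case
      by (simp only: higher_deriv_Suc')
  qed simp
  show "(deriv ^^ N) (\<lambda>x. f x * g x) x = (deriv ^^ N) f x * g x"
    by (rule *[OF assms(2,3,5)])
  show "j < N \<Longrightarrow> (deriv ^^ j) (\<lambda>x. f x * g x) x = 0"
    using *[OF assms(2,3), of j] assms(5) by auto
qed

lemma higher_deriv_power:
  "(deriv ^^ j) (\<lambda>x::real. x ^ N) = (\<lambda>x. (\<Prod>i<j. real (N - i)) * x ^ (N - j))"
proof (induction j)
  case (Suc j)
  have "deriv (\<lambda>x. (\<Prod>i<j. real (N - i)) * x ^ (N - j)) x
     = (\<Prod>i<Suc j. real (N - i)) * x ^ (N - Suc j)" for x :: real
    by (rule DERIV_imp_deriv) (auto intro!: derivative_eq_intros)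
  then show ?case using Suc by auto
qed simp

lemma higher_deriv_power_0:
  "j < N \<Longrightarrow> (deriv ^^ j) (\<lambda>x::real. x ^ N) 0 = 0"
  "(deriv ^^ N) (\<lambda>x::real. x ^ N) 0 = fact N"
  unfolding higher_deriv_power by (auto simp: fact_prod_rev of_nat_prod atLeast0LessThan)

section \<open>The Laplacian in coordinates\<close>

lemma matrix_inv_right: "invertible A \<Longrightarrow> A ** matrix_inv A = mat 1"
  and matrix_inv_left: "invertible A \<Longrightarrow> matrix_inv A ** A = mat 1"
  unfolding invertible_def matrix_inv_def by (metis (mono_tags, lifting) someI_ex)+

lemma matrix_inv_eqI:
  fixes A B :: "real^'n^'n"
  assumes "A ** B = mat 1"
  shows "matrix_inv B = A"
proof -
  have "B ** A = mat 1"
    using assms matrix_left_right_inverse by blast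
  then have "invertible B"
    using assms unfolding invertible_def by blast
  then have "B ** matrix_inv B = mat 1"
    using matrix_inv_right by blast
  then have "A ** (B ** matrix_inv B) = A" 
    by simp
  then show ?thesis
    using assms by (simp add: matrix_mul_assoc)
qed

text \<open>Cramer's rule exhibits the entries of the inverse as quotients of polynomials in the
  entries of the matrix, so they inherit smoothness.\<close>

lemma matrix_inv_entry:
  fixes A :: "real^'n^'n"
  assumes "invertible A"
  shows "matrix_inv A $ i $ j = det (\<chi> a b. if b = i then axis j 1 $ a else A $ a $ b) / det A"
proof -
  have "A *v (matrix_inv A *v axis j 1) = axis j 1"
    using matrix_inv_right[OF assms] by (simp add: matrix_vector_mul_assoc)
  moreover have "det A \<noteq> 0"
    using assms invertible_det_nz by blast
  ultimately have "matrix_inv A *v axis j 1 = 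
      (\<chi> k. det (\<chi> a b. if b = k then axis j 1 $ a else A $ a $ b) / det A)"
    using cramer by blast
  moreover have "(matrix_inv A *v axis j 1) $ i = matrix_inv A $ i $ j"
    by (simp add: matrix_vector_mult_def axis_def if_distrib cong: if_cong)
  ultimately show ?thesis
    by simp
qed

lemma smooth_on_det:
  fixes G :: "'a::real_normed_vector \<Rightarrow> real^'n^'n"
  assumes "open S" "\<And>i j. smooth_on S (\<lambda>x. G x $ i $ j)"
  shows "smooth_on S (\<lambda>x. det (G x))"
  unfolding det_def by (intro smooth_on_sum smooth_on_mult smooth_on_prod smooth_on_const assms)

lemma smooth_on_matrix_inv:
  fixes G :: "'a::real_normed_vector \<Rightarrow> real^'n^'n"
  assumes "open S" "\<And>i j. smooth_on S (\<lambda>x. G x $ i $ j)" "\<And>x. x \<in> S \<Longrightarrow> invertible (G x)"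
  shows "smooth_on S (\<lambda>x. matrix_inv (G x) $ i $ j)"
proof (rule iffD1[OF smooth_on_cong[OF assms(1)]])
  show "det (\<chi> a b. if b = i then axis j 1 $ a else G x $ a $ b) / det (G x) = matrix_inv (G x) $ i $ j"
    if "x \<in> S" for x
    using matrix_inv_entry[OF assms(3)[OF that]] by simp
  have "smooth_on S (\<lambda>x. (\<chi> a b. if b = i then axis j 1 $ a else G x $ a $ b) $ a' $ b')" for a' b'
    using assms(2) by (cases "b' = i") (auto simp: smooth_on_const)
  then show "smooth_on S (\<lambda>x. det (\<chi> a b. if b = i then axis j 1 $ a else G x $ a $ b) / det (G x))"
    using assms by (intro smooth_on_divide smooth_on_det) (auto simp: invertible_det_nz)
qed

text \<open>The pointwise and regularity conditions of a metric on a single open set, so that they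
  can be restricted to the overlap of two charts.\<close>

definition coord_metric :: "(real^'n) set \<Rightarrow> (real^'n \<Rightarrow> real^'n^'n) \<Rightarrow> bool" where
  "coord_metric S G \<longleftrightarrow> open S \<and> (\<forall>i j. smooth_on S (\<lambda>x. G x $ i $ j)) \<and>
     (\<forall>x\<in>S. transpose (G x) = G x \<and> invertible (G x))"

lemma coord_metricD:
  assumes "coord_metric S G"
  shows "open S" "smooth_on S (\<lambda>x. G x $ i $ j)" "x \<in> S \<Longrightarrow> G x $ i $ j = G x $ j $ i"
    "x \<in> S \<Longrightarrow> invertible (G x)"
proof -
  show "open S" "smooth_on S (\<lambda>x. G x $ i $ j)" "x \<in> S \<Longrightarrow> invertible (G x)"
    using assms by (auto simp: coord_metric_def)
  assume "x \<in> S"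
  then have "transpose (G x) = G x"
    using assms by (auto simp: coord_metric_def)
  then show "G x $ i $ j = G x $ j $ i"
    unfolding transpose_def vec_eq_iff by simp
qed

lemma smooth_on_metric_inv:
  "coord_metric S G \<Longrightarrow> smooth_on S (\<lambda>x. matrix_inv (G x) $ i $ j)"
  by (intro smooth_on_matrix_inv) (auto simp: coord_metricD)

lemma smooth_on_christoffel:
  assumes "coord_metric S G"
  shows "smooth_on S (christoffel G k i j)"
  unfolding christoffel_def[abs_def]
  using assms
  by (intro smooth_on_divide smooth_on_sum smooth_on_mult smooth_on_add smooth_on_diff smooth_on_pd
      smooth_on_const smooth_on_metric_inv) (auto simp: coord_metricD)

lemma coord_laplacian_cong:
  assumes "open S" "\<And>y. y \<in> S \<Longrightarrow> f y = h y" "x \<in> S"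
  shows "coord_laplacian G f x = coord_laplacian G h x"
proof -
  have 1: "pd k f y = pd k h y" if "y \<in> S" for y k
    by (rule pd_cong[OF assms(1) that assms(2)])
  have "pd i (pd j f) x = pd i (pd j h) x" for i j
    by (rule pd_cong[OF assms(1,3) 1])
  then show ?thesis
    by (simp add: coord_laplacian_def 1[OF assms(3)])
qed

section \<open>Coordinate invariance of the Laplacian\<close>

lemma congruent_matrix_inv:
  fixes Ga Gb J :: "real^'n^'n"
  assumes "invertible Ga" "Ga = transpose J ** Gb ** J"
  shows "matrix_inv Gb = J ** matrix_inv Ga ** transpose J"
proof (rule matrix_inv_eqI)
  have "matrix_inv Ga ** transpose J ** Gb ** J = mat 1"
    using matrix_inv_left[OF assms(1)] assms(2) by (simp add: matrix_mul_assoc)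
  then have "J ** (matrix_inv Ga ** transpose J ** Gb) = mat 1"
    using matrix_left_right_inverse by blast
  then show "J ** matrix_inv Ga ** transpose J ** Gb = mat 1"
    by (simp add: matrix_mul_assoc)
qed

text \<open>The coordinate Hessian of \<open>F \<circ> \<phi>\<close> and the Christoffel symbols of
  \<open>Ga\<close> both fail to be tensors by the same term, the second derivatives of \<phi>
  paired with the differential of \<open>F\<close>. It cancels in the covariant Hessian, which
  therefore pulls back, and the inverse metric transforms with the Jacobian in the opposite
  way.\<close>

lemma coord_laplacian_change:
  fixes \<phi> :: "real^'n::finite \<Rightarrow> real^'n"
  assumes Ga: "coord_metric S Ga" and Gb: "coord_metric T Gb"
    and \<phi>: "smooth_on S \<phi>" "\<phi> ` S \<subseteq> T"
    and tensor: "\<And>x. x \<in> S \<Longrightarrow>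
      Ga x = transpose (matrix (frechet_derivative \<phi> (at x))) ** Gb (\<phi> x) ** matrix (frechet_derivative \<phi> (at x))"
    and F: "smooth_on T F" and x: "x \<in> S"
  shows "coord_laplacian Ga (\<lambda>y. F (\<phi> y)) x = coord_laplacian Gb F (\<phi> x)"
proof -
  note S = coord_metricD(1)[OF Ga] and T = coord_metricD(1)[OF Gb]
  have \<phi>x: "\<phi> y \<in> T" if "y \<in> S" for y
    using that \<phi>(2) by blast
  define P where "P = (\<lambda>i \<alpha> y. pd i (\<lambda>y. \<phi> y $ \<alpha>) y)"
  have \<phi>s: "smooth_on S (\<lambda>y. \<phi> y $ \<alpha>)" for \<alpha>
    by (rule smooth_on_nth[OF S \<phi>(1)])
  have Ps: "smooth_on S (P i \<alpha>)" for i \<alpha>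
    unfolding P_def by (intro smooth_on_pd \<phi>s)
  define Q where "Q = (\<lambda>i j \<alpha>. pd i (P j \<alpha>) x)"
  have Qsym: "Q i j = Q j i" for i j
    unfolding Q_def P_def by (intro ext pd_commute[OF S \<phi>s x])
  have J: "matrix (frechet_derivative \<phi> (at y)) $ \<alpha> $ i = P i \<alpha> y" if "y \<in> S" for y i \<alpha>
  proof -
    have "((\<lambda>y. \<phi> y \<bullet> axis \<alpha> 1) has_derivative (\<lambda>v. frechet_derivative \<phi> (at y) v \<bullet> axis \<alpha> 1)) (at y)"
      by (intro has_derivative_inner_left frechet_derivative_has smooth_on_differentiable[OF \<phi>(1) that])
    then show ?thesis
      unfolding P_def by (subst pd_eqI) (auto simp: inner_axis matrix_def)
  qed
  define B where "B = (\<lambda>\<alpha> \<beta> y. Gb (\<phi> y) $ \<alpha> $ \<beta>)"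
  have Bs: "smooth_on S (B \<alpha> \<beta>)" for \<alpha> \<beta>
    unfolding B_def by (rule smooth_on_compose_vec[OF S \<phi>s \<phi>(2) coord_metricD(2)[OF Gb]])
  have Bsym: "B \<alpha> \<beta> x = B \<beta> \<alpha> x" for \<alpha> \<beta>
    unfolding B_def by (rule coord_metricD(3)[OF Gb \<phi>x[OF x]])
  define D where "D = (\<lambda>\<gamma> \<alpha> \<beta>. pd \<gamma> (\<lambda>z. Gb z $ \<alpha> $ \<beta>) (\<phi> x))"
  have dB: "pd i (B \<alpha> \<beta>) x = (\<Sum>\<gamma>\<in>UNIV. D \<gamma> \<alpha> \<beta> * P i \<gamma> x)" for i \<alpha> \<beta>
    unfolding B_def D_def P_def
    by (rule pd_compose) (use smooth_on_differentiable \<phi>s coord_metricD(2)[OF Gb] x \<phi>x in blast)+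
  \<comment> \<open>\<open>bil\<close> is the metric \<open>Gb\<close> at \<open>\<phi> x\<close> as
    a bilinear form; \<open>tri X Y Z\<close> is its derivative in direction \<open>X\<close>,
    evaluated on \<open>Y\<close> and \<open>Z\<close>. The vector \<open>p i\<close> is the image
    of the i-th coordinate vector. This notation hides the index sums.\<close>
  define bil where "bil = (\<lambda>X Y. \<Sum>\<beta>\<in>UNIV. \<Sum>\<alpha>\<in>UNIV. X \<alpha> * B \<alpha> \<beta> x * Y \<beta>)"
  define tri where "tri = (\<lambda>X Y Z. \<Sum>\<beta>\<in>UNIV. \<Sum>\<alpha>\<in>UNIV. \<Sum>\<gamma>\<in>UNIV. X \<gamma> * D \<gamma> \<alpha> \<beta> * Y \<alpha> * Z \<beta>)"
  define p where "p = (\<lambda>i \<alpha>. P i \<alpha> x)"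
  have bilsym: "bil X Y = bil Y X" for X Y
    unfolding bil_def by (subst sum.swap) (simp add: Bsym mult.commute mult.left_commute)
  have Ga_entry: "Ga y $ j $ l = (\<Sum>\<beta>\<in>UNIV. \<Sum>\<alpha>\<in>UNIV. P j \<alpha> y * B \<alpha> \<beta> y * P l \<beta> y)" if "y \<in> S" for y j l
    unfolding tensor[OF that] B_def
    by (simp add: matrix_matrix_mult_def transpose_def J[OF that] sum_distrib_right)
  note Pd = smooth_on_differentiable[OF Ps x] and Bd = smooth_on_differentiable[OF Bs x]
  have dGa: "pd i (\<lambda>y. Ga y $ j $ l) x = bil (p j) (Q i l) + bil (Q i j) (p l) + tri (p i) (p j) (p l)" for i j l
  proof -
    have "pd i (\<lambda>y. Ga y $ j $ l) x = pd i (\<lambda>y. \<Sum>\<beta>\<in>UNIV. \<Sum>\<alpha>\<in>UNIV. P j \<alpha> y * B \<alpha> \<beta> y * P l \<beta> y) x"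
      by (rule pd_cong[OF S x Ga_entry])
    also have "\<dots> = (\<Sum>\<beta>\<in>UNIV. \<Sum>\<alpha>\<in>UNIV. P j \<alpha> x * B \<alpha> \<beta> x * Q i l \<beta> +
        (P j \<alpha> x * pd i (B \<alpha> \<beta>) x + Q i j \<alpha> * B \<alpha> \<beta> x) * P l \<beta> x)"
      by (simp add: pd_sum pd_mult Pd Bd differentiable_sum Q_def)
    also have "\<dots> = bil (p j) (Q i l) + bil (Q i j) (p l) + tri (p i) (p j) (p l)"
      unfolding bil_def tri_def dB p_def
      by (simp add: sum.distrib[symmetric] sum_distrib_left sum_distrib_right algebra_simps)
    finally show ?thesis .
  qed
  define H where "H = matrix_inv (Gb (\<phi> x))"
  define K where "K = matrix_inv (Ga x)"
  have HK: "H $ \<mu> $ \<gamma> = (\<Sum>l\<in>UNIV. \<Sum>k\<in>UNIV. p k \<mu> * K $ k $ l * p l \<gamma>)" for \<mu> \<gamma>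
    unfolding H_def K_def p_def congruent_matrix_inv[OF coord_metricD(4)[OF Ga x] tensor[OF x]]
    by (simp add: matrix_matrix_mult_def transpose_def J[OF x] sum_distrib_right)
  define F' where "F' = (\<lambda>\<mu>. pd \<mu> F (\<phi> x))"
  \<comment> \<open>The gradient of \<open>F\<close> with respect to \<open>Gb\<close>. The vector
    \<open>W\<close> below is the gradient of \<open>F \<circ> \<phi>\<close> with respect to
    \<open>Ga\<close>, and \<open>zW\<close> says that the Jacobian maps the second gradient to the
    first. Hence summing any expression in \<open>p l\<close> against \<open>W l\<close> substitutes
    \<open>z\<close> for \<open>p l\<close>.\<close>
  define z where "z = (\<lambda>\<gamma>. \<Sum>\<mu>\<in>UNIV. H $ \<mu> $ \<gamma> * F' \<mu>)"
  have dF: "pd k (\<lambda>y. F (\<phi> y)) y = (\<Sum>\<mu>\<in>UNIV. pd \<mu> F (\<phi> y) * P k \<mu> y)" if "y \<in> S" for k y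
    unfolding P_def
    by (rule pd_compose) (use smooth_on_differentiable \<phi>s F that \<phi>x in blast)+
  define W where "W = (\<lambda>l. \<Sum>k\<in>UNIV. K $ k $ l * pd k (\<lambda>y. F (\<phi> y)) x)"
  have zW: "(\<Sum>l\<in>UNIV. p l \<gamma> * W l) = z \<gamma>" for \<gamma>
  proof -
    have "(\<Sum>l\<in>UNIV. p l \<gamma> * W l) = (\<Sum>l\<in>UNIV. \<Sum>k\<in>UNIV. \<Sum>\<mu>\<in>UNIV. p k \<mu> * K $ k $ l * p l \<gamma> * F' \<mu>)"
      unfolding W_def dF[OF x] F'_def p_def
      by (simp add: sum_distrib_left sum_distrib_right algebra_simps)
    also have "\<dots> = z \<gamma>"
      unfolding z_def HK sum_distrib_right
      by (subst (2) sum.swap, subst sum.swap) simp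
    finally show ?thesis .
  qed
  have bilW: "(\<Sum>l\<in>UNIV. bil X (p l) * W l) = bil X z" for X
  proof -
    have "(\<Sum>l\<in>UNIV. bil X (p l) * W l) = (\<Sum>l\<in>UNIV. \<Sum>\<beta>\<in>UNIV. \<Sum>\<alpha>\<in>UNIV. X \<alpha> * B \<alpha> \<beta> x * (p l \<beta> * W l))"
      unfolding bil_def by (simp add: sum_distrib_left sum_distrib_right algebra_simps)
    also have "\<dots> = bil X z"
      unfolding bil_def zW[symmetric] sum_distrib_left
      by (subst sum.swap, rule sum.cong[OF refl], rule sum.swap)
    finally show ?thesis .
  qed
  have triW: "(\<Sum>l\<in>UNIV. tri X Y (p l) * W l) = tri X Y z" for X Y
  proof -
    have "(\<Sum>l\<in>UNIV. tri X Y (p l) * W l) =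
      (\<Sum>l\<in>UNIV. \<Sum>\<beta>\<in>UNIV. \<Sum>\<alpha>\<in>UNIV. \<Sum>\<gamma>\<in>UNIV. X \<gamma> * D \<gamma> \<alpha> \<beta> * Y \<alpha> * (p l \<beta> * W l))"
      unfolding tri_def by (simp add: sum_distrib_left sum_distrib_right algebra_simps)
    also have "\<dots> = tri X Y z"
      unfolding tri_def zW[symmetric] sum_distrib_left
      by (subst sum.swap, rule sum.cong[OF refl], subst sum.swap, rule sum.cong[OF refl], rule sum.swap)
    finally show ?thesis .
  qed
  have triW': "(\<Sum>l\<in>UNIV. tri (p l) X Y * W l) = tri z X Y" for X Y
  proof -
    have "(\<Sum>l\<in>UNIV. tri (p l) X Y * W l) =
      (\<Sum>l\<in>UNIV. \<Sum>\<beta>\<in>UNIV. \<Sum>\<alpha>\<in>UNIV. \<Sum>\<gamma>\<in>UNIV. (p l \<gamma> * W l) * (D \<gamma> \<alpha> \<beta> * X \<alpha> * Y \<beta>))"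
      unfolding tri_def by (simp add: sum_distrib_left sum_distrib_right algebra_simps)
    also have "\<dots> = (\<Sum>\<beta>\<in>UNIV. \<Sum>\<alpha>\<in>UNIV. \<Sum>\<gamma>\<in>UNIV. \<Sum>l\<in>UNIV. (p l \<gamma> * W l) * (D \<gamma> \<alpha> \<beta> * X \<alpha> * Y \<beta>))"
      by (subst sum.swap, rule sum.cong[OF refl], subst sum.swap, rule sum.cong[OF refl], rule sum.swap)
    also have "\<dots> = tri z X Y"
      unfolding tri_def zW[symmetric] by (simp add: sum_distrib_right sum_distrib_left algebra_simps)
    finally show ?thesis .
  qed
  have "H ** Gb (\<phi> x) = mat 1"
    unfolding H_def by (rule matrix_inv_left[OF coord_metricD(4)[OF Gb \<phi>x[OF x]]])
  then have HB: "(\<Sum>\<gamma>\<in>UNIV. H $ \<mu> $ \<gamma> * B \<gamma> \<alpha> x) = (if \<mu> = \<alpha> then 1 else 0)" for \<mu> \<alpha>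
    unfolding B_def matrix_matrix_mult_def vec_eq_iff by (simp add: mat_def)
  \<comment> \<open>Lowering the index of the gradient returns the differential: the metric pairing
    of \<open>X\<close> with the gradient is the derivative of \<open>F\<close> along
    \<open>X\<close>.\<close>
  have bilz: "bil X z = (\<Sum>\<alpha>\<in>UNIV. X \<alpha> * F' \<alpha>)" for X
  proof -
    have "bil X z = (\<Sum>\<beta>\<in>UNIV. \<Sum>\<alpha>\<in>UNIV. \<Sum>\<mu>\<in>UNIV. X \<alpha> * F' \<mu> * (H $ \<mu> $ \<beta> * B \<beta> \<alpha> x))"
      unfolding bil_def z_def by (simp add: sum_distrib_left sum_distrib_right Bsym algebra_simps)
    also have "\<dots> = (\<Sum>\<alpha>\<in>UNIV. \<Sum>\<mu>\<in>UNIV. \<Sum>\<beta>\<in>UNIV. X \<alpha> * F' \<mu> * (H $ \<mu> $ \<beta> * B \<beta> \<alpha> x))"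
      by (subst sum.swap, rule sum.cong[OF refl], rule sum.swap)
    also have "\<dots> = (\<Sum>\<alpha>\<in>UNIV. X \<alpha> * F' \<alpha>)"
      unfolding sum_distrib_left[symmetric] HB by (simp add: if_distrib cong: if_cong)
    finally show ?thesis .
  qed
  \<comment> \<open>The combination of first derivatives of the metric in the Christoffel formula,
    with vectors in place of indices.\<close>
  define C where "C = (\<lambda>X Y Z. tri X Y Z + tri Y X Z - tri Z X Y)"
  have \<Gamma>a: "(\<Sum>k\<in>UNIV. christoffel Ga k i j x * pd k (\<lambda>y. F (\<phi> y)) x)
     = (\<Sum>\<alpha>\<in>UNIV. Q i j \<alpha> * F' \<alpha>) + C (p i) (p j) z / 2" for i j
  proof -
    define c where "c = (\<lambda>l. pd i (\<lambda>y. Ga y $ j $ l) x + pd j (\<lambda>y. Ga y $ i $ l) x - pd l (\<lambda>y. Ga y $ i $ j) x)"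
    \<comment> \<open>By symmetry of second derivatives the terms with \<open>Q i l\<close> and
      \<open>Q j l\<close> cancel and the one with \<open>Q i j\<close> occurs twice; it is the
      inhomogeneous part of the transformation law.\<close>
    have c: "c l = 2 * bil (Q i j) (p l) + C (p i) (p j) (p l)" for l
      unfolding c_def dGa C_def
      using Qsym[of i j] Qsym[of i l] Qsym[of j l] bilsym[of "p j" "Q i l"] by simp
    have "(\<Sum>k\<in>UNIV. christoffel Ga k i j x * pd k (\<lambda>y. F (\<phi> y)) x)
        = (\<Sum>k\<in>UNIV. \<Sum>l\<in>UNIV. c l * (K $ k $ l * pd k (\<lambda>y. F (\<phi> y)) x)) / 2"
      unfolding christoffel_def c_def K_def by (simp add: sum_distrib_left sum_distrib_right sum_divide_distrib algebra_simps)
    also have "\<dots> = (\<Sum>l\<in>UNIV. c l * W l) / 2"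
      unfolding W_def sum_distrib_left by (subst sum.swap) simp
    also have "(\<Sum>l\<in>UNIV. c l * W l) = 2 * bil (Q i j) z + C (p i) (p j) z"
      unfolding c C_def bilW[symmetric] triW[symmetric] triW'[symmetric]
      by (simp add: sum_distrib_left sum.distrib[symmetric] sum_subtractf[symmetric] algebra_simps)
    finally show ?thesis
      unfolding bilz by simp
  qed
  have \<Gamma>b: "(\<Sum>k\<in>UNIV. christoffel Gb k \<alpha> \<beta> (\<phi> x) * F' k) = 
      (\<Sum>\<gamma>\<in>UNIV. (D \<alpha> \<beta> \<gamma> + D \<beta> \<alpha> \<gamma> - D \<gamma> \<alpha> \<beta>) * z \<gamma>) / 2" for \<alpha> \<beta>
  proof -
    have "(\<Sum>k\<in>UNIV. christoffel Gb k \<alpha> \<beta> (\<phi> x) * F' k)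
      = (\<Sum>k\<in>UNIV. \<Sum>\<gamma>\<in>UNIV. (D \<alpha> \<beta> \<gamma> + D \<beta> \<alpha> \<gamma> - D \<gamma> \<alpha> \<beta>) * (H $ k $ \<gamma> * F' k)) / 2"
      unfolding christoffel_def D_def H_def by (simp add: sum_distrib_left sum_distrib_right sum_divide_distrib algebra_simps)
    also have "\<dots> = (\<Sum>\<gamma>\<in>UNIV. (D \<alpha> \<beta> \<gamma> + D \<beta> \<alpha> \<gamma> - D \<gamma> \<alpha> \<beta>) * z \<gamma>) / 2"
      unfolding z_def sum_distrib_left by (subst sum.swap) simp
    finally show ?thesis .
  qed
  have ddF: "pd i (pd j (\<lambda>y. F (\<phi> y))) x
     = (\<Sum>\<beta>\<in>UNIV. \<Sum>\<alpha>\<in>UNIV. p i \<alpha> * p j \<beta> * pd \<alpha> (pd \<beta> F) (\<phi> x)) + (\<Sum>\<alpha>\<in>UNIV. Q i j \<alpha> * F' \<alpha>)" for i j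
  proof -
    have s: "smooth_on S (\<lambda>y. pd \<mu> F (\<phi> y))" for \<mu>
      by (rule smooth_on_compose_vec[OF S \<phi>s \<phi>(2) smooth_on_pd[OF F]])
    have d: "pd i (\<lambda>y. pd \<mu> F (\<phi> y)) x = (\<Sum>\<alpha>\<in>UNIV. pd \<alpha> (pd \<mu> F) (\<phi> x) * P i \<alpha> x)" for \<mu>
      unfolding P_def
      by (rule pd_compose) (use smooth_on_differentiable \<phi>s smooth_on_pd[OF F] x \<phi>x in blast)+
    have "pd i (pd j (\<lambda>y. F (\<phi> y))) x = pd i (\<lambda>y. \<Sum>\<mu>\<in>UNIV. pd \<mu> F (\<phi> y) * P j \<mu> y) x"
      by (rule pd_cong[OF S x dF])
    also have "\<dots> = (\<Sum>\<mu>\<in>UNIV. F' \<mu> * Q i j \<mu> + pd i (\<lambda>y. pd \<mu> F (\<phi> y)) x * p j \<mu>)"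
      by (simp add: pd_sum pd_mult Pd smooth_on_differentiable[OF s x] Q_def p_def F'_def)
    also have "\<dots> = (\<Sum>\<beta>\<in>UNIV. \<Sum>\<alpha>\<in>UNIV. p i \<alpha> * p j \<beta> * pd \<alpha> (pd \<beta> F) (\<phi> x)) + (\<Sum>\<alpha>\<in>UNIV. Q i j \<alpha> * F' \<alpha>)"
      unfolding d by (simp add: sum.distrib sum_distrib_left sum_distrib_right p_def algebra_simps)
    finally show ?thesis .
  qed
  define Tb where "Tb = (\<lambda>\<alpha> \<beta>. pd \<alpha> (pd \<beta> F) (\<phi> x) - (\<Sum>k\<in>UNIV. christoffel Gb k \<alpha> \<beta> (\<phi> x) * F' k))"
  \<comment> \<open>The sum of \<open>Q i j \<alpha> * F' \<alpha>\<close> appears in both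
    \<open>ddF\<close> and \<open>\<Gamma>a\<close> and drops out of the difference.\<close>
  have hess: "pd i (pd j (\<lambda>y. F (\<phi> y))) x - (\<Sum>k\<in>UNIV. christoffel Ga k i j x * pd k (\<lambda>y. F (\<phi> y)) x)
     = (\<Sum>\<beta>\<in>UNIV. \<Sum>\<alpha>\<in>UNIV. p i \<alpha> * p j \<beta> * Tb \<alpha> \<beta>)" for i j
  proof -
    have t1: "tri X Y Z = (\<Sum>\<beta>\<in>UNIV. \<Sum>\<alpha>\<in>UNIV. \<Sum>\<gamma>\<in>UNIV. X \<alpha> * Y \<beta> * (D \<alpha> \<beta> \<gamma> * Z \<gamma>))" for X Y Z
      unfolding tri_def
      by (subst sum.swap, rule sum.cong[OF refl], subst sum.swap) (simp add: algebra_simps)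
    have t2: "tri Y X Z = (\<Sum>\<beta>\<in>UNIV. \<Sum>\<alpha>\<in>UNIV. \<Sum>\<gamma>\<in>UNIV. X \<alpha> * Y \<beta> * (D \<beta> \<alpha> \<gamma> * Z \<gamma>))" for X Y Z
      unfolding t1 by (subst sum.swap) (simp add: algebra_simps)
    have t3: "tri Z X Y = (\<Sum>\<beta>\<in>UNIV. \<Sum>\<alpha>\<in>UNIV. \<Sum>\<gamma>\<in>UNIV. X \<alpha> * Y \<beta> * (D \<gamma> \<alpha> \<beta> * Z \<gamma>))" for X Y Z
      unfolding tri_def by (simp add: algebra_simps)
    have "C (p i) (p j) z / 2 = (\<Sum>\<beta>\<in>UNIV. \<Sum>\<alpha>\<in>UNIV. p i \<alpha> * p j \<beta> * (\<Sum>k\<in>UNIV. christoffel Gb k \<alpha> \<beta> (\<phi> x) * F' k))"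
      unfolding C_def t1[of "p i" "p j"] t2[of "p j" "p i"] t3[of z] \<Gamma>b
      by (simp add: sum.distrib[symmetric] sum_subtractf[symmetric] sum_divide_distrib sum_distrib_left algebra_simps)
    then show ?thesis
      unfolding \<Gamma>a ddF Tb_def by (simp add: sum_subtractf algebra_simps)
  qed
  have "coord_laplacian Ga (\<lambda>y. F (\<phi> y)) x = (\<Sum>i\<in>UNIV. \<Sum>j\<in>UNIV. K $ i $ j * (\<Sum>\<beta>\<in>UNIV. \<Sum>\<alpha>\<in>UNIV. p i \<alpha> * p j \<beta> * Tb \<alpha> \<beta>))"
    unfolding coord_laplacian_def hess K_def ..
  also have "\<dots> = (\<Sum>i\<in>UNIV. \<Sum>j\<in>UNIV. \<Sum>\<beta>\<in>UNIV. \<Sum>\<alpha>\<in>UNIV. p i \<alpha> * K $ i $ j * p j \<beta> * Tb \<alpha> \<beta>)"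
    by (simp add: sum_distrib_left sum_distrib_right algebra_simps)
  also have "\<dots> = (\<Sum>i\<in>UNIV. \<Sum>\<beta>\<in>UNIV. \<Sum>\<alpha>\<in>UNIV. \<Sum>j\<in>UNIV. p i \<alpha> * K $ i $ j * p j \<beta> * Tb \<alpha> \<beta>)"
    by (rule sum.cong[OF refl], subst sum.swap, rule sum.cong[OF refl], rule sum.swap)
  also have "\<dots> = (\<Sum>\<beta>\<in>UNIV. \<Sum>\<alpha>\<in>UNIV. \<Sum>j\<in>UNIV. \<Sum>i\<in>UNIV. p i \<alpha> * K $ i $ j * p j \<beta> * Tb \<alpha> \<beta>)"
    by (subst sum.swap, rule sum.cong[OF refl], subst sum.swap, rule sum.cong[OF refl], rule sum.swap)
  also have "\<dots> = (\<Sum>\<beta>\<in>UNIV. \<Sum>\<alpha>\<in>UNIV. H $ \<alpha> $ \<beta> * Tb \<alpha> \<beta>)"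
    unfolding HK by (simp add: sum_distrib_right)
  also have "\<dots> = coord_laplacian Gb F (\<phi> x)"
    unfolding coord_laplacian_def Tb_def F'_def H_def by (rule sum.swap)
  finally show ?thesis .
qed

lemma coord_laplacian_lincomb:
  assumes "open S" "smooth_on S f" "smooth_on S h" "x \<in> S"
  shows "coord_laplacian G (\<lambda>y. f y + c * h y) x = coord_laplacian G f x + c * coord_laplacian G h x"
proof -
  have 1: "pd k (\<lambda>y. f y + c * h y) y = pd k f y + c * pd k h y"
    if "smooth_on S f" "smooth_on S h" "y \<in> S" for y k and f h :: "real^'a \<Rightarrow> real"
  proof -
    have "f differentiable at y" "h differentiable at y"
      using that smooth_on_differentiable by blast+
    then show ?thesis
      by (subst pd_add) (auto simp: pd_cmult differentiable_mult)
  qed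
  have "pd i (pd j (\<lambda>y. f y + c * h y)) x = pd i (pd j f) x + c * pd i (pd j h) x" for i j
    using pd_cong[OF assms(1,4) 1[OF assms(2,3)]] 1[OF smooth_on_pd smooth_on_pd, OF assms(2,3,4)] by simp
  then show ?thesis
    unfolding coord_laplacian_def 1[OF assms(2-4)]
    by (simp add: algebra_simps sum.distrib sum_distrib_left sum_subtractf)
qed

section \<open>The Laplacian on a manifold\<close>

locale pr_manifold =
  fixes A :: "('i, 'm::{t2_space,second_countable_topology}, 'n::finite) atlas"
    and g :: "('i, 'n) tensor2"
  assumes atlas: "smooth_atlas A" and metric: "pseudo_riemannian_metric A g"
begin

abbreviation cdom :: "'i \<Rightarrow> 'm set" where
  "cdom a \<equiv> chart_dom A a"

abbreviation cimage :: "'i \<Rightarrow> (real^'n) set" where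
  "cimage a \<equiv> chart A a ` chart_dom A a"

lemma open_cdom: "open (cdom a)" 
  and open_cimage: "open (cimage a)"
  and chart_homeo: "homeomorphism (cdom a) (cimage a) (chart A a) (param A a)"
  using atlas unfolding smooth_atlas_def by auto

lemma param_chart: "p \<in> cdom a \<Longrightarrow> param A a (chart A a p) = p"
  and chart_param: "x \<in> cimage a \<Longrightarrow> chart A a (param A a x) = x"
  and param_cdom: "x \<in> cimage a \<Longrightarrow> param A a x \<in> cdom a"
  using chart_homeo[of a] unfolding homeomorphism_def by auto

lemma cdom_manifold: "p \<in> cdom a \<Longrightarrow> p \<in> manifold_of A"
  by (auto simp: manifold_of_def)

lemma metric_cimage: "coord_metric (cimage a) (g a)"
  using metric open_cimage unfolding pseudo_riemannian_metric_def coord_metric_def by auto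

lemma smooth_functionD: "smooth_function A f \<Longrightarrow> smooth_on (cimage a) (f \<circ> param A a)"
  unfolding smooth_function_def by blast

lemma open_overlap: "open (chart A a ` (cdom a \<inter> cdom b))"
proof -
  have "openin (top_of_set (cdom a)) (cdom a \<inter> cdom b)"
    using open_cdom by (auto simp: openin_open)
  then have "openin (top_of_set (cimage a)) (chart A a ` (cdom a \<inter> cdom b))"
    by (rule homeomorphism_imp_open_map[OF chart_homeo])
  then show ?thesis
    using open_cimage openin_open_eq by blast
qed

text \<open>Replaces the chart hidden in the choice operator by any chart around \<open>p\<close>.
  The transition map on the overlap satisfies the hypotheses of
  \<open>coord_laplacian_change\<close>, and \<open>f\<close> read in the two charts differs by
  composition with it.\<close>

lemma laplacian_chart:
  assumes "smooth_function A f" "p \<in> cdom a"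
  shows "laplacian A g f p = coord_laplacian (g a) (f \<circ> param A a) (chart A a p)"
proof -
  define b where "b = (SOME a. p \<in> cdom a)"
  have b: "p \<in> cdom b"
    unfolding b_def by (rule someI[of _ a]) (rule assms(2))
  define S where "S = chart A a ` (cdom a \<inter> cdom b)"
  define \<phi> where "\<phi> = chart A b \<circ> param A a"
  have S: "open S" "S \<subseteq> cimage a" "chart A a p \<in> S"
    using open_overlap assms(2) b by (auto simp: S_def)
  have \<phi>: "smooth_on S \<phi>"
    using atlas unfolding smooth_atlas_def S_def \<phi>_def by blast
  have \<phi>_im: "\<phi> ` S \<subseteq> cimage b"
    by (auto simp: \<phi>_def S_def param_chart)
  have Ga: "coord_metric S (g a)"
    using metric_cimage[of a] S smooth_on_subset[OF _ S(2)] unfolding coord_metric_def by blast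
  have tensor: "g a x = transpose (matrix (frechet_derivative \<phi> (at x))) ** g b (\<phi> x) ** matrix (frechet_derivative \<phi> (at x))"
    if xS: "x \<in> S" for x
  proof -
    obtain q where q: "q \<in> cdom a \<inter> cdom b" "x = chart A a q"
      using xS unfolding S_def by blast
    then have "\<phi> x = chart A b q"
      by (simp add: \<phi>_def param_chart)
    then show ?thesis
      using metric q unfolding pseudo_riemannian_metric_def Let_def \<phi>_def by auto
  qed
  have "coord_laplacian (g a) (f \<circ> param A a) (chart A a p)
      = coord_laplacian (g a) (\<lambda>y. (f \<circ> param A b) (\<phi> y)) (chart A a p)"
    by (rule coord_laplacian_cong[OF S(1) _ S(3)]) (auto simp: \<phi>_def S_def param_chart)
  also have "\<dots> = coord_laplacian (g b) (f \<circ> param A b) (\<phi> (chart A a p))"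
    by (rule coord_laplacian_change[OF Ga metric_cimage \<phi> \<phi>_im tensor smooth_functionD[OF assms(1)] S(3)])
  also have "\<phi> (chart A a p) = chart A b p"
    by (simp add: \<phi>_def param_chart assms(2))
  finally show ?thesis
    by (simp add: laplacian_def b_def Let_def comp_def)
qed

lemma smooth_function_lincomb:
  "smooth_function A f \<Longrightarrow> smooth_function A h \<Longrightarrow> smooth_function A (\<lambda>p. c * f p + d * h p)"
  unfolding smooth_function_def comp_def
  by (intro allI smooth_on_add smooth_on_mult smooth_on_const open_cimage) auto

lemma smooth_function_cmult: "smooth_function A f \<Longrightarrow> smooth_function A (\<lambda>p. c * f p)"
  using smooth_function_lincomb[of f f c 0] by simp

lemma laplacian_cong:
  assumes "\<And>p. p \<in> manifold_of A \<Longrightarrow> f p = h p" "p \<in> manifold_of A"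
  shows "laplacian A g f p = laplacian A g h p"
proof -
  define b where "b = (SOME a. p \<in> cdom a)"
  obtain a where "p \<in> cdom a"
    using assms(2) by (auto simp: manifold_of_def)
  then have b: "p \<in> cdom b"
    unfolding b_def by (rule someI[of _ a])
  have "coord_laplacian (g b) (f \<circ> param A b) (chart A b p) = coord_laplacian (g b) (h \<circ> param A b) (chart A b p)"
    using b assms(1)[OF cdom_manifold[OF param_cdom]]
    by (intro coord_laplacian_cong[OF open_cimage[of b]]) auto
  then show ?thesis
    by (simp add: laplacian_def b_def Let_def)
qed

lemma laplacian_lincomb:
  assumes "smooth_function A f" "smooth_function A h" "p \<in> manifold_of A"
  shows "laplacian A g (\<lambda>q. f q + c * h q) p = laplacian A g f p + c * laplacian A g h p"
proof -
  obtain a where a: "p \<in> cdom a"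
    using assms(3) by (auto simp: manifold_of_def)
  have "smooth_function A (\<lambda>q. f q + c * h q)"
    using smooth_function_lincomb[OF assms(1,2), of 1 c] by simp
  then show ?thesis
    using coord_laplacian_lincomb[OF open_cimage smooth_functionD[OF assms(1)] smooth_functionD[OF assms(2)], of "chart A a p" a "g a" c] a
    by (simp add: laplacian_chart assms comp_def)
qed

end

section \<open>Differential operators\<close>

text \<open>An operator on all smooth functions of an open coordinate set, including those that do
  not come from a function on the manifold. This makes composition with partial derivatives possible
  inside a chart.\<close>

definition local_op :: "(real^'n::finite) set \<Rightarrow> nat \<Rightarrow> ((real^'n \<Rightarrow> real) \<Rightarrow> real^'n \<Rightarrow> real) \<Rightarrow> bool" where
  "local_op S m D \<longleftrightarrow> (\<exists>c. (\<forall>l. smooth_on S (c l)) \<and>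
     (\<forall>F. smooth_on S F \<longrightarrow> (\<forall>x\<in>S. D F x = (\<Sum>l | length l \<le> m. c l x * pds l F x))))"

lemma finite_length_le [simp]: "finite {l :: 'n::finite list. length l \<le> m}"
  using finite_lists_length_le[of "UNIV :: 'n set" m] by simp

lemma local_op_cong:
  "(\<And>F x. smooth_on S F \<Longrightarrow> x \<in> S \<Longrightarrow> D F x = E F x) \<Longrightarrow> local_op S m D \<Longrightarrow> local_op S m E"
  unfolding local_op_def by auto

lemma local_op_monomial:
  assumes "open S" "smooth_on S h" "length l \<le> m"
  shows "local_op S m (\<lambda>F x. h x * pds l F x)"
  unfolding local_op_def
proof (intro exI conjI allI impI ballI)
  show "smooth_on S (if l' = l then h else (\<lambda>x. 0))" for l'
    using assms by (simp add: smooth_on_const)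
  show "h x * pds l F x = (\<Sum>l' | length l' \<le> m. (if l' = l then h else (\<lambda>x. 0)) x * pds l' F x)" for F x
    using assms(3) by (simp add: if_distrib if_distribR cong: if_cong)
qed

lemma local_op_zero: "local_op S m (\<lambda>F x. 0)"
  unfolding local_op_def by (intro exI[of _ "\<lambda>l x. 0"]) (simp add: smooth_on_const)

lemma local_op_add:
  assumes "open S" "local_op S m D" "local_op S m E"
  shows "local_op S m (\<lambda>F x. D F x + E F x)"
proof -
  obtain c d where c: "\<forall>l. smooth_on S (c l)"
      "\<forall>F. smooth_on S F \<longrightarrow> (\<forall>x\<in>S. D F x = (\<Sum>l | length l \<le> m. c l x * pds l F x))"
    and d: "\<forall>l. smooth_on S (d l)"
      "\<forall>F. smooth_on S F \<longrightarrow> (\<forall>x\<in>S. E F x = (\<Sum>l | length l \<le> m. d l x * pds l F x))"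
    using assms(2,3) unfolding local_op_def by blast
  then show ?thesis
    unfolding local_op_def
    by (intro exI[of _ "\<lambda>l x. c l x + d l x"]) (auto simp: sum.distrib algebra_simps intro: smooth_on_add[OF assms(1)])
qed

lemma local_op_mult:
  assumes "open S" "smooth_on S h" "local_op S m D"
  shows "local_op S m (\<lambda>F x. h x * D F x)"
proof -
  obtain c where c: "\<forall>l. smooth_on S (c l)"
      "\<forall>F. smooth_on S F \<longrightarrow> (\<forall>x\<in>S. D F x = (\<Sum>l | length l \<le> m. c l x * pds l F x))"
    using assms(3) unfolding local_op_def by blast
  then show ?thesis
    unfolding local_op_def
    by (intro exI[of _ "\<lambda>l x. h x * c l x"])
      (auto simp: sum_distrib_left algebra_simps intro: smooth_on_mult[OF assms(1,2)])
qed

lemma local_op_sum: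
  assumes "open S" "\<And>i. i \<in> I \<Longrightarrow> local_op S m (D i)"
  shows "local_op S m (\<lambda>F x. \<Sum>i\<in>I. D i F x)"
  using assms(2)
  by (induction I rule: infinite_finite_induct) (auto simp: local_op_zero intro: local_op_add[OF assms(1)])

lemma local_op_mono:
  assumes "open S" "local_op S m D" "m \<le> m'"
  shows "local_op S m' D"
proof -
  obtain c where c: "\<forall>l. smooth_on S (c l)"
      "\<And>F x. smooth_on S F \<Longrightarrow> x \<in> S \<Longrightarrow> D F x = (\<Sum>l | length l \<le> m. c l x * pds l F x)"
    using assms(2) unfolding local_op_def by blast
  have "local_op S m' (\<lambda>F x. \<Sum>l | length l \<le> m. c l x * pds l F x)"
    using c(1) assms(3) by (intro local_op_sum local_op_monomial assms(1)) auto
  then show ?thesis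
    by (rule local_op_cong[rotated]) (simp add: c(2))
qed

lemma local_op_smooth:
  assumes "open S" "local_op S m D" "smooth_on S F"
  shows "smooth_on S (D F)"
proof -
  obtain c where c: "\<And>l. smooth_on S (c l)"
      "\<And>F x. smooth_on S F \<Longrightarrow> x \<in> S \<Longrightarrow> D F x = (\<Sum>l | length l \<le> m. c l x * pds l F x)"
    using assms(2) unfolding local_op_def by blast
  have "smooth_on S (\<lambda>x. \<Sum>l | length l \<le> m. c l x * pds l F x)"
    by (intro smooth_on_sum smooth_on_mult c smooth_on_pds assms)
  from smooth_on_cong[OF assms(1), THEN iffD1, OF _ this] show ?thesis
    by (simp add: c(2)[OF assms(3)])
qed

lemma local_op_pd:
  assumes "open S" "local_op S m D"
  shows "local_op S (Suc m) (\<lambda>F. pd i (D F))"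
proof -
  obtain c where c: "\<And>l. smooth_on S (c l)"
      "\<And>F x. smooth_on S F \<Longrightarrow> x \<in> S \<Longrightarrow> D F x = (\<Sum>l | length l \<le> m. c l x * pds l F x)"
    using assms(2) unfolding local_op_def by blast
  have "local_op S (Suc m) (\<lambda>F x. \<Sum>l | length l \<le> m. c l x * pds (i # l) F x + pd i (c l) x * pds l F x)"
    by (intro local_op_sum local_op_add local_op_monomial assms(1) smooth_on_pd c) auto
  moreover have "(\<Sum>l | length l \<le> m. c l x * pds (i # l) F x + pd i (c l) x * pds l F x) = pd i (D F) x"
    if F: "smooth_on S F" "x \<in> S" for F x
  proof -
    have cd: "c l differentiable at x" "pds l F differentiable at x" for l
      using smooth_on_differentiable[OF _ F(2)] c(1) smooth_on_pds[OF F(1)] by blast+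
    have "pd i (D F) x = pd i (\<lambda>y. \<Sum>l | length l \<le> m. c l y * pds l F y) x"
      by (rule pd_cong[OF assms(1) F(2) c(2)[OF F(1)]])
    then show ?thesis
      by (simp add: pd_sum pd_mult cd)
  qed
  ultimately show ?thesis
    by (rule local_op_cong[rotated])
qed

lemma local_op_laplacian:
  assumes "coord_metric S G" "local_op S m D"
  shows "local_op S (m + 2) (\<lambda>F. coord_laplacian G (D F))"
proof -
  note S = coord_metricD(1)[OF assms(1)]
  have 1: "local_op S (m + 2) (\<lambda>F. pd k (D F))" for k
    by (rule local_op_mono[OF S local_op_pd[OF S assms(2)]]) simp
  have 2: "local_op S (m + 2) (\<lambda>F. pd i (pd j (D F)))" for i j
    by (rule local_op_mono[OF S local_op_pd[OF S local_op_pd[OF S assms(2)]]]) simp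
  \<comment> \<open>Closure is available for sums and for multiplication by smooth functions, so the
    subtracted Christoffel term is turned into a sum with negated coefficients.\<close>
  have eq: "coord_laplacian G f = (\<lambda>x. \<Sum>i\<in>UNIV. \<Sum>j\<in>UNIV. matrix_inv (G x) $ i $ j *
     (pd i (pd j f) x + (\<Sum>k\<in>UNIV. (- christoffel G k i j x) * pd k f x)))" for f
    unfolding coord_laplacian_def[abs_def] by (simp add: sum_negf)
  show ?thesis
    unfolding eq
    by (intro local_op_sum local_op_mult local_op_add 1 2 S smooth_on_metric_inv smooth_on_uminus
        smooth_on_christoffel assms(1))
qed

context pr_manifold
begin

text \<open>The coefficients of a differential operator in a chart define an operator on every
  smooth function there, so closure properties can be proved in coordinates and carried
  back.\<close>

lemma diff_op_iff_local_op:
  "diff_op A m D \<longleftrightarrow> (\<forall>a. \<exists>E. local_op (cimage a) m E \<and>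
     (\<forall>f. smooth_function A f \<longrightarrow> (\<forall>p\<in>cdom a. D f p = E (f \<circ> param A a) (chart A a p))))"
proof
  assume l: "diff_op A m D"
  show "\<forall>a. \<exists>E. local_op (cimage a) m E \<and>
     (\<forall>f. smooth_function A f \<longrightarrow> (\<forall>p\<in>cdom a. D f p = E (f \<circ> param A a) (chart A a p)))"
  proof
    fix a
    obtain c where c: "\<forall>l. smooth_on (cimage a) (c l)"
      "\<forall>f. smooth_function A f \<longrightarrow> (\<forall>p\<in>cdom a. D f p =
        (\<Sum>l | length l \<le> m. c l (chart A a p) * pds l (f \<circ> param A a) (chart A a p)))"
      using l unfolding diff_op_def by blast
    have "local_op (cimage a) m (\<lambda>F x. \<Sum>l | length l \<le> m. c l x * pds l F x)"
      using c(1) unfolding local_op_def by blast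
    with c(2) show "\<exists>E. local_op (cimage a) m E \<and>
       (\<forall>f. smooth_function A f \<longrightarrow> (\<forall>p\<in>cdom a. D f p = E (f \<circ> param A a) (chart A a p)))"
      by (intro exI[of _ "\<lambda>F x. \<Sum>l | length l \<le> m. c l x * pds l F x"]) blast
  qed
next
  assume r: "\<forall>a. \<exists>E. local_op (cimage a) m E \<and>
     (\<forall>f. smooth_function A f \<longrightarrow> (\<forall>p\<in>cdom a. D f p = E (f \<circ> param A a) (chart A a p)))"
  show "diff_op A m D"
    unfolding diff_op_def
  proof
    fix a
    obtain E where E: "local_op (cimage a) m E"
       "\<forall>f. smooth_function A f \<longrightarrow> (\<forall>p\<in>cdom a. D f p = E (f \<circ> param A a) (chart A a p))"
      using r by blast
    obtain c where c: "\<forall>l. smooth_on (cimage a) (c l)"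
      "\<forall>F. smooth_on (cimage a) F \<longrightarrow> (\<forall>x\<in>cimage a. E F x = (\<Sum>l | length l \<le> m. c l x * pds l F x))"
      using E(1) unfolding local_op_def by blast
    show "\<exists>c. (\<forall>l. smooth_on (cimage a) (c l)) \<and>
        (\<forall>f. smooth_function A f \<longrightarrow> (\<forall>p \<in> cdom a.
           D f p = (\<Sum>l | length l \<le> m. c l (chart A a p) * pds l (f \<circ> param A a) (chart A a p))))"
      using c E(2) smooth_functionD by (intro exI[of _ c]) auto
  qed
qed

lemma diff_op_cong:
  "(\<And>f p. smooth_function A f \<Longrightarrow> p \<in> manifold_of A \<Longrightarrow> D f p = E f p) \<Longrightarrow> diff_op A m D \<Longrightarrow> diff_op A m E"
  unfolding diff_op_def using cdom_manifold by auto

lemma diff_op_id: "diff_op A m (\<lambda>f. f)"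
  unfolding diff_op_iff_local_op
proof (intro allI exI conjI impI ballI)
  show "local_op (cimage a) m (\<lambda>F x. 1 * pds [] F x)" for a
    by (rule local_op_monomial[OF open_cimage]) (simp_all add: smooth_on_const)
qed (simp add: param_chart)

lemma diff_op_mono: "diff_op A m D \<Longrightarrow> m \<le> m' \<Longrightarrow> diff_op A m' D"
  unfolding diff_op_iff_local_op using local_op_mono[OF open_cimage] by blast

lemma diff_op_lincomb:
  assumes "diff_op A m D" "diff_op A m E"
  shows "diff_op A m (\<lambda>f p. c * D f p + d * E f p)"
  unfolding diff_op_iff_local_op
proof
  fix a
  obtain D' E' where *: "local_op (cimage a) m D'" "local_op (cimage a) m E'"
    "\<And>f p. smooth_function A f \<Longrightarrow> p \<in> cdom a \<Longrightarrow> D f p = D' (f \<circ> param A a) (chart A a p)"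
    "\<And>f p. smooth_function A f \<Longrightarrow> p \<in> cdom a \<Longrightarrow> E f p = E' (f \<circ> param A a) (chart A a p)"
    using assms unfolding diff_op_iff_local_op by metis
  have "local_op (cimage a) m (\<lambda>F x. c * D' F x + d * E' F x)"
    by (intro local_op_add local_op_mult open_cimage smooth_on_const *)
  then show "\<exists>F. local_op (cimage a) m F \<and> (\<forall>f. smooth_function A f \<longrightarrow>
      (\<forall>p\<in>cdom a. c * D f p + d * E f p = F (f \<circ> param A a) (chart A a p)))"
    by (intro exI[of _ "\<lambda>F x. c * D' F x + d * E' F x"]) (simp add: *)
qed

lemma diff_op_smooth:
  assumes "diff_op A m D" "smooth_function A f"
  shows "smooth_function A (D f)"
  unfolding smooth_function_def
proof
  fix a
  obtain E where E: "local_op (cimage a) m E"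
    "\<And>f p. smooth_function A f \<Longrightarrow> p \<in> cdom a \<Longrightarrow> D f p = E (f \<circ> param A a) (chart A a p)"
    using assms unfolding diff_op_iff_local_op by metis
  have "E (f \<circ> param A a) x = (D f \<circ> param A a) x" if "x \<in> cimage a" for x
    using E(2)[OF assms(2) param_cdom[OF that]] chart_param[OF that] by simp
  then show "smooth_on (cimage a) (D f \<circ> param A a)"
    using smooth_on_cong[OF open_cimage] local_op_smooth[OF open_cimage E(1) smooth_functionD[OF assms(2)]] by metis
qed

lemma diff_op_laplacian:
  assumes "diff_op A m D"
  shows "diff_op A (m + 2) (\<lambda>f. laplacian A g (D f))"
  unfolding diff_op_iff_local_op
proof
  fix a
  obtain E where E: "local_op (cimage a) m E"
    "\<And>f p. smooth_function A f \<Longrightarrow> p \<in> cdom a \<Longrightarrow> D f p = E (f \<circ> param A a) (chart A a p)"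
    using assms unfolding diff_op_iff_local_op by metis
  have "laplacian A g (D f) p = coord_laplacian (g a) (E (f \<circ> param A a)) (chart A a p)"
    if f: "smooth_function A f" and p: "p \<in> cdom a" for f p
  proof -
    have "E (f \<circ> param A a) x = (D f \<circ> param A a) x" if "x \<in> cimage a" for x
      using E(2)[OF f param_cdom[OF that]] chart_param[OF that] by simp
    then show ?thesis
      unfolding laplacian_chart[OF diff_op_smooth[OF assms f] p]
      using p by (intro coord_laplacian_cong[OF open_cimage[of a]]) auto
  qed
  then show "\<exists>F. local_op (cimage a) (m + 2) F \<and> (\<forall>f. smooth_function A f \<longrightarrow>
      (\<forall>p\<in>cdom a. laplacian A g (D f) p = F (f \<circ> param A a) (chart A a p)))"
    using local_op_laplacian[OF metric_cimage E(1)] by blast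
qed

section \<open>Products of shifted Laplacians and their principal parts\<close>

definition shifted :: "real \<Rightarrow> ('m \<Rightarrow> real) \<Rightarrow> 'm \<Rightarrow> real" where
  "shifted s f p = minus_laplacian A g f p + s * f p"

text \<open>A list of shifts, head outermost, has both the product in the theorem and the power of
  \<open>minus_laplacian\<close> (all shifts zero) as instances, so a single induction compares
  them.\<close>

definition shifted_prod :: "real list \<Rightarrow> ('m \<Rightarrow> real) \<Rightarrow> 'm \<Rightarrow> real" where
  "shifted_prod ss = foldr (\<lambda>s T. shifted s \<circ> T) ss id"

lemma shifted_prod_simps [simp]:
  "shifted_prod [] f = f" "shifted_prod (s # ss) f = shifted s (shifted_prod ss f)"
  by (simp_all add: shifted_prod_def)

lemma diff_op_shifted:
  assumes "diff_op A m D"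
  shows "diff_op A (m + 2) (\<lambda>f. shifted s (D f))"
  using diff_op_lincomb[OF diff_op_laplacian[OF assms] diff_op_mono[OF assms le_add1], of "-1" s]
  unfolding shifted_def[abs_def] minus_laplacian_def[abs_def] by simp

lemma diff_op_shifted_prod: "diff_op A (2 * length ss) (shifted_prod ss)"
proof (induction ss)
  case Nil
  then show ?case using diff_op_id[of 0] by (simp add: shifted_prod_def id_def)
next
  case (Cons s ss)
  then show ?case using diff_op_shifted[OF Cons, of s] by (simp add: shifted_prod_def comp_def)
qed

lemma smooth_function_shifted_prod: "smooth_function A f \<Longrightarrow> smooth_function A (shifted_prod ss f)"
  using diff_op_smooth[OF diff_op_shifted_prod] .

lemma minus_laplacian_power: "minus_laplacian A g ^^ k = shifted_prod (replicate k 0)"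
proof (induction k)
  case (Suc k)
  have "minus_laplacian A g = shifted 0"
    by (simp add: shifted_def[abs_def] minus_laplacian_def[abs_def])
  then show ?case using Suc by (simp add: shifted_prod_def)
qed (simp add: shifted_prod_def)

text \<open>With T the product over \<open>ss\<close> and T0 the power of equal length, one more
  factor changes the difference T - T0 into -\<Delta>(T - T0) + s T. The first term gains two
  orders, and the second has order \<open>2 * length ss\<close>, one less than that of the new
  product minus one more cancellation of the top order.\<close>

lemma shifted_prod_principal_part:
  assumes "ss \<noteq> []"
  shows "diff_op A (2 * length ss - 1)
    (\<lambda>f p. shifted_prod ss f p - shifted_prod (replicate (length ss) 0) f p)"
  using assms
proof (induction ss rule: list_nonempty_induct)
  \<comment> \<open>The induction starts at length one. For the empty list the truncated bound
    \<open>2 * length ss - 1\<close> is 0, and adding two orders would give 2 instead of the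
    required 1.\<close>
  case (single s)
  have "diff_op A 1 (\<lambda>f p. s * f p + 0 * f p)"
    by (rule diff_op_lincomb[OF diff_op_id diff_op_id])
  then show ?case by (simp add: shifted_def)
next
  case (cons s ss)
  let ?E = "\<lambda>f p. shifted_prod ss f p - shifted_prod (replicate (length ss) 0) f p"
  have le: "2 * length ss \<le> 2 * length (s # ss) - 1"
    by simp
  have e: "2 * length ss - 1 + 2 = 2 * length (s # ss) - 1"
    using cons.hyps by (cases ss) auto
  have "diff_op A (2 * length (s # ss) - 1) (\<lambda>f p. (-1) * laplacian A g (?E f) p + s * shifted_prod ss f p)"
    by (intro diff_op_lincomb diff_op_mono[OF diff_op_shifted_prod le] diff_op_laplacian[OF cons.IH, unfolded e])
  moreover have "(-1) * laplacian A g (?E f) p + s * shifted_prod ss f p =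
      shifted_prod (s # ss) f p - shifted_prod (replicate (length (s # ss)) 0) f p"
    if "smooth_function A f" "p \<in> manifold_of A" for f p
    using laplacian_lincomb[OF smooth_function_shifted_prod smooth_function_shifted_prod, OF that(1,1,2),
        of ss "-1" "replicate (length ss) 0"]
    by (simp add: shifted_def minus_laplacian_def)
  ultimately show ?case
    by (rule diff_op_cong[rotated])
qed

end

section \<open>The Laplacian of the ambient metric\<close>

text \<open>The Christoffel symbols of the first kind, contracted with the inverse metric:
  \<open>G\<^sup>i\<^sup>j \<Gamma>\<^sub>l\<^sub>i\<^sub>j\<close>.\<close>

definition contracted_christoffel :: "(real^'n \<Rightarrow> real^'n^'n) \<Rightarrow> 'n::finite \<Rightarrow> real^'n \<Rightarrow> real" where
  "contracted_christoffel G l x = (\<Sum>i\<in>UNIV. \<Sum>j\<in>UNIV. matrix_inv (G x) $ i $ j *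
     (pd i (\<lambda>y. G y $ j $ l) x + pd j (\<lambda>y. G y $ i $ l) x - pd l (\<lambda>y. G y $ i $ j) x)) / 2"

text \<open>Contracting before raising the index leaves one number per coordinate direction in place
  of the full set of Christoffel symbols, which keeps the ambient computation short.\<close>

lemma coord_laplacian_contracted:
  "coord_laplacian G f x = (\<Sum>i\<in>UNIV. \<Sum>j\<in>UNIV. matrix_inv (G x) $ i $ j * pd i (pd j f) x)
     - (\<Sum>k\<in>UNIV. \<Sum>l\<in>UNIV. matrix_inv (G x) $ k $ l * contracted_christoffel G l x * pd k f x)"
proof -
  let ?K = "matrix_inv (G x)"
  define c where "c = (\<lambda>i j l. pd i (\<lambda>y. G y $ j $ l) x + pd j (\<lambda>y. G y $ i $ l) x - pd l (\<lambda>y. G y $ i $ j) x)"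
  have "(\<Sum>i\<in>UNIV. \<Sum>j\<in>UNIV. \<Sum>k\<in>UNIV. \<Sum>l\<in>UNIV. ?K $ i $ j * (?K $ k $ l * c i j l / 2 * pd k f x))
     = (\<Sum>k\<in>UNIV. \<Sum>l\<in>UNIV. \<Sum>i\<in>UNIV. \<Sum>j\<in>UNIV. ?K $ i $ j * (?K $ k $ l * c i j l / 2 * pd k f x))"
  proof -
    have "(\<Sum>i\<in>UNIV. \<Sum>j\<in>UNIV. \<Sum>k\<in>UNIV. \<Sum>l\<in>UNIV. h i j k l) =
        (\<Sum>k\<in>UNIV. \<Sum>l\<in>UNIV. \<Sum>i\<in>UNIV. \<Sum>j\<in>UNIV. h i j k l)" for h :: "'a \<Rightarrow> 'a \<Rightarrow> 'a \<Rightarrow> 'a \<Rightarrow> real"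
    proof -
      have "(\<Sum>i\<in>UNIV. \<Sum>j\<in>UNIV. \<Sum>k\<in>UNIV. \<Sum>l\<in>UNIV. h i j k l) = (\<Sum>i\<in>UNIV. \<Sum>k\<in>UNIV. \<Sum>j\<in>UNIV. \<Sum>l\<in>UNIV. h i j k l)"
        by (rule sum.cong[OF refl], rule sum.swap)
      also have "\<dots> = (\<Sum>k\<in>UNIV. \<Sum>i\<in>UNIV. \<Sum>j\<in>UNIV. \<Sum>l\<in>UNIV. h i j k l)"
        by (rule sum.swap)
      also have "\<dots> = (\<Sum>k\<in>UNIV. \<Sum>i\<in>UNIV. \<Sum>l\<in>UNIV. \<Sum>j\<in>UNIV. h i j k l)"
        by (rule sum.cong[OF refl], rule sum.cong[OF refl], rule sum.swap)
      also have "\<dots> = (\<Sum>k\<in>UNIV. \<Sum>l\<in>UNIV. \<Sum>i\<in>UNIV. \<Sum>j\<in>UNIV. h i j k l)"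
        by (rule sum.cong[OF refl], rule sum.swap)
      finally show ?thesis .
    qed
    then show ?thesis .
  qed
  moreover have "christoffel G k i j x = (\<Sum>l\<in>UNIV. ?K $ k $ l * c i j l) / 2"
    and "contracted_christoffel G l x = (\<Sum>i\<in>UNIV. \<Sum>j\<in>UNIV. ?K $ i $ j * c i j l) / 2" for k i j l
    by (simp_all add: christoffel_def contracted_christoffel_def c_def)
  ultimately show ?thesis
    unfolding coord_laplacian_def
    by (simp add: right_diff_distrib sum_subtractf sum_distrib_left sum_distrib_right sum_divide_distrib mult_ac)
qed

lemma sum_amb: "(\<Sum>I\<in>UNIV. h I) = h AmbT + h AmbR + (\<Sum>i\<in>UNIV. h (AmbX i))"
  for h :: "'n::finite amb \<Rightarrow> 'b::comm_monoid_add"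
proof -
  have "UNIV = insert AmbT (insert AmbR (range (AmbX :: 'n \<Rightarrow> 'n amb)))"
    by (auto intro: amb.exhaust)
  then have "sum h UNIV = h AmbT + (h AmbR + sum h (range AmbX))"
    by (metis (no_types, lifting) amb.distinct finite sum.insert insertE imageE)
  also have "sum h (range AmbX) = (\<Sum>i\<in>UNIV. h (AmbX i))"
    by (subst sum.reindex) (auto simp: inj_on_def)
  finally show ?thesis by (simp add: add.assoc)
qed

section \<open>Coordinates t, x, \<rho> on the ambient space\<close>

definition emb :: "real \<Rightarrow> real^'n \<Rightarrow> real \<Rightarrow> real^('n::finite amb)" where
  "emb t x \<rho> = (\<chi> I. case I of AmbT \<Rightarrow> t | AmbX i \<Rightarrow> x $ i | AmbR \<Rightarrow> \<rho>)"

definition xpart :: "real^('n::finite amb) \<Rightarrow> real^'n" where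
  "xpart X = (\<chi> i. X $ AmbX i)"

lemma emb_simps [simp]:
  "emb t x \<rho> $ AmbT = t" "emb t x \<rho> $ AmbX i = x $ i" "emb t x \<rho> $ AmbR = \<rho>"
  "xpart X $ i = X $ AmbX i" "xpart (emb t x \<rho>) = x"
  by (simp_all add: emb_def xpart_def)

lemma emb_eta: "X = emb (X $ AmbT) (xpart X) (X $ AmbR)"
  by (simp add: vec_eq_iff emb_def xpart_def split: amb.split)

definition amb_region :: "real \<Rightarrow> (real^'n::finite) set \<Rightarrow> (real^('n amb)) set" where
  "amb_region lam S = {X. X $ AmbT > 0 \<and> xpart X \<in> S \<and> 1 + lam * X $ AmbR > 0}"

lemma linear_xpart: "bounded_linear (xpart :: real^('n::finite amb) \<Rightarrow> real^'n)"
  by (intro linear_conv_bounded_linear[THEN iffD1] linearI) (simp_all add: vec_eq_iff)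

lemma open_amb_region:
  assumes "open S"
  shows "open (amb_region lam S)"
proof -
  have "amb_region lam S = {X. 0 < X $ AmbT} \<inter> xpart -` S \<inter> {X. 0 < 1 + lam * X $ AmbR}"
    by (auto simp: amb_region_def)
  moreover have "open (xpart -` S)"
    by (intro open_vimage assms linear_continuous_on linear_xpart)
  ultimately show ?thesis
    by (auto intro!: open_Int open_Collect_less continuous_intros)
qed

lemma pd_xpart:
  assumes "h differentiable at (xpart X)"
  shows "pd I (\<lambda>X. h (xpart X)) X = (case I of AmbX i \<Rightarrow> pd i h (xpart X) | _ \<Rightarrow> 0)"
proof -
  have "(\<lambda>X. xpart X $ j) differentiable at X" for j
    by (simp add: bounded_linear_imp_differentiable bounded_linear_vec_nth)
  from pd_compose[OF this assms, of I] show ?thesis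
    by (simp add: if_distrib split: amb.split cong: if_cong)
qed

lemma pd_emb_x:
  assumes "h differentiable at (emb t x \<rho>)"
  shows "pd i (\<lambda>x. h (emb t x \<rho>)) x = pd (AmbX i) h (emb t x \<rho>)"
proof -
  have "(\<lambda>x. emb t x \<rho> $ J) differentiable at x" for J
    by (cases J) (simp_all add: bounded_linear_imp_differentiable bounded_linear_vec_nth)
  from pd_compose[OF this assms, of i] show ?thesis
    by (simp add: sum_amb if_distrib cong: if_cong)
qed

lemma smooth_on_emb:
  fixes x :: "'a::real_normed_vector \<Rightarrow> real^'n::finite" and h :: "real^('n amb) \<Rightarrow> real"
  assumes "open T" "\<And>i. smooth_on T (\<lambda>y. x y $ i)" "smooth_on T t" "smooth_on T \<rho>"
    "(\<lambda>y. emb (t y) (x y) (\<rho> y)) ` T \<subseteq> S" "smooth_on S h"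
  shows "smooth_on T (\<lambda>y. h (emb (t y) (x y) (\<rho> y)))"
proof (rule smooth_on_compose_vec[OF assms(1) _ assms(5,6)])
  show "smooth_on T (\<lambda>y. emb (t y) (x y) (\<rho> y) $ j)" for j
    using assms(2-4) by (cases j) simp_all
qed

lemma pd_powr_mult:
  assumes "h differentiable at X" "X $ AmbT > 0"
  shows "pd I (\<lambda>X. (X $ AmbT) powr w * h X) X =
    (if I = AmbT then w * (X $ AmbT) powr (w - 1) * h X else 0) + (X $ AmbT) powr w * pd I h X"
proof -
  have "((\<lambda>y. y powr w) has_derivative (*) (w * (X $ AmbT) powr (w - 1))) (at (X $ AmbT))"
    using has_real_derivative_powr[OF assms(2), of w] by (simp add: has_field_derivative_def)
  from has_derivative_compose[OF bounded_linear_imp_has_derivative[OF bounded_linear_vec_nth] this]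
  have d: "((\<lambda>X. (X $ AmbT) powr w) has_derivative (\<lambda>H. w * (X $ AmbT) powr (w - 1) * H $ AmbT)) (at X)" .
  show ?thesis
    by (subst pd_mult[OF differentiableI[OF d] assms(1)]) (simp add: pd_eqI[OF d] axis_def)
qed

lemma ambient_metric_simps [simp]:
  "ambient_metric g lam a X $ AmbT $ AmbT = 2 * X $ AmbR"
  "ambient_metric g lam a X $ AmbT $ AmbR = X $ AmbT"
  "ambient_metric g lam a X $ AmbR $ AmbT = X $ AmbT"
  "ambient_metric g lam a X $ AmbR $ AmbR = 0"
  "ambient_metric g lam a X $ AmbT $ AmbX i = 0"
  "ambient_metric g lam a X $ AmbX i $ AmbT = 0"
  "ambient_metric g lam a X $ AmbR $ AmbX i = 0"
  "ambient_metric g lam a X $ AmbX i $ AmbR = 0"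
  "ambient_metric g lam a X $ AmbX i $ AmbX j = (X $ AmbT)\<^sup>2 * (1 + lam * X $ AmbR)\<^sup>2 * g a (xpart X) $ i $ j"
  by (simp_all add: ambient_metric_def Let_def xpart_def)

text \<open>At t = 1 the inverse ambient metric consists of the block with rows (0, 1) and (1,
  -2\<rho>) in the directions t, \<rho> and of the inverse of \<open>g\<close> divided by u^2. As
  \<open>h\<close> does not depend on t, derivatives in t act on the power alone, and the second
  t-derivative is multiplied by the zero entry of the block.\<close>

lemma ambient_coord_laplacian:
  fixes g :: "('i, 'n::finite) tensor2"
  assumes g: "coord_metric S (g a)" and x: "x \<in> S" and u: "1 + lam * \<rho> > 0"
    and h: "smooth_on (amb_region lam S) h" "\<And>X. X \<in> amb_region lam S \<Longrightarrow> pd AmbT h X = 0"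
  defines "X \<equiv> emb 1 x \<rho>" and "n \<equiv> real CARD('n)"
  shows "coord_laplacian (ambient_metric g lam a) (\<lambda>X. (X $ AmbT) powr w * h X) X =
     - 2 * \<rho> * pd AmbR (pd AmbR h) X + (2 * w + n - 2 - 2 * n * lam * \<rho> / (1 + lam * \<rho>)) * pd AmbR h X
     + coord_laplacian (g a) (\<lambda>y. h (emb 1 y \<rho>)) x / (1 + lam * \<rho>)\<^sup>2 + lam * n * w / (1 + lam * \<rho>) * h X"
proof -
  let ?G = "ambient_metric g lam a" and ?u = "1 + lam * \<rho>"
  define \<Omega> where "\<Omega> = amb_region lam S"
  have \<Omega>: "open \<Omega>"
    unfolding \<Omega>_def by (rule open_amb_region[OF coord_metricD(1)[OF g]])
  have X\<Omega>: "X \<in> \<Omega>" and e\<Omega>: "\<And>y. y \<in> S \<Longrightarrow> emb 1 y \<rho> \<in> \<Omega>"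
    using x u by (auto simp: \<Omega>_def amb_region_def X_def)
  have X[simp]: "X $ AmbT = 1" "X $ AmbR = \<rho>" "xpart X = x"
    by (simp_all add: X_def)
  define K where "K = matrix_inv (g a x)"
  have u0: "?u \<noteq> 0" using u by simp
  define N :: "real^('n amb)^('n amb)" where "N = (\<chi> I J. case (I, J) of
      (AmbT, AmbR) \<Rightarrow> 1 | (AmbR, AmbT) \<Rightarrow> 1 | (AmbR, AmbR) \<Rightarrow> - 2 * \<rho>
      | (AmbX i, AmbX j) \<Rightarrow> K $ i $ j / ?u\<^sup>2 | _ \<Rightarrow> 0)"
  have N[simp]: "N $ AmbT $ AmbT = 0" "N $ AmbT $ AmbR = 1" "N $ AmbR $ AmbT = 1" "N $ AmbR $ AmbR = - 2 * \<rho>"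
    "N $ AmbT $ AmbX i = 0" "N $ AmbX i $ AmbT = 0" "N $ AmbR $ AmbX i = 0" "N $ AmbX i $ AmbR = 0"
    "N $ AmbX i $ AmbX j = K $ i $ j / ?u\<^sup>2" for i j
    by (simp_all add: N_def)
  have Kg: "(\<Sum>j\<in>UNIV. K $ i $ j * g a x $ j $ l) = (if i = l then 1 else 0)" for i l
    using matrix_inv_left[OF coord_metricD(4)[OF g x]]
    unfolding K_def matrix_matrix_mult_def vec_eq_iff by (simp add: mat_def)
  have "N ** ?G X = mat 1"
  proof -
    have "(N ** ?G X) $ I $ J = mat 1 $ I $ J" for I J
      by (cases I; cases J) (simp_all add: matrix_matrix_mult_def sum_amb mat_def u0 Kg)
    then show ?thesis by (simp add: vec_eq_iff)
  qed
  then have inv: "matrix_inv (?G X) = N"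
    by (rule matrix_inv_eqI)
  have tr: "(\<Sum>i\<in>UNIV. \<Sum>j\<in>UNIV. K $ i $ j * g a x $ i $ j) = n"
  proof -
    have "(\<Sum>j\<in>UNIV. K $ i $ j * g a x $ i $ j) = 1" for i
      using Kg[of i i] by (simp add: coord_metricD(3)[OF g x, of i])
    then show ?thesis by (simp add: n_def)
  qed
  have gd: "(\<lambda>y. g a y $ i $ j) differentiable at (xpart X)" for i j
    using smooth_on_differentiable[OF coord_metricD(2)[OF g] x] by simp
  have gd': "(\<lambda>X. g a (xpart X) $ i $ j) differentiable at X" for i j
    using differentiable_compose[OF gd bounded_linear_imp_differentiable[OF linear_xpart]] .
  have sq: "((\<lambda>X. (X $ AmbT)\<^sup>2 * (1 + lam * X $ AmbR)\<^sup>2) has_derivative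
      (\<lambda>H. 2 * ?u\<^sup>2 * H $ AmbT + 2 * lam * ?u * H $ AmbR)) (at X)"
    by (auto intro!: derivative_eq_intros bounded_linear_imp_has_derivative[OF bounded_linear_vec_nth] ext
        simp: algebra_simps)
  have dXX: "pd I (\<lambda>X. (X $ AmbT)\<^sup>2 * (1 + lam * X $ AmbR)\<^sup>2 * g a (xpart X) $ i $ j) X =
     (case I of AmbT \<Rightarrow> 2 * ?u\<^sup>2 * g a x $ i $ j | AmbR \<Rightarrow> 2 * lam * ?u * g a x $ i $ j
      | AmbX k \<Rightarrow> ?u\<^sup>2 * pd k (\<lambda>y. g a y $ i $ j) x)" for I i j
    by (subst pd_mult[OF differentiableI[OF sq] gd'])
      (simp add: pd_eqI[OF sq] pd_xpart[OF gd] axis_def split: amb.split)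
  have dTT: "pd I (\<lambda>X. 2 * X $ AmbR) X = (if I = AmbR then 2 else 0)" for I
    by (subst pd_cmult) (simp_all add: bounded_linear_imp_differentiable bounded_linear_vec_nth)
  note dG = dXX dTT
  \<comment> \<open>Write V_l as the divergence term
    \<open>G\<^sup>i\<^sup>j \<partial>\<^sub>i G\<^sub>j\<^sub>l\<close> minus half the trace of
    the l-th derivative of the metric. For t this is 3 - (1 + n), for \<rho> it is 0 - n \<lambda> /
    u. In the x-directions the factor u^2 of the metric cancels against that of the inverse.\<close>
  have V: "contracted_christoffel ?G AmbT X = 2 - n" 
    "contracted_christoffel ?G AmbR X = - n * lam / ?u"
    "contracted_christoffel ?G (AmbX l) X = contracted_christoffel (g a) l x" for l
  proof -
    have t1: "(\<Sum>i\<in>UNIV. \<Sum>j\<in>UNIV. K $ i $ j * (2 * ?u\<^sup>2 * g a x $ i $ j) / ?u\<^sup>2) = 2 * n"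
      unfolding tr[symmetric] sum_distrib_left using u0 by (intro sum.cong refl) simp
    have t2: "(\<Sum>i\<in>UNIV. \<Sum>j\<in>UNIV. K $ i $ j * (2 * lam * ?u * g a x $ i $ j) / ?u\<^sup>2) = 2 * lam * n / ?u"
      unfolding tr[symmetric] sum_distrib_left sum_divide_distrib
      using u0 by (intro sum.cong refl) (simp add: power2_eq_square)
    show "contracted_christoffel ?G AmbT X = 2 - n"
      using t1 unfolding contracted_christoffel_def inv
      by (simp add: sum_amb dG sum_negf)
    show "contracted_christoffel ?G AmbR X = - n * lam / ?u"
      using t2 unfolding contracted_christoffel_def inv
      by (simp add: sum_amb dG sum_negf del: distrib_left_numeral distrib_right_numeral)
    show "contracted_christoffel ?G (AmbX l) X = contracted_christoffel (g a) l x"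
      unfolding contracted_christoffel_def inv K_def[symmetric] using u0
      by (simp add: sum_amb dG distrib_left[symmetric] right_diff_distrib[symmetric])
  qed
  define F where "F = (\<lambda>X. (X $ AmbT) powr w * h X)"
  note hd = smooth_on_differentiable[OF h(1)[folded \<Omega>_def]]
  note hd' = smooth_on_differentiable[OF smooth_on_pd[OF h(1)[folded \<Omega>_def]]]
  have T: "Y $ AmbT > 0" if "Y \<in> \<Omega>" for Y
    using that by (simp add: \<Omega>_def amb_region_def)
  have dF: "pd I F Y = (if I = AmbT then w * ((Y $ AmbT) powr (w - 1) * h Y) else (Y $ AmbT) powr w * pd I h Y)"
    if "Y \<in> \<Omega>" for I Y
    unfolding F_def pd_powr_mult[OF hd[OF that] T[OF that]] using h(2) that by (simp add: \<Omega>_def)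
  have pTp: "pd AmbT (pd J h) X = 0" for J
  proof -
    have "pd AmbT (pd J h) X = pd J (pd AmbT h) X"
      by (rule pd_commute[OF \<Omega> h(1)[folded \<Omega>_def] X\<Omega>])
    also have "\<dots> = pd J (\<lambda>X. 0) X"
      by (rule pd_cong[OF \<Omega> X\<Omega>]) (use h(2) in \<open>simp add: \<Omega>_def\<close>)
    finally show ?thesis by simp
  qed
  \<comment> \<open>For \<open>J \<noteq> AmbT\<close> the derivative \<open>pd J F\<close> still
    carries the power \<open>w\<close> of t. The derivative \<open>pd AmbT F\<close> carries the
    power \<open>w - 1\<close>, and its \<rho>-derivative is computed in
    \<open>ddFT\<close>.\<close>
  have ddF: "pd I (pd J F) X = (if I = AmbT then w * pd J h X else pd I (pd J h) X)" if "J \<noteq> AmbT" for I J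
  proof -
    have "pd I (pd J F) X = pd I (\<lambda>Y. (Y $ AmbT) powr w * pd J h Y) X"
      by (rule pd_cong[OF \<Omega> X\<Omega>]) (simp add: dF that)
    then show ?thesis
      unfolding pd_powr_mult[OF hd'[OF X\<Omega>], simplified] using pTp by simp
  qed
  have ddFT: "pd AmbR (pd AmbT F) X = w * pd AmbR h X"
  proof -
    have d: "(\<lambda>Y. (Y $ AmbT) powr (w - 1) * h Y) differentiable at X"
    proof (rule smooth_on_differentiable[OF _ X\<Omega>])
      show "smooth_on \<Omega> (\<lambda>Y. (Y $ AmbT) powr (w - 1) * h Y)"
        by (intro smooth_on_mult smooth_on_powr \<Omega> smooth_on_vec_nth h(1)[folded \<Omega>_def] T)
    qed
    have "pd AmbR (pd AmbT F) X = pd AmbR (\<lambda>Y. w * ((Y $ AmbT) powr (w - 1) * h Y)) X"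
      by (rule pd_cong[OF \<Omega> X\<Omega>]) (simp add: dF)
    also have "\<dots> = w * pd AmbR h X"
      unfolding pd_cmult[OF d] pd_powr_mult[OF hd[OF X\<Omega>], simplified] by simp
    finally show ?thesis .
  qed
  define f where "f = (\<lambda>y. h (emb 1 y \<rho>))"
  have df: "pd j f y = pd (AmbX j) h (emb 1 y \<rho>)" if "y \<in> S" for j y
    unfolding f_def by (rule pd_emb_x[OF hd[OF e\<Omega>[OF that]]])
  have ddf: "pd i (pd j f) x = pd (AmbX i) (pd (AmbX j) h) X" for i j
  proof -
    have "pd i (pd j f) x = pd i (\<lambda>y. pd (AmbX j) h (emb 1 y \<rho>)) x"
      by (rule pd_cong[OF coord_metricD(1)[OF g] x df])
    also have "\<dots> = pd (AmbX i) (pd (AmbX j) h) X"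
      unfolding X_def by (rule pd_emb_x[OF hd'[OF e\<Omega>[OF x]]])
    finally show ?thesis .
  qed
  have "coord_laplacian (g a) f x = (\<Sum>i\<in>UNIV. \<Sum>j\<in>UNIV. K $ i $ j * pd (AmbX i) (pd (AmbX j) h) X)
     - (\<Sum>k\<in>UNIV. \<Sum>l\<in>UNIV. K $ k $ l * contracted_christoffel (g a) l x * pd (AmbX k) h X)"
    unfolding coord_laplacian_contracted ddf K_def[symmetric] df[OF x] X_def ..
  then have lapf: "coord_laplacian (g a) f x / ?u\<^sup>2 =
     (\<Sum>i\<in>UNIV. \<Sum>j\<in>UNIV. K $ i $ j * pd (AmbX i) (pd (AmbX j) h) X / ?u\<^sup>2)
     - (\<Sum>k\<in>UNIV. \<Sum>l\<in>UNIV. K $ k $ l * contracted_christoffel (g a) l x * pd (AmbX k) h X / ?u\<^sup>2)"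
    by (simp add: diff_divide_distrib sum_divide_distrib)
  have "coord_laplacian ?G F X = - 2 * \<rho> * pd AmbR (pd AmbR h) X + 2 * w * pd AmbR h X
     - (2 - n + 2 * \<rho> * n * lam / ?u) * pd AmbR h X + n * lam / ?u * w * h X 
     + coord_laplacian (g a) f x / ?u\<^sup>2"
    unfolding coord_laplacian_contracted[of ?G] inv lapf
    by (simp add: sum_amb V ddF ddFT dF[OF X\<Omega>] algebra_simps)
  then show ?thesis
    unfolding F_def f_def by (simp add: algebra_simps)
qed

lemma has_derivative_emb_rho:
  assumes "h differentiable at (emb t x \<rho>)"
  shows "((\<lambda>\<rho>. h (emb t x \<rho>)) has_real_derivative pd AmbR h (emb t x \<rho>)) (at \<rho>)"
proof -
  have e: "emb t x = (\<lambda>r. emb t x 0 + r *\<^sub>R axis AmbR 1)"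
    by (rule ext) (simp add: vec_eq_iff emb_def axis_def split: amb.split)
  have "((\<lambda>r. emb t x 0 + r *\<^sub>R axis AmbR 1) has_derivative (\<lambda>r. r *\<^sub>R axis AmbR 1)) (at \<rho>)"
    by (auto intro!: derivative_eq_intros)
  then have 1: "(emb t x has_derivative (\<lambda>r. r *\<^sub>R axis AmbR 1)) (at \<rho>)"
    using e by simp
  have "linear (frechet_derivative h (at (emb t x \<rho>)))"
    by (rule linear_frechet_derivative[OF assms])
  then have "(\<lambda>r. frechet_derivative h (at (emb t x \<rho>)) (r *\<^sub>R axis AmbR 1)) = (*) (pd AmbR h (emb t x \<rho>))"
    by (simp add: linear_scale pd_def fun_eq_iff)
  then show ?thesis
    using has_derivative_compose[OF 1 frechet_derivative_has[OF assms]]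
    unfolding has_field_derivative_def by simp
qed

definition rho_dom :: "real \<Rightarrow> real set" where
  "rho_dom lam = {\<rho>. 1 + lam * \<rho> > 0}"

lemma open_rho_dom: "open (rho_dom lam)"
  unfolding rho_dom_def by (intro open_Collect_less continuous_intros)

lemma zero_rho_dom [simp]: "0 \<in> rho_dom lam"
  by (simp add: rho_dom_def)

lemma smooth_on_rho [simp]: "smooth_on S (\<lambda>\<rho>::real. \<rho>)"
  by (rule smooth_on_linear) (rule bounded_linear_ident)

lemma emb_amb_region: "t > 0 \<Longrightarrow> x \<in> S \<Longrightarrow> \<rho> \<in> rho_dom lam \<Longrightarrow> emb t x \<rho> \<in> amb_region lam S"
  by (simp add: amb_region_def rho_dom_def)

text \<open>The Laplacian of a slice becomes a combination of ambient partial derivatives along the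
  \<rho>-line, with coefficients that do not involve \<rho>. In this form it can be differentiated
  in \<rho>.\<close>

lemma coord_laplacian_slice:
  assumes "open S" "smooth_on (amb_region lam S) h" "x \<in> S" "\<rho> \<in> rho_dom lam"
  shows "coord_laplacian G (\<lambda>y. h (emb 1 y \<rho>)) x = (\<Sum>i\<in>UNIV. \<Sum>j\<in>UNIV. matrix_inv (G x) $ i $ j *
     (pd (AmbX i) (pd (AmbX j) h) (emb 1 x \<rho>) - (\<Sum>k\<in>UNIV. christoffel G k i j x * pd (AmbX k) h (emb 1 x \<rho>))))"
proof -
  have e: "emb 1 y \<rho> \<in> amb_region lam S" if "y \<in> S" for y
    using that assms(4) by (simp add: emb_amb_region)
  have df: "pd j (\<lambda>y. h (emb 1 y \<rho>)) y = pd (AmbX j) h (emb 1 y \<rho>)" if "y \<in> S" for j y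
    by (rule pd_emb_x[OF smooth_on_differentiable[OF assms(2) e[OF that]]])
  have "pd i (pd j (\<lambda>y. h (emb 1 y \<rho>))) x = pd (AmbX i) (pd (AmbX j) h) (emb 1 x \<rho>)" for i j
    using pd_cong[OF assms(1,3) df]
      pd_emb_x[OF smooth_on_differentiable[OF smooth_on_pd[OF assms(2)] e[OF assms(3)]]] by simp
  then show ?thesis
    by (simp add: coord_laplacian_def df[OF assms(3)])
qed

section \<open>Extensions on the ambient manifold and the explicit form of the equation\<close>

context pr_manifold
begin

lemma ambient_chart_simps:
  "chart_dom (ambient_atlas A lam) a = {0<..} \<times> cdom a \<times> rho_dom lam"
  "chart (ambient_atlas A lam) a (t, p, \<rho>) = emb t (chart A a p) \<rho>"
  by (simp_all add: chart_dom_def chart_def ambient_atlas_def emb_def rho_dom_def)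

lemma ambient_chart_image:
  "chart (ambient_atlas A lam) a ` chart_dom (ambient_atlas A lam) a = amb_region lam (cimage a)"
proof (intro equalityI subsetI)
  fix X assume "X \<in> amb_region lam (cimage a)"
  then obtain p where "p \<in> cdom a" "xpart X = chart A a p" "X $ AmbT > 0" "X $ AmbR \<in> rho_dom lam"
    by (auto simp: amb_region_def rho_dom_def)
  then show "X \<in> chart (ambient_atlas A lam) a ` chart_dom (ambient_atlas A lam) a"
    using emb_eta[of X]
    by (intro image_eqI[of _ _ "(X $ AmbT, p, X $ AmbR)"]) (simp_all add: ambient_chart_simps)
next
  fix X assume "X \<in> chart (ambient_atlas A lam) a ` chart_dom (ambient_atlas A lam) a"
  then obtain P where P: "P \<in> chart_dom (ambient_atlas A lam) a" "X = chart (ambient_atlas A lam) a P"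
    by blast
  obtain t p r where e: "P = (t, p, r)"
    by (rule prod_cases3)
  show "X \<in> amb_region lam (cimage a)"
    using P unfolding e ambient_chart_simps by (simp add: emb_amb_region)
qed

lemma ambient_param:
  assumes "X \<in> amb_region lam (cimage a)"
  shows "param (ambient_atlas A lam) a X = (X $ AmbT, param A a (xpart X), X $ AmbR)"
  unfolding param_def[of "ambient_atlas A lam"]
proof (rule inv_into_f_eq)
  show "inj_on (chart (ambient_atlas A lam) a) (chart_dom (ambient_atlas A lam) a)"
  proof (rule inj_onI)
    fix P Q assume *: "P \<in> chart_dom (ambient_atlas A lam) a" "Q \<in> chart_dom (ambient_atlas A lam) a"
      "chart (ambient_atlas A lam) a P = chart (ambient_atlas A lam) a Q"
    obtain t p r t' p' r' where PQ: "P = (t, p, r)" "Q = (t', p', r')"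
      by (metis surj_pair)
    have e: "emb t (chart A a p) r = emb t' (chart A a p') r'"
      using *(3) by (simp add: PQ ambient_chart_simps)
    have "t = t'" "r = r'" "chart A a p = chart A a p'"
      using arg_cong[OF e, of "\<lambda>X. X $ AmbT"] arg_cong[OF e, of "\<lambda>X. X $ AmbR"] arg_cong[OF e, of xpart]
      by simp_all
    moreover have "p = p'"
    proof -
      have "p \<in> cdom a" "p' \<in> cdom a"
        using *(1,2) by (simp_all add: PQ ambient_chart_simps)
      then show ?thesis
        using \<open>chart A a p = chart A a p'\<close> param_chart by metis
    qed
    ultimately show "P = Q" by (simp add: PQ)
  qed
  show "(X $ AmbT, param A a (xpart X), X $ AmbR) \<in> chart_dom (ambient_atlas A lam) a"
    using assms param_cdom by (simp add: ambient_chart_simps amb_region_def rho_dom_def)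
  show "chart (ambient_atlas A lam) a (X $ AmbT, param A a (xpart X), X $ AmbR) = X"
    using assms emb_eta[of X, symmetric] by (simp add: ambient_chart_simps amb_region_def chart_param)
qed

text \<open>The extension read in the ambient chart \<open>a\<close>, with the inverse chart
  resolved into its three components.\<close>

definition lift :: "'i \<Rightarrow> ('m \<Rightarrow> real \<Rightarrow> real) \<Rightarrow> real^('n amb) \<Rightarrow> real" where
  "lift a f X = f (param A a (xpart X)) (X $ AmbR)"

lemma lift_emb [simp]: "lift a f (emb t x \<rho>) = f (param A a x) \<rho>"
  by (simp add: lift_def)

definition ext_smooth :: "real \<Rightarrow> ('m \<Rightarrow> real \<Rightarrow> real) \<Rightarrow> bool" where
  "ext_smooth lam f \<longleftrightarrow> (\<forall>a. smooth_on (amb_region lam (cimage a)) (lift a f))"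

lemma smooth_function_ambient:
  "smooth_function (ambient_atlas A lam) (\<lambda>(t, p, \<rho>). f p \<rho>) \<longleftrightarrow> ext_smooth lam f"
proof -
  have "smooth_on (amb_region lam (cimage a)) ((\<lambda>(t, p, \<rho>). f p \<rho>) \<circ> param (ambient_atlas A lam) a)
     \<longleftrightarrow> smooth_on (amb_region lam (cimage a)) (lift a f)" for a
    by (rule smooth_on_cong[OF open_amb_region[OF open_cimage]]) (simp add: ambient_param lift_def)
  then show ?thesis
    unfolding smooth_function_def ext_smooth_def ambient_chart_image by blast
qed

lemma ext_smooth_lift: "ext_smooth lam f \<Longrightarrow> smooth_on (amb_region lam (cimage a)) (lift a f)"
  by (simp add: ext_smooth_def)

text \<open>The lift is unchanged when t is replaced by 1, so it factors through a map whose
  derivative in t is zero.\<close>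

lemma pd_AmbT_lift:
  assumes "ext_smooth lam f" "X \<in> amb_region lam (cimage a)"
  shows "pd AmbT (lift a f) X = 0"
proof -
  let ?\<Phi> = "\<lambda>X. emb 1 (xpart X) (X $ AmbR)"
  have X: "?\<Phi> X \<in> amb_region lam (cimage a)"
    using assms(2) by (simp add: amb_region_def)
  have d: "(\<lambda>X. ?\<Phi> X $ J) differentiable at X" for J
    by (cases J) (simp_all add: bounded_linear_imp_differentiable bounded_linear_vec_nth)
  have "pd AmbT (\<lambda>X. lift a f (?\<Phi> X)) X = 0"
    by (subst pd_compose[OF d smooth_on_differentiable[OF ext_smooth_lift[OF assms(1)] X]])
      (simp add: sum_amb)
  then show ?thesis
    by (simp add: lift_def[abs_def])
qed

lemma smooth_function_slice:
  assumes "ext_smooth lam f" "\<rho> \<in> rho_dom lam"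
  shows "smooth_function A (\<lambda>q. f q \<rho>)"
  unfolding smooth_function_def
proof
  fix a
  have "smooth_on (cimage a) (\<lambda>y. lift a f (emb 1 y \<rho>))"
    by (rule smooth_on_emb[OF open_cimage _ _ _ _ ext_smooth_lift[OF assms(1)]])
      (use assms(2) in \<open>auto simp: smooth_on_const smooth_on_vec_nth intro!: emb_amb_region\<close>)
  then show "smooth_on (cimage a) ((\<lambda>q. f q \<rho>) \<circ> param A a)"
    by (simp add: comp_def)
qed

lemma smooth_on_emb_rho:
  fixes h :: "real^('n amb) \<Rightarrow> real"
  assumes "x \<in> cimage a" "smooth_on (amb_region lam (cimage a)) h"
  shows "smooth_on (rho_dom lam) (\<lambda>\<rho>. h (emb 1 x \<rho>))"
  by (rule smooth_on_emb[OF open_rho_dom _ _ _ _ assms(2)])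
    (use assms(1) in \<open>auto simp: smooth_on_const intro!: emb_amb_region\<close>)

lemma smooth_on_fibre:
  assumes "ext_smooth lam f" "p \<in> manifold_of A"
  shows "smooth_on (rho_dom lam) (f p)"
proof -
  obtain a where "p \<in> cdom a"
    using assms(2) by (auto simp: manifold_of_def)
  then show ?thesis
    using smooth_on_emb_rho[OF _ ext_smooth_lift[OF assms(1)], of "chart A a p" a] by (simp add: param_chart)
qed

lemma deriv_fibre:
  assumes "ext_smooth lam f" "p \<in> cdom a" "\<rho> \<in> rho_dom lam" "t > 0"
  shows "deriv (f p) \<rho> = pd AmbR (lift a f) (emb t (chart A a p) \<rho>)"
proof -
  have "emb t (chart A a p) \<rho> \<in> amb_region lam (cimage a)"
    using assms by (auto intro!: emb_amb_region)
  from has_derivative_emb_rho[OF smooth_on_differentiable[OF ext_smooth_lift[OF assms(1)] this]]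
  show ?thesis
    using assms(2) by (intro DERIV_imp_deriv) (simp add: param_chart)
qed

lemma lift_deriv:
  assumes "ext_smooth lam f" "X \<in> amb_region lam (cimage a)"
  shows "lift a (\<lambda>p. deriv (f p)) X = pd AmbR (lift a f) X"
proof -
  have X: "xpart X \<in> cimage a" "X $ AmbR \<in> rho_dom lam" "X $ AmbT > 0"
    using assms(2) by (auto simp: amb_region_def rho_dom_def)
  show ?thesis
    unfolding lift_def deriv_fibre[OF assms(1) param_cdom[OF X(1)] X(2,3)] chart_param[OF X(1)]
    using emb_eta[of X] by simp
qed

lemma ext_smooth_deriv:
  assumes "ext_smooth lam f"
  shows "ext_smooth lam (\<lambda>p. deriv (f p))"
  unfolding ext_smooth_def
proof
  fix a
  show "smooth_on (amb_region lam (cimage a)) (lift a (\<lambda>p. deriv (f p)))"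
    using smooth_on_cong[OF open_amb_region[OF open_cimage], THEN iffD2, OF lift_deriv[OF assms]
        smooth_on_pd[OF ext_smooth_lift[OF assms]]] .
qed

text \<open>The Laplacian of \<open>g\<close> differentiates in x with coefficients free of \<rho>,
  so it commutes with the \<rho>-derivative by symmetry of mixed partial derivatives. This turns
  \<rho>-derivatives of the equation into Laplacians of the Taylor coefficients.\<close>

lemma laplacian_slice:
  assumes f: "ext_smooth lam f" and p: "p \<in> manifold_of A"
  shows "smooth_on (rho_dom lam) (\<lambda>\<rho>. laplacian A g (\<lambda>q. f q \<rho>) p)" (is ?S)
    and "\<rho> \<in> rho_dom lam \<Longrightarrow> deriv (\<lambda>\<rho>. laplacian A g (\<lambda>q. f q \<rho>) p) \<rho> = laplacian A g (\<lambda>q. deriv (f q) \<rho>) p"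
proof -
  obtain a where a: "p \<in> cdom a"
    using p by (auto simp: manifold_of_def)
  define x where "x = chart A a p"
  have x: "x \<in> cimage a" using a by (simp add: x_def)
  define L where "L = (\<lambda>h \<rho>. \<Sum>i\<in>UNIV. \<Sum>j\<in>UNIV. matrix_inv (g a x) $ i $ j *
     (pd (AmbX i) (pd (AmbX j) h) (emb 1 x \<rho>) - (\<Sum>k\<in>UNIV. christoffel (g a) k i j x * pd (AmbX k) h (emb 1 x \<rho>))))"
  have L: "laplacian A g (\<lambda>q. f q \<rho>) p = L (lift a f) \<rho>" if "ext_smooth lam f" "\<rho> \<in> rho_dom lam" for f \<rho>
    using coord_laplacian_slice[OF open_cimage ext_smooth_lift[OF that(1)] x that(2), of "g a"]
    unfolding laplacian_chart[OF smooth_function_slice[OF that] a] L_def x_def by (simp add: comp_def)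
  note h = ext_smooth_lift[OF f, of a]
  note R = open_amb_region[OF open_cimage, of lam a]
  have e: "emb 1 x \<rho> \<in> amb_region lam (cimage a)" if "\<rho> \<in> rho_dom lam" for \<rho>
    using that x by (simp add: emb_amb_region)
  have sL: "smooth_on (rho_dom lam) (L (lift a f))"
    unfolding L_def
    by (intro smooth_on_sum smooth_on_mult smooth_on_diff smooth_on_const open_rho_dom
        smooth_on_emb_rho[OF x] smooth_on_pd h)
  show ?S
    by (rule smooth_on_cong[OF open_rho_dom, THEN iffD2, OF _ sL]) (rule L[OF f])
  show "deriv (\<lambda>\<rho>. laplacian A g (\<lambda>q. f q \<rho>) p) \<rho> = laplacian A g (\<lambda>q. deriv (f q) \<rho>) p"
    if r: "\<rho> \<in> rho_dom lam"
  proof -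
    let ?h' = "lift a (\<lambda>p. deriv (f p))"
    \<comment> \<open>Stated for all index lists, since both first and second x-derivatives occur in
      \<open>L\<close>.\<close>
    have d: "((\<lambda>\<rho>. pds l (lift a f) (emb 1 x \<rho>)) has_real_derivative pds l ?h' (emb 1 x \<rho>)) (at \<rho>)" for l
    proof -
      have "pds l ?h' (emb 1 x \<rho>) = pds l (pd AmbR (lift a f)) (emb 1 x \<rho>)"
        by (rule pds_cong[OF R lift_deriv[OF f] e[OF r]])
      also have "\<dots> = pd AmbR (pds l (lift a f)) (emb 1 x \<rho>)"
        by (rule pd_pds_commute[OF R h e[OF r], symmetric])
      finally show ?thesis
        using has_derivative_emb_rho[OF smooth_on_differentiable[OF smooth_on_pds[OF h] e[OF r]]] by simp
    qed
    have "(L (lift a f) has_real_derivative L ?h' \<rho>) (at \<rho>)"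
      unfolding L_def
      using d[of "[AmbX _, AmbX _]"] d[of "[AmbX _]"]
      by (intro DERIV_sum DERIV_cmult DERIV_diff) simp_all
    then have "deriv (L (lift a f)) \<rho> = L ?h' \<rho>"
      by (rule DERIV_imp_deriv)
    moreover have "deriv (\<lambda>\<rho>. laplacian A g (\<lambda>q. f q \<rho>) p) \<rho> = deriv (L (lift a f)) \<rho>"
      using higher_deriv_cong[OF open_rho_dom L[OF f] r, where m = 1] by simp
    ultimately show ?thesis
      using L[OF ext_smooth_deriv[OF f] r] by simp
  qed
qed

lemma higher_deriv_laplacian_slice:
  assumes "ext_smooth lam f" "p \<in> manifold_of A" "\<rho> \<in> rho_dom lam"
  shows "(deriv ^^ m) (\<lambda>\<rho>. laplacian A g (\<lambda>q. f q \<rho>) p) \<rho> = laplacian A g (\<lambda>q. (deriv ^^ m) (f q) \<rho>) p"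
  using assms(1)
proof (induction m arbitrary: f)
  case (Suc m)
  have "(deriv ^^ Suc m) (\<lambda>\<rho>. laplacian A g (\<lambda>q. f q \<rho>) p) \<rho>
      = (deriv ^^ m) (\<lambda>\<rho>. laplacian A g (\<lambda>q. deriv (f q) \<rho>) p) \<rho>"
    unfolding higher_deriv_Suc'
    by (rule higher_deriv_cong[OF open_rho_dom laplacian_slice(2)[OF Suc.prems assms(2)] assms(3)])
  also have "\<dots> = laplacian A g (\<lambda>q. (deriv ^^ m) (deriv (f q)) \<rho>) p"
    by (rule Suc.IH[OF ext_smooth_deriv[OF Suc.prems]])
  finally show ?case
    by (simp only: higher_deriv_Suc')
qed simp

text \<open>The coordinate formula for the ambient Laplacian, expressed through \<open>deriv\<close>
  and the Laplacian of \<open>g\<close>, so that no chart is left. From here on the ambient metric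
  itself no longer appears.\<close>

lemma harmonic_lhs_eq:
  assumes f: "ext_smooth lam f" and p: "p \<in> manifold_of A" and r: "\<rho> \<in> rho_dom lam"
  defines "n \<equiv> real CARD('n)"
  shows "harmonic_lhs A g lam k f p \<rho> =
     - 2 * \<rho> * deriv (deriv (f p)) \<rho> + (2 * real k - 2 - 2 * n * lam * \<rho> / (1 + lam * \<rho>)) * deriv (f p) \<rho>
     + laplacian A g (\<lambda>q. f q \<rho>) p / (1 + lam * \<rho>)\<^sup>2 + lam * n * (real k - n / 2) / (1 + lam * \<rho>) * f p \<rho>"
proof -
  \<comment> \<open>The chart that \<open>laplacian\<close> selects on the ambient manifold. Its
    index also belongs to a chart of \<open>A\<close> around \<open>p\<close>, which is the one in
    which \<open>g\<close> is read.\<close>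
  define a where "a = (SOME a. (1, p, \<rho>) \<in> chart_dom (ambient_atlas A lam) a)"
  obtain b where "p \<in> cdom b"
    using p by (auto simp: manifold_of_def)
  then have "(1, p, \<rho>) \<in> chart_dom (ambient_atlas A lam) b"
    using r by (simp add: ambient_chart_simps)
  then have "(1, p, \<rho>) \<in> chart_dom (ambient_atlas A lam) a"
    unfolding a_def by (rule someI)
  then have a: "p \<in> cdom a"
    by (simp add: ambient_chart_simps)
  define w where "w = gjms_weight A k"
  define x where "x = chart A a p"
  have x: "x \<in> cimage a" using a by (simp add: x_def)
  note R = open_amb_region[OF open_cimage, of lam a]
  have X: "emb 1 x \<rho> \<in> amb_region lam (cimage a)"
    using x r by (simp add: emb_amb_region)
  note h = ext_smooth_lift[OF f, of a]
  have w: "w = real k - n / 2"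
    by (simp add: w_def gjms_weight_def n_def)
  have "harmonic_lhs A g lam k f p \<rho> = coord_laplacian (ambient_metric g lam a)
      ((\<lambda>(t, q, r). t powr w * f q r) \<circ> param (ambient_atlas A lam) a) (emb 1 x \<rho>)"
    unfolding harmonic_lhs_def laplacian_def a_def[symmetric] w_def
    by (simp add: Let_def a_def[symmetric] ambient_chart_simps x_def)
  also have "\<dots> = coord_laplacian (ambient_metric g lam a) (\<lambda>X. (X $ AmbT) powr w * lift a f X) (emb 1 x \<rho>)"
    by (rule coord_laplacian_cong[OF R _ X]) (simp add: ambient_param lift_def)
  also have "\<dots> = - 2 * \<rho> * pd AmbR (pd AmbR (lift a f)) (emb 1 x \<rho>)
     + (2 * w + n - 2 - 2 * n * lam * \<rho> / (1 + lam * \<rho>)) * pd AmbR (lift a f) (emb 1 x \<rho>)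
     + coord_laplacian (g a) (\<lambda>y. lift a f (emb 1 y \<rho>)) x / (1 + lam * \<rho>)\<^sup>2
     + lam * n * w / (1 + lam * \<rho>) * lift a f (emb 1 x \<rho>)"
    unfolding n_def
    by (rule ambient_coord_laplacian[where g = g and a = a, OF metric_cimage x _ h pd_AmbT_lift[OF f]])
      (use r in \<open>simp_all add: rho_dom_def\<close>)
  also have "coord_laplacian (g a) (\<lambda>y. lift a f (emb 1 y \<rho>)) x = laplacian A g (\<lambda>q. f q \<rho>) p"
    unfolding laplacian_chart[OF smooth_function_slice[OF f r] a] x_def by (simp add: comp_def)
  also have "pd AmbR (lift a f) (emb 1 x \<rho>) = deriv (f p) \<rho>"
    unfolding x_def by (rule deriv_fibre[OF f a r, symmetric]) simp
  also have "pd AmbR (pd AmbR (lift a f)) (emb 1 x \<rho>) = pd AmbR (lift a (\<lambda>p. deriv (f p))) (emb 1 x \<rho>)"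
    by (rule pd_cong[OF R X lift_deriv[OF f, symmetric]])
  also have "\<dots> = deriv (deriv (f p)) \<rho>"
    unfolding x_def by (rule deriv_fibre[OF ext_smooth_deriv[OF f] a r, symmetric]) simp
  also have "2 * w + n - 2 = 2 * real k - 2"
    by (simp add: w)
  finally show ?thesis
    using a by (simp add: w x_def param_chart)
qed

end

section \<open>The harmonic extension and its obstruction\<close>

text \<open>The change of unknown reduced to a polynomial identity. Here \<open>v\<close> stands for
  1/u, the bracket after \<open>- 2 * \<rho>\<close> is f'' and the one before \<open>L\<close> is
  f', both divided by u^w; \<open>n = 2 * (k - w)\<close> encodes the weight.\<close>

lemma ode_substitution_algebra:
  fixes u v z \<rho> lam w k n H H1 H2 L :: real
  assumes "u * v = 1" "\<rho> = z * u" "lam * z = 1 - v" "n = 2 * (k - w)"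
  shows "- 2 * \<rho> * (w * lam * v * (w * lam * H * v + H1 * v^2) + w * lam * (H1 * v^3 - lam * H * v^2)
            + H2 * v^4 - 2 * lam * H1 * v^3)
      + (2 * k - 2 - 2 * n * lam * \<rho> * v) * (w * lam * H * v + H1 * v^2) + L * v^2 + lam * n * w * v * H
    = v^2 * (- 2 * z * (1 - lam * z) * H2 + (2 * k - 2) * (1 - 2 * lam * z) * H1 + L
         + lam * w * (2 * k + n - 2) * H)"
  using assms by algebra

text \<open>\<open>L\<close> is the value at \<open>z\<close> of the series of Laplacians; for a
  fixed point of the manifold it enters only as a number, so the partial differential equation is
  handled as an ordinary one.\<close>

lemma ode_substitution:
  fixes H H1 H2 :: "real \<Rightarrow> real"
  assumes H: "\<And>z. (H has_real_derivative H1 z) (at z)" "\<And>z. (H1 has_real_derivative H2 z) (at z)"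
    and r: "\<rho> \<in> rho_dom lam" and n: "n = 2 * (k - w)"
  defines "F \<equiv> \<lambda>\<rho>. (1 + lam * \<rho>) powr w * H (\<rho> / (1 + lam * \<rho>))"
    and "u \<equiv> 1 + lam * \<rho>" and "z \<equiv> \<rho> / (1 + lam * \<rho>)"
  shows "- 2 * \<rho> * deriv (deriv F) \<rho> + (2 * k - 2 - 2 * n * lam * \<rho> / u) * deriv F \<rho>
      + u powr w * L / u\<^sup>2 + lam * n * w / u * F \<rho>
    = u powr w / u\<^sup>2 * (- 2 * z * (1 - lam * z) * H2 z + (2 * k - 2) * (1 - 2 * lam * z) * H1 z + L
         + lam * w * (2 * k + n - 2) * H z)"
proof -
  \<comment> \<open>The functions \<open>Z\<close>, \<open>V\<close>, \<open>P\<close> satisfy Z' =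
    V^2, V' = -\<lambda> V^2 and P' = w \<lambda> V P. Hence every derivative of \<open>F\<close> is
    \<open>P\<close> times a polynomial in \<open>V\<close> and the derivatives of \<open>H\<close>,
    and \<open>P\<close> can be factored out.\<close>
  define Z where "Z = (\<lambda>\<rho>. \<rho> / (1 + lam * \<rho>))"
  define P where "P = (\<lambda>\<rho>. (1 + lam * \<rho>) powr w)"
  define V where "V = (\<lambda>\<rho>. 1 / (1 + lam * \<rho>))"
  have F: "F = (\<lambda>\<rho>. P \<rho> * H (Z \<rho>))"
    by (simp add: F_def P_def Z_def)
  have dZ: "(Z has_real_derivative V \<rho> ^ 2) (at \<rho>)" if "\<rho> \<in> rho_dom lam" for \<rho>
    using that unfolding Z_def V_def rho_dom_def
    by (auto intro!: derivative_eq_intros simp: power2_eq_square divide_simps)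
  have dV: "(V has_real_derivative - lam * V \<rho> ^ 2) (at \<rho>)" if "\<rho> \<in> rho_dom lam" for \<rho>
    using that unfolding V_def rho_dom_def
    by (auto intro!: derivative_eq_intros simp: power2_eq_square)
  have dP: "(P has_real_derivative w * lam * V \<rho> * P \<rho>) (at \<rho>)" if "\<rho> \<in> rho_dom lam" for \<rho>
    using that unfolding P_def V_def rho_dom_def
    by (auto intro!: derivative_eq_intros simp: powr_diff)
  define F1 where "F1 = (\<lambda>\<rho>. P \<rho> * (w * lam * H (Z \<rho>) * V \<rho> + H1 (Z \<rho>) * V \<rho> ^ 2))"
  have dF: "(F has_real_derivative F1 \<rho>) (at \<rho>)" if "\<rho> \<in> rho_dom lam" for \<rho>
    unfolding F F1_def
    by (auto intro!: derivative_eq_intros dP[OF that] DERIV_chain2[OF H(1) dZ[OF that]] simp: algebra_simps)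
  define F2 where "F2 = (\<lambda>\<rho>. P \<rho> * (w * lam * V \<rho> * (w * lam * H (Z \<rho>) * V \<rho> + H1 (Z \<rho>) * V \<rho>^2)
      + w * lam * (H1 (Z \<rho>) * V \<rho>^3 - lam * H (Z \<rho>) * V \<rho>^2) + H2 (Z \<rho>) * V \<rho>^4 - 2 * lam * H1 (Z \<rho>) * V \<rho>^3))"
  have dF1: "(F1 has_real_derivative F2 \<rho>) (at \<rho>)" if "\<rho> \<in> rho_dom lam" for \<rho>
    unfolding F1_def F2_def
    by (auto intro!: derivative_eq_intros dP[OF that] dV[OF that] DERIV_chain2[OF H(1) dZ[OF that]]
        DERIV_chain2[OF H(2) dZ[OF that]] simp: algebra_simps power2_eq_square power3_eq_cube power4_eq_xxxx)
  have 1: "deriv F \<rho> = F1 \<rho>" if "\<rho> \<in> rho_dom lam" for \<rho>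
    by (rule DERIV_imp_deriv[OF dF[OF that]])
  have "deriv (deriv F) \<rho> = deriv F1 \<rho>"
    using higher_deriv_cong[OF open_rho_dom 1 r, where m = 1] by simp
  then have 2: "deriv (deriv F) \<rho> = F2 \<rho>"
    using DERIV_imp_deriv[OF dF1[OF r]] by simp
  have u: "u \<noteq> 0" "u * V \<rho> = 1" "\<rho> = z * u" "lam * z = 1 - V \<rho>" "Z \<rho> = z" "V \<rho> = 1 / u"
    using r by (auto simp: u_def V_def z_def Z_def rho_dom_def field_simps)
  have "- 2 * \<rho> * F2 \<rho> + (2 * k - 2 - 2 * n * lam * \<rho> * V \<rho>) * F1 \<rho>
      + P \<rho> * L * V \<rho> ^ 2 + lam * n * w * V \<rho> * (P \<rho> * H z)
    = P \<rho> * (V \<rho>^2 * (- 2 * z * (1 - lam * z) * H2 z + (2 * k - 2) * (1 - 2 * lam * z) * H1 z + L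
         + lam * w * (2 * k + n - 2) * H z))"
    unfolding ode_substitution_algebra[OF u(2,3,4) n, symmetric] F1_def F2_def u(5)
    by (simp add: algebra_simps)
  moreover have "F \<rho> = P \<rho> * H z" "P \<rho> = u powr w"
    by (simp_all add: F u(5)) (simp add: P_def u_def)
  ultimately show ?thesis
    unfolding 1[OF r] 2 u(6) by (simp add: power_one_over)
qed

text \<open>The operator sends the term b_m z^m to multiples of z^(m-1) and z^m only. Their
  coefficients are 2 m (K + 1 - m) b_m and Lb_m - 2 \<lambda> d_m b_m. After an index shift the
  recursion cancels everything except the second coefficient at m = K. \<open>K\<close> is k - 1,
  and \<open>Lb m\<close> stands for the Laplacian of the m-th coefficient at the point
  considered.\<close>

lemma ode_series:
  fixes b Lb :: "nat \<Rightarrow> real" and z lam n :: real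
  assumes rec: "\<And>m. m < K \<Longrightarrow> 2 * (real m + 1) * (real K - real m) * b (Suc m) =
      - Lb m + 2 * lam * ((n / 2 + (real K - real m)) * (n / 2 - (real K - real m) - 1)) * b m"
    and w: "w = real K + 1 - n / 2"
  defines "H \<equiv> (\<Sum>m<Suc K. b m * z ^ m)" and "H1 \<equiv> (\<Sum>m<Suc K. b m * (real m * z ^ (m - 1)))"
    and "H2 \<equiv> (\<Sum>m<Suc K. b m * (real m * (real (m - 1) * z ^ (m - 2))))"
  shows "- 2 * z * (1 - lam * z) * H2 + 2 * real K * (1 - 2 * lam * z) * H1 + (\<Sum>m<Suc K. Lb m * z ^ m)
         + lam * w * (2 * real K + n) * H = (Lb K - 2 * lam * (n / 2 * (n / 2 - 1)) * b K) * z ^ K"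
proof -
  define d where "d = (\<lambda>m. (n / 2 + (real K - real m)) * (n / 2 - (real K - real m) - 1))"
  have "- 2 * z * (1 - lam * z) * H2 + 2 * real K * (1 - 2 * lam * z) * H1 + (\<Sum>m<Suc K. Lb m * z ^ m)
         + lam * w * (2 * real K + n) * H
     = (\<Sum>m<Suc K. - 2 * z * (1 - lam * z) * (b m * (real m * (real (m - 1) * z ^ (m - 2))))
         + 2 * real K * (1 - 2 * lam * z) * (b m * (real m * z ^ (m - 1)))
         + Lb m * z ^ m + lam * w * (2 * real K + n) * (b m * z ^ m))"
    unfolding H_def H1_def H2_def by (simp only: sum_distrib_left sum.distrib)
  also have "\<dots> = (\<Sum>m<Suc K. 2 * real m * (real K + 1 - real m) * b m * z ^ (m - 1)
      + (Lb m - 2 * lam * d m * b m) * z ^ m)"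
  proof (rule sum.cong[OF refl])
    fix m
    \<comment> \<open>The truncated exponents \<open>m - 1\<close> and \<open>m - 2\<close> are the
      true ones for m \<ge> 2; for smaller m the coefficients in front of the wrong powers
      vanish.\<close>
    consider "m = 0" | "m = 1" | j where "m = Suc (Suc j)"
      by (metis One_nat_def not0_implies_Suc)
    then show "- 2 * z * (1 - lam * z) * (b m * (real m * (real (m - 1) * z ^ (m - 2))))
         + 2 * real K * (1 - 2 * lam * z) * (b m * (real m * z ^ (m - 1)))
         + Lb m * z ^ m + lam * w * (2 * real K + n) * (b m * z ^ m) =
       2 * real m * (real K + 1 - real m) * b m * z ^ (m - 1) + (Lb m - 2 * lam * d m * b m) * z ^ m"
      by cases (simp_all add: d_def w field_simps)
  qed
  also have "\<dots> = (\<Sum>m<Suc K. 2 * real m * (real K + 1 - real m) * b m * z ^ (m - 1))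
      + (\<Sum>m<Suc K. (Lb m - 2 * lam * d m * b m) * z ^ m)"
    by (rule sum.distrib)
  \<comment> \<open>The term m = 0 is zero, and the shifted sum runs over exactly the indices for
    which the recursion is available.\<close>
  also have "(\<Sum>m<Suc K. 2 * real m * (real K + 1 - real m) * b m * z ^ (m - 1))
      = (\<Sum>m<K. 2 * (real m + 1) * (real K - real m) * b (Suc m) * z ^ m)"
    by (subst sum.lessThan_Suc_shift) (simp add: algebra_simps)
  also have "\<dots> = (\<Sum>m<K. - (Lb m - 2 * lam * d m * b m) * z ^ m)"
  proof (rule sum.cong[OF refl])
    fix m assume "m \<in> {..<K}"
    then have "2 * (real m + 1) * (real K - real m) * b (Suc m) = - (Lb m - 2 * lam * d m * b m)"
      using rec[of m] unfolding d_def by auto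
    then show "2 * (real m + 1) * (real K - real m) * b (Suc m) * z ^ m = - (Lb m - 2 * lam * d m * b m) * z ^ m"
      by (simp only:)
  qed
  also have "\<dots> = - (\<Sum>m<K. (Lb m - 2 * lam * d m * b m) * z ^ m)"
    by (simp only: sum_negf mult_minus_left)
  also have "\<dots> + (\<Sum>m<Suc K. (Lb m - 2 * lam * d m * b m) * z ^ m) = (Lb K - 2 * lam * d K * b K) * z ^ K"
    by simp
  finally show ?thesis
    by (simp add: d_def)
qed

section \<open>The truncated series as an extension\<close>

context pr_manifold
begin

lemma laplacian_zero:
  assumes "p \<in> manifold_of A"
  shows "laplacian A g (\<lambda>q. 0) p = 0"
proof -
  have "smooth_function A (\<lambda>q. 0)"
    by (simp add: smooth_function_def comp_def smooth_on_const)
  from laplacian_lincomb[OF this this assms, of "- 1"] show ?thesis by simp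
qed

lemma laplacian_cmult:
  assumes "smooth_function A f" "p \<in> manifold_of A"
  shows "laplacian A g (\<lambda>q. c * f q) p = c * laplacian A g f p"
proof -
  have "smooth_function A (\<lambda>q. 0)"
    by (simp add: smooth_function_def comp_def smooth_on_const)
  from laplacian_lincomb[OF this assms, of c] show ?thesis
    using laplacian_zero[OF assms(2)] by simp
qed

lemma smooth_function_sum:
  "(\<And>m. m \<in> I \<Longrightarrow> smooth_function A (b m)) \<Longrightarrow> smooth_function A (\<lambda>q. \<Sum>m\<in>I. b m q * c m)"
  unfolding smooth_function_def comp_def
  by (intro allI smooth_on_sum smooth_on_mult smooth_on_const open_cimage) auto

lemma laplacian_sum:
  assumes "finite I" "\<And>m. m \<in> I \<Longrightarrow> smooth_function A (b m)" "p \<in> manifold_of A"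
  shows "laplacian A g (\<lambda>q. \<Sum>m\<in>I. b m q * c m) p = (\<Sum>m\<in>I. laplacian A g (b m) p * c m)"
  using assms(1,2)
proof (induction I)
  case empty
  then show ?case using laplacian_zero[OF assms(3)] by simp
next
  case (insert i I)
  have "laplacian A g (\<lambda>q. \<Sum>m\<in>insert i I. b m q * c m) p =
      laplacian A g (\<lambda>q. (\<Sum>m\<in>I. b m q * c m) + c i * b i q) p"
    using insert by (simp add: algebra_simps)
  also have "\<dots> = laplacian A g (\<lambda>q. \<Sum>m\<in>I. b m q * c m) p + c i * laplacian A g (b i) p"
    using insert by (intro laplacian_lincomb smooth_function_sum assms(3)) auto
  finally show ?case
    using insert by (simp add: algebra_simps)
qed

text \<open>Both the real power and the quotient are smooth because u > 0 holds on the ambient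
  region.\<close>

lemma ext_smooth_series:
  assumes "\<And>m. smooth_function A (b m)"
  shows "ext_smooth lam (\<lambda>q \<rho>. (1 + lam * \<rho>) powr w * (\<Sum>m<N. b m q * (\<rho> / (1 + lam * \<rho>)) ^ m))"
  unfolding ext_smooth_def
proof
  fix a
  let ?R = "amb_region lam (cimage a)"
  have R: "open ?R" by (rule open_amb_region[OF open_cimage])
  have "smooth_on ?R (\<lambda>X. (b m \<circ> param A a) (xpart X))" for m
    by (rule smooth_on_compose_vec[OF R _ _ smooth_functionD[OF assms]])
      (auto simp: amb_region_def smooth_on_vec_nth)
  then have b: "smooth_on ?R (\<lambda>X. b m (param A a (xpart X)))" for m
    by (simp add: comp_def)
  have u: "smooth_on ?R (\<lambda>X. 1 + lam * X $ AmbR)"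
    by (intro smooth_on_add smooth_on_mult R smooth_on_const smooth_on_vec_nth)
  show "smooth_on ?R (lift a (\<lambda>q \<rho>. (1 + lam * \<rho>) powr w * (\<Sum>m<N. b m q * (\<rho> / (1 + lam * \<rho>)) ^ m)))"
    unfolding lift_def[abs_def]
    by (intro smooth_on_mult smooth_on_powr smooth_on_sum smooth_on_power smooth_on_divide R u b smooth_on_vec_nth)
      (auto simp: amb_region_def)
qed

text \<open>The residual z^K is \<rho>^K / u^K. Pulling \<rho>^K to the front displays the order of
  vanishing at \<rho> = 0, and the exponent K + 2 collects this u^K and the u^2 of the
  substitution.\<close>

lemma harmonic_lhs_series:
  assumes b: "\<And>m. smooth_function A (b m)" and p: "p \<in> manifold_of A" and r: "\<rho> \<in> rho_dom lam"
    and rec: "\<And>m. m < K \<Longrightarrow> 2 * (real m + 1) * (real K - real m) * b (Suc m) p =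
      - laplacian A g (b m) p
      + 2 * lam * ((n / 2 + (real K - real m)) * (n / 2 - (real K - real m) - 1)) * b m p"
    and n: "n = real CARD('n)" and w: "w = real K + 1 - n / 2"
  shows "harmonic_lhs A g lam (Suc K)
      (\<lambda>q \<rho>. (1 + lam * \<rho>) powr w * (\<Sum>m<Suc K. b m q * (\<rho> / (1 + lam * \<rho>)) ^ m)) p \<rho>
    = \<rho> ^ K * ((1 + lam * \<rho>) powr w / (1 + lam * \<rho>) ^ (K + 2) *
        (laplacian A g (b K) p - 2 * lam * (n / 2 * (n / 2 - 1)) * b K p))"
proof -
  define f where "f = (\<lambda>q \<rho>. (1 + lam * \<rho>) powr w * (\<Sum>m<Suc K. b m q * (\<rho> / (1 + lam * \<rho>)) ^ m))"
  have f: "ext_smooth lam f"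
    unfolding f_def by (rule ext_smooth_series[OF b])
  define u where "u = 1 + lam * \<rho>"
  define z where "z = \<rho> / u"
  define H where "H = (\<lambda>z. \<Sum>m<Suc K. b m p * z ^ m)"
  define H1 where "H1 = (\<lambda>z. \<Sum>m<Suc K. b m p * (real m * z ^ (m - 1)))"
  define H2 where "H2 = (\<lambda>z. \<Sum>m<Suc K. b m p * (real m * (real (m - 1) * z ^ (m - 2))))"
  have dH: "(H has_real_derivative H1 z) (at z)" "(H1 has_real_derivative H2 z) (at z)" for z
    unfolding H_def H1_def H2_def
    by (auto intro!: DERIV_sum DERIV_cmult derivative_eq_intros simp: numeral_2_eq_2 simp del: sum.lessThan_Suc)
  define L where "L = (\<Sum>m<Suc K. laplacian A g (b m) p * z ^ m)"
  have lap: "laplacian A g (\<lambda>q. f q \<rho>) p = u powr w * L"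
  proof -
    have "laplacian A g (\<lambda>q. u powr w * (\<Sum>m<Suc K. b m q * z ^ m)) p = u powr w * L"
      unfolding L_def
      by (simp only: laplacian_cmult[OF smooth_function_sum[OF b] p] laplacian_sum[OF finite_lessThan b p])
    then show ?thesis
      by (simp add: f_def u_def z_def)
  qed
  have fp: "f p = (\<lambda>\<rho>. (1 + lam * \<rho>) powr w * H (\<rho> / (1 + lam * \<rho>)))"
    by (simp add: f_def H_def)
  have n': "n = 2 * (real (Suc K) - w)"
    using w by simp
  have k: "real (Suc K) - n / 2 = w" "2 * real (Suc K) - 2 = 2 * real K" "2 * real (Suc K) + n - 2 = 2 * real K + n"
    using w by simp_all
  have "harmonic_lhs A g lam (Suc K) f p \<rho> =
      u powr w / u\<^sup>2 * (- 2 * z * (1 - lam * z) * H2 z + 2 * real K * (1 - 2 * lam * z) * H1 z + L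
         + lam * w * (2 * real K + n) * H z)"
    using ode_substitution[OF dH r n', of L]
    unfolding harmonic_lhs_eq[OF f p r] lap fp u_def[symmetric] z_def[symmetric] n[symmetric] k by simp
  also have "\<dots> = u powr w / u\<^sup>2 * ((laplacian A g (b K) p - 2 * lam * (n / 2 * (n / 2 - 1)) * b K p) * z ^ K)"
    unfolding H_def H1_def H2_def L_def by (subst ode_series[OF rec w]) auto
  also have "\<dots> = \<rho> ^ K * (u powr w / u ^ (K + 2) *
      (laplacian A g (b K) p - 2 * lam * (n / 2 * (n / 2 - 1)) * b K p))"
    by (simp add: z_def power_divide power_add power2_eq_square mult_ac)
  finally show ?thesis
    unfolding f_def u_def .
qed

section \<open>Independence of the chosen extension\<close>

lemma harmonic_lhs_smooth:
  assumes f: "ext_smooth lam f" and p: "p \<in> manifold_of A"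
  shows "smooth_on (rho_dom lam) (harmonic_lhs A g lam k f p)"
proof -
  note d = smooth_on_fibre[OF f p] smooth_on_deriv(1)[OF open_rho_dom]
  have u: "smooth_on (rho_dom lam) (\<lambda>\<rho>. 1 + lam * \<rho>)"
    by (intro smooth_on_add smooth_on_mult smooth_on_const open_rho_dom smooth_on_rho)
  show ?thesis
    by (rule smooth_on_cong[OF open_rho_dom, THEN iffD2, OF harmonic_lhs_eq[OF f p]], assumption)
      (intro smooth_on_add smooth_on_diff smooth_on_mult smooth_on_divide smooth_on_power open_rho_dom d u
        smooth_on_const laplacian_slice(1)[OF f p] smooth_on_rho, auto simp: rho_dom_def)
qed

text \<open>When the Taylor coefficients up to order m vanish, only -2 \<rho> f'' and (2k - 2) f'
  contribute, by -2m and 2k - 2 times the derivative of order m + 1. The factor vanishes exactly at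
  m = k - 1: there the extension cannot be continued freely and the obstruction arises.\<close>

lemma higher_deriv_harmonic_lhs:
  assumes f: "ext_smooth lam f" and p: "p \<in> manifold_of A"
    and z: "\<And>j q. j \<le> m \<Longrightarrow> q \<in> manifold_of A \<Longrightarrow> (deriv ^^ j) (f q) 0 = 0"
  shows "(deriv ^^ m) (harmonic_lhs A g lam k f p) 0 = 2 * (real k - 1 - real m) * (deriv ^^ Suc m) (f p) 0"
proof -
  let ?U = "rho_dom lam"
  define F where "F = f p"
  define G where "G = (\<lambda>\<rho>. laplacian A g (\<lambda>q. f q \<rho>) p)"
  define n where "n = real CARD('n)"
  \<comment> \<open>The coefficients of \<rho> f', of the Laplacian and of f, which are smooth near
    \<rho> = 0. Each multiplies a function whose derivatives up to order m vanish at 0.\<close>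
  define \<phi>1 where "\<phi>1 = (\<lambda>\<rho>. - 2 * n * lam / (1 + lam * \<rho>))"
  define \<phi>2 where "\<phi>2 = (\<lambda>\<rho>. 1 / (1 + lam * \<rho>)\<^sup>2)"
  define \<phi>3 where "\<phi>3 = (\<lambda>\<rho>. lam * n * (real k - n / 2) / (1 + lam * \<rho>))"
  note U = open_rho_dom[of lam]
  have u: "smooth_on ?U (\<lambda>\<rho>. 1 + lam * \<rho>)"
    by (intro smooth_on_add smooth_on_mult smooth_on_const open_rho_dom smooth_on_rho)
  have F: "smooth_on ?U F"
    unfolding F_def by (rule smooth_on_fibre[OF f p])
  note dF = smooth_on_deriv(1)[OF U F] and ddF = smooth_on_deriv(1)[OF U smooth_on_deriv(1)[OF U F]]
  have G: "smooth_on ?U G"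
    unfolding G_def by (rule laplacian_slice(1)[OF f p])
  have \<phi>: "smooth_on ?U \<phi>1" "smooth_on ?U \<phi>2" "smooth_on ?U \<phi>3"
    unfolding \<phi>1_def \<phi>2_def \<phi>3_def
    by (intro smooth_on_divide smooth_on_power U u smooth_on_const; auto simp: rho_dom_def)+
  have rF: "smooth_on ?U (\<lambda>\<rho>. \<rho> * deriv F \<rho>)" "smooth_on ?U (\<lambda>\<rho>. \<rho> * deriv (deriv F) \<rho>)"
    by (intro smooth_on_mult U smooth_on_rho dF ddF)+
  have eq: "harmonic_lhs A g lam k f p \<rho> =
      (((- 2 * (\<rho> * deriv (deriv F) \<rho>) + (2 * real k - 2) * deriv F \<rho>) + (\<rho> * deriv F \<rho>) * \<phi>1 \<rho>)
        + G \<rho> * \<phi>2 \<rho>) + F \<rho> * \<phi>3 \<rho>" if "\<rho> \<in> ?U" for \<rho>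
    unfolding harmonic_lhs_eq[OF f p that] F_def G_def \<phi>1_def \<phi>2_def \<phi>3_def n_def by (simp add: algebra_simps)
  have F0: "(deriv ^^ j) F 0 = 0" if "j < Suc m" for j
    using z[of j p] that p by (simp add: F_def)
  \<comment> \<open>The Laplacian at \<open>p\<close> needs the vanishing at all points near
    \<open>p\<close>; hence assumption \<open>z\<close> ranges over the whole manifold.\<close>
  have G0: "(deriv ^^ j) G 0 = 0" if "j < Suc m" for j
  proof -
    have "(deriv ^^ j) G 0 = laplacian A g (\<lambda>q. (deriv ^^ j) (f q) 0) p"
      unfolding G_def by (rule higher_deriv_laplacian_slice[OF f p zero_rho_dom])
    also have "\<dots> = laplacian A g (\<lambda>q. 0) p"
      by (rule laplacian_cong[OF _ p]) (use z that in auto)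
    finally show ?thesis
      using laplacian_zero[OF p] by simp
  qed
  have rF0: "(deriv ^^ j) (\<lambda>\<rho>. \<rho> * deriv F \<rho>) 0 = 0" if "j < Suc m" for j
    using higher_deriv_mult_left[OF U dF zero_rho_dom, of j] F0[OF that]
    by (cases j) (simp_all add: higher_deriv_Suc'[symmetric] del: funpow.simps)
  have rrF: "(deriv ^^ m) (\<lambda>\<rho>. \<rho> * deriv (deriv F) \<rho>) 0 = real m * (deriv ^^ Suc m) F 0"
    using higher_deriv_mult_left[OF U ddF zero_rho_dom, of m]
    by (cases m) (simp_all add: higher_deriv_Suc'[symmetric] del: funpow.simps)
  have "(deriv ^^ m) (harmonic_lhs A g lam k f p) 0 = (deriv ^^ m) (\<lambda>\<rho>.
      (((- 2 * (\<rho> * deriv (deriv F) \<rho>) + (2 * real k - 2) * deriv F \<rho>) + (\<rho> * deriv F \<rho>) * \<phi>1 \<rho>)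
        + G \<rho> * \<phi>2 \<rho>) + F \<rho> * \<phi>3 \<rho>) 0"
    by (rule higher_deriv_cong[OF U eq zero_rho_dom])
  also have "\<dots> = - 2 * (deriv ^^ m) (\<lambda>\<rho>. \<rho> * deriv (deriv F) \<rho>) 0
      + (2 * real k - 2) * (deriv ^^ m) (deriv F) 0
      + (deriv ^^ m) (\<lambda>\<rho>. (\<rho> * deriv F \<rho>) * \<phi>1 \<rho>) 0
      + (deriv ^^ m) (\<lambda>\<rho>. G \<rho> * \<phi>2 \<rho>) 0 + (deriv ^^ m) (\<lambda>\<rho>. F \<rho> * \<phi>3 \<rho>) 0"
    by (simp only: higher_deriv_add[OF U _ _ zero_rho_dom] higher_deriv_cmult[OF U _ zero_rho_dom]
        smooth_on_add[OF U] smooth_on_mult[OF U] smooth_on_const F G \<phi> rF dF ddF)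
  also have "(deriv ^^ m) (\<lambda>\<rho>. (\<rho> * deriv F \<rho>) * \<phi>1 \<rho>) 0 = 0"
    by (rule higher_deriv_mult_vanishing(2)[OF U rF(1) \<phi>(1) zero_rho_dom rF0 lessI])
  also have "(deriv ^^ m) (\<lambda>\<rho>. G \<rho> * \<phi>2 \<rho>) 0 = 0"
    by (rule higher_deriv_mult_vanishing(2)[OF U G \<phi>(2) zero_rho_dom G0 lessI])
  also have "(deriv ^^ m) (\<lambda>\<rho>. F \<rho> * \<phi>3 \<rho>) 0 = 0"
    by (rule higher_deriv_mult_vanishing(2)[OF U F \<phi>(3) zero_rho_dom F0 lessI])
  finally show ?thesis
    unfolding rrF F_def[symmetric] by (simp add: higher_deriv_Suc'[symmetric] algebra_simps del: funpow.simps)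
qed

lemma harmonic_lhs_diff:
  assumes f: "ext_smooth lam f" and h: "ext_smooth lam h" and p: "p \<in> manifold_of A" and r: "\<rho> \<in> rho_dom lam"
  shows "ext_smooth lam (\<lambda>q \<rho>. f q \<rho> + (- 1) * h q \<rho>)" (is ?S)
    and "harmonic_lhs A g lam k (\<lambda>q \<rho>. f q \<rho> + (- 1) * h q \<rho>) p \<rho>
      = harmonic_lhs A g lam k f p \<rho> + (- 1) * harmonic_lhs A g lam k h p \<rho>"
proof -
  note U = open_rho_dom[of lam]
  show S: ?S
    unfolding ext_smooth_def
  proof
    fix a
    show "smooth_on (amb_region lam (cimage a)) (lift a (\<lambda>q \<rho>. f q \<rho> + (- 1) * h q \<rho>))"
      unfolding lift_def[abs_def]
      by (intro smooth_on_add smooth_on_mult smooth_on_const open_amb_region open_cimage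
          ext_smooth_lift[OF f, unfolded lift_def[abs_def]] ext_smooth_lift[OF h, unfolded lift_def[abs_def]])
  qed
  have d: "(deriv ^^ m) (\<lambda>\<rho>. f p \<rho> + (- 1) * h p \<rho>) \<rho> = (deriv ^^ m) (f p) \<rho> + (- 1) * (deriv ^^ m) (h p) \<rho>" for m
    by (simp only: higher_deriv_add[OF U _ _ r] higher_deriv_cmult[OF U _ r] smooth_on_mult[OF U] smooth_on_const
        smooth_on_fibre[OF f p] smooth_on_fibre[OF h p])
  have d1: "deriv (\<lambda>\<rho>. f p \<rho> + (- 1) * h p \<rho>) \<rho> = deriv (f p) \<rho> + (- 1) * deriv (h p) \<rho>"
    using d[of "Suc 0"] by (simp only: funpow.simps comp_def id_def)
  have d2: "deriv (deriv (\<lambda>\<rho>. f p \<rho> + (- 1) * h p \<rho>)) \<rho>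
      = deriv (deriv (f p)) \<rho> + (- 1) * deriv (deriv (h p)) \<rho>"
    using d[of "Suc (Suc 0)"] by (simp only: funpow.simps comp_def id_def)
  have l: "laplacian A g (\<lambda>q. f q \<rho> + (- 1) * h q \<rho>) p
      = laplacian A g (\<lambda>q. f q \<rho>) p + (- 1) * laplacian A g (\<lambda>q. h q \<rho>) p"
    by (rule laplacian_lincomb[OF smooth_function_slice[OF f r] smooth_function_slice[OF h r] p])
  show "harmonic_lhs A g lam k (\<lambda>q \<rho>. f q \<rho> + (- 1) * h q \<rho>) p \<rho>
      = harmonic_lhs A g lam k f p \<rho> + (- 1) * harmonic_lhs A g lam k h p \<rho>"
    unfolding harmonic_lhs_eq[OF f p r] harmonic_lhs_eq[OF h p r] harmonic_lhs_eq[OF S p r] l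
    unfolding d1 d2
    by (simp add: algebra_simps diff_divide_distrib)
qed

text \<open>The equation is linear, so the difference of two extensions solves it to the required
  order with zero initial value. Inductively its derivatives up to order k - 1 vanish, as the
  factors 2 (k - 1 - m) are non-zero for m < k - 1.\<close>

lemma harmonic_extension_unique:
  assumes f: "harmonic_extension A g lam k f0 f" and h: "harmonic_extension A g lam k f0 h"
    and p: "p \<in> manifold_of A" and k: "k \<ge> 1"
  shows "(deriv ^^ (k - 1)) (harmonic_lhs A g lam k f p) 0 = (deriv ^^ (k - 1)) (harmonic_lhs A g lam k h p) 0"
proof -
  note U = open_rho_dom[of lam]
  have fs: "ext_smooth lam f" and hs: "ext_smooth lam h"
    using f h unfolding harmonic_extension_def smooth_function_ambient by auto
  define e where "e = (\<lambda>q \<rho>. f q \<rho> + (- 1) * h q \<rho>)"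
  have es: "ext_smooth lam e"
    unfolding e_def by (rule harmonic_lhs_diff(1)[OF fs hs p zero_rho_dom])
  have de: "(deriv ^^ m) (harmonic_lhs A g lam k e q) 0 = (deriv ^^ m) (harmonic_lhs A g lam k f q) 0
      - (deriv ^^ m) (harmonic_lhs A g lam k h q) 0" if "q \<in> manifold_of A" for m q
  proof -
    note sf = harmonic_lhs_smooth[OF fs that, of k] and sh = harmonic_lhs_smooth[OF hs that, of k]
    have "(deriv ^^ m) (harmonic_lhs A g lam k e q) 0 =
        (deriv ^^ m) (\<lambda>\<rho>. harmonic_lhs A g lam k f q \<rho> + (- 1) * harmonic_lhs A g lam k h q \<rho>) 0"
      unfolding e_def by (rule higher_deriv_cong[OF U harmonic_lhs_diff(2)[OF fs hs that] zero_rho_dom])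
    also have "\<dots> = (deriv ^^ m) (harmonic_lhs A g lam k f q) 0
      + (- 1) * (deriv ^^ m) (harmonic_lhs A g lam k h q) 0"
      by (simp only: higher_deriv_add[OF U _ _ zero_rho_dom] higher_deriv_cmult[OF U _ zero_rho_dom]
          smooth_on_mult[OF U] smooth_on_const sf sh)
    finally show ?thesis by simp
  qed
  have z: "\<forall>j\<le>m. \<forall>q\<in>manifold_of A. (deriv ^^ j) (e q) 0 = 0" if "m \<le> k - 1" for m
    using that
  proof (induction m)
    case 0
    then show ?case
      using f h by (auto simp: e_def harmonic_extension_def)
  next
    case (Suc m)
    have "(deriv ^^ Suc m) (e q) 0 = 0" if q: "q \<in> manifold_of A" for q
    proof -
      have "(deriv ^^ m) (harmonic_lhs A g lam k e q) 0 = 0"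
        using f h q Suc.prems unfolding de[OF q] by (auto simp: harmonic_extension_def)
      moreover have "(deriv ^^ m) (harmonic_lhs A g lam k e q) 0
          = 2 * (real k - 1 - real m) * (deriv ^^ Suc m) (e q) 0"
        by (rule higher_deriv_harmonic_lhs[OF es q]) (use Suc in auto)
      moreover have "real k - 1 - real m \<noteq> 0"
        using Suc.prems by auto
      ultimately show ?thesis by simp
    qed
    then show ?case
      using Suc by (auto simp: le_Suc_eq simp del: funpow.simps)
  qed
  \<comment> \<open>At m = k - 1 the factor is zero, so the k-th derivatives of the two extensions
    may differ without affecting the value.\<close>
  have "(deriv ^^ (k - 1)) (harmonic_lhs A g lam k e p) 0
      = 2 * (real k - 1 - real (k - 1)) * (deriv ^^ Suc (k - 1)) (e p) 0"
    by (rule higher_deriv_harmonic_lhs[OF es p]) (use z in auto)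
  then show ?thesis
    using de[OF p] k by (simp add: of_nat_diff del: funpow.simps)
qed

section \<open>The value of the obstruction\<close>

lemma obstruction_eqI:
  assumes "harmonic_extension A g lam k f0 f" "p \<in> manifold_of A" "k \<ge> 1"
  shows "obstruction A g lam k f0 p = (deriv ^^ (k - 1)) (harmonic_lhs A g lam k f p) 0"
  unfolding obstruction_def
  by (rule the_equality) (use assms harmonic_extension_unique[OF _ assms] in blast)+

text \<open>The constant is -K! times the product of the reciprocal recursion factors, that is -1 /
  (2^K K!). Writing k as \<open>Suc K\<close> avoids truncated differences.\<close>

lemma obstruction_eq:
  assumes c: "\<And>j. c j = (real CARD('n) / 2 + real j - 1) * (real CARD('n) / 2 - real j)"
  shows "\<exists>\<kappa>. \<kappa> \<noteq> 0 \<and> (\<forall>f p. smooth_function A f \<longrightarrow> p \<in> manifold_of A \<longrightarrow>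
      obstruction A g lam (Suc K) f p = \<kappa> * shifted_prod (map (\<lambda>j. 2 * lam * c j) [1..<Suc (Suc K)]) f p)"
proof -
  define n where "n = real CARD('n)"
  define w where "w = real K + 1 - n / 2"
  \<comment> \<open>The accumulated reciprocals of the factors on the left of the recursion,
    non-zero up to index K. Beyond K the factor with \<open>i = K\<close> is 1/0 = 0; the truncated
    series stops at K.\<close>
  define \<beta> where "\<beta> = (\<lambda>m. \<Prod>i<m. 1 / (2 * (real i + 1) * (real K - real i)))"
  \<comment> \<open>The product of the last \<open>m\<close> factors. The recursion starts with the
    largest index, so each step adds a factor with a smaller index on the outside.\<close>
  define R where "R = (\<lambda>m. shifted_prod (map (\<lambda>j. 2 * lam * c j) [Suc (Suc K) - m..<Suc (Suc K)]))"
  have R_Suc: "R (Suc m) f = shifted (2 * lam * c (Suc K - m)) (R m f)" if "m \<le> K" for m f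
  proof -
    have "[Suc (Suc K) - Suc m..<Suc (Suc K)] = (Suc K - m) # [Suc (Suc K) - m..<Suc (Suc K)]"
      using that by (subst upt_conv_Cons) (auto simp: Suc_diff_le)
    then show ?thesis by (simp add: R_def)
  qed
  have \<beta>0: "\<beta> K \<noteq> 0"
    unfolding \<beta>_def by (auto simp: add_pos_nonneg)
  have "obstruction A g lam (Suc K) f p = (- fact K * \<beta> K) * R (Suc K) f p"
    if f: "smooth_function A f" and p: "p \<in> manifold_of A" for f p
  proof -
    define b where "b = (\<lambda>m q. \<beta> m * R m f q)"
    have Rs: "smooth_function A (R m f)" for m
      unfolding R_def by (rule smooth_function_shifted_prod[OF f])
    have b: "smooth_function A (b m)" for m
      unfolding b_def by (rule smooth_function_cmult[OF Rs])
    have lapb: "laplacian A g (b m) q = \<beta> m * laplacian A g (R m f) q" if "q \<in> manifold_of A" for m q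
      unfolding b_def by (rule laplacian_cmult[OF Rs that])
    have cm: "c (Suc K - m) = (n / 2 + (real K - real m)) * (n / 2 - (real K - real m) - 1)" if "m \<le> K" for m
      using that by (simp add: c n_def of_nat_diff algebra_simps)
    have rec: "2 * (real m + 1) * (real K - real m) * b (Suc m) q = - laplacian A g (b m) q
      + 2 * lam * ((n / 2 + (real K - real m)) * (n / 2 - (real K - real m) - 1)) * b m q"
      if "q \<in> manifold_of A" "m < K" for m q
    proof -
      have "2 * (real m + 1) * (real K - real m) * \<beta> (Suc m) = \<beta> m"
        using that(2) by (simp add: \<beta>_def)
      then have "2 * (real m + 1) * (real K - real m) * b (Suc m) q = \<beta> m * R (Suc m) f q"
        unfolding b_def by (metis mult.assoc)
      also have "\<beta> m * R (Suc m) f q = - laplacian A g (b m) q + 2 * lam * c (Suc K - m) * b m q"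
        using that(2) unfolding lapb[OF that(1)] by (simp add: R_Suc shifted_def minus_laplacian_def b_def algebra_simps)
      finally show ?thesis
        using that(2) by (simp only: cm[OF less_imp_le])
    qed
    define F where "F = (\<lambda>q \<rho>. (1 + lam * \<rho>) powr w * (\<Sum>m<Suc K. b m q * (\<rho> / (1 + lam * \<rho>)) ^ m))"
    define C where "C = (\<lambda>q. laplacian A g (b K) q - 2 * lam * (n / 2 * (n / 2 - 1)) * b K q)"
    define \<psi> where "\<psi> = (\<lambda>q \<rho>. (1 + lam * \<rho>) powr w / (1 + lam * \<rho>) ^ (K + 2) * C q)"
    have harm: "harmonic_lhs A g lam (Suc K) F q \<rho> = \<rho> ^ K * \<psi> q \<rho>"
      if "q \<in> manifold_of A" "\<rho> \<in> rho_dom lam" for q \<rho>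
      unfolding F_def \<psi>_def C_def
      by (rule harmonic_lhs_series[OF b that rec[OF that(1)] n_def w_def])
    note U = open_rho_dom[of lam]
    have \<psi>: "smooth_on (rho_dom lam) (\<psi> q)" for q
      unfolding \<psi>_def
      by (intro smooth_on_mult smooth_on_divide smooth_on_powr smooth_on_power smooth_on_add U smooth_on_const smooth_on_rho)
        (auto simp: rho_dom_def)
    have pw: "smooth_on (rho_dom lam) (\<lambda>\<rho>. \<rho> ^ K)"
      by (intro smooth_on_power U smooth_on_rho)
    have dh: "(deriv ^^ m) (harmonic_lhs A g lam (Suc K) F q) 0 = (deriv ^^ m) (\<lambda>\<rho>. \<rho> ^ K * \<psi> q \<rho>) 0"
      if "q \<in> manifold_of A" for q m
      by (rule higher_deriv_cong[OF U harm[OF that] zero_rho_dom])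
    have ext: "harmonic_extension A g lam (Suc K) f F"
      unfolding harmonic_extension_def smooth_function_ambient
    proof (intro conjI ballI allI impI)
      show "ext_smooth lam F"
        unfolding F_def by (rule ext_smooth_series[OF b])
      show "F q 0 = f q" for q
        by (simp add: F_def sum.lessThan_Suc_shift b_def \<beta>_def R_def del: sum.lessThan_Suc)
      show "(deriv ^^ m) (harmonic_lhs A g lam (Suc K) F q) 0 = 0" if "m < Suc K - 1" "q \<in> manifold_of A" for m q
        unfolding dh[OF that(2)] using that(1)
        by (intro higher_deriv_mult_vanishing(2)[OF U pw \<psi> zero_rho_dom, of K] higher_deriv_power_0) auto
    qed
    have "obstruction A g lam (Suc K) f p = (deriv ^^ K) (\<lambda>\<rho>. \<rho> ^ K * \<psi> p \<rho>) 0"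
      using obstruction_eqI[OF ext p] dh[OF p, of K] by simp
    also have "\<dots> = (deriv ^^ K) (\<lambda>\<rho>. \<rho> ^ K) 0 * \<psi> p 0"
      by (rule higher_deriv_mult_vanishing(1)[OF U pw \<psi> zero_rho_dom higher_deriv_power_0(1)])
    also have "\<dots> = fact K * C p"
      by (simp add: higher_deriv_power_0 \<psi>_def)
    \<comment> \<open>The operator left over in the residual, \<Delta> - 2 \<lambda> c_1, is minus
      the one missing factor, and it completes the product.\<close>
    also have "C p = - \<beta> K * R (Suc K) f p"
    proof -
      have c1: "n / 2 * (n / 2 - 1) = c (Suc K - K)"
        using cm[of K] by simp
      show ?thesis
        unfolding C_def lapb[OF p] c1
        by (simp add: R_Suc shifted_def minus_laplacian_def b_def algebra_simps)
    qed
    finally show ?thesis by simp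
  qed
  moreover have "R (Suc K) = shifted_prod (map (\<lambda>j. 2 * lam * c j) [1..<Suc (Suc K)])"
    by (simp add: R_def)
  ultimately show ?thesis
    using \<beta>0 by (intro exI[of _ "- fact K * \<beta> K"]) auto
qed

end

section \<open>Bump functions\<close>

text \<open>The classical function exp(-1/x), extended by zero, together with its products with
  powers of 1/x. This family is closed under differentiation up to linear combinations, so
  smoothness follows by one induction over all \<open>k\<close>.\<close>

definition flat :: "nat \<Rightarrow> real \<Rightarrow> real" where
  "flat k x = (if x > 0 then inverse x ^ k * exp (- inverse x) else 0)"

lemma flat_has_derivative: "(flat k has_real_derivative flat (k + 2) x - real k * flat (k + 1) x) (at x)"
proof -
  consider "x > 0" | "x < 0" | "x = 0" by linarith
  then show ?thesis
  proof cases
    case 1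
    have *: "((\<lambda>x. Y x ^ k * exp (- Y x)) has_real_derivative
        Y x ^ (k + 2) * exp (- Y x) - real k * (Y x ^ (k + 1) * exp (- Y x))) (at x)"
      if Y: "(Y has_real_derivative - (Y x * Y x)) (at x)" for Y
    proof -
      have pw: "((\<lambda>x. Y x ^ k) has_real_derivative - real k * Y x ^ (k + 1)) (at x)"
        using DERIV_power[OF Y, of k] by (cases k) (simp_all add: algebra_simps)
      have "((\<lambda>x. exp (- Y x)) has_real_derivative exp (- Y x) * (Y x * Y x)) (at x)"
        by (auto intro!: derivative_eq_intros Y)
      from DERIV_mult[OF pw this] show ?thesis
        by (simp add: algebra_simps)
    qed
    have "(inverse has_real_derivative - (inverse x * inverse x)) (at x)"
      using 1 by (auto intro!: derivative_eq_intros)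
    from *[OF this] have "((\<lambda>x. inverse x ^ k * exp (- inverse x)) has_real_derivative
        flat (k + 2) x - real k * flat (k + 1) x) (at x)"
      using 1 by (simp add: flat_def)
    then show ?thesis
      by (rule has_field_derivative_transform_within_open[of _ _ _ "{0<..}"]) (use 1 in \<open>auto simp: flat_def\<close>)
  next
    case 2
    have "((\<lambda>x. 0) has_real_derivative flat (k + 2) x - real k * flat (k + 1) x) (at x)"
      using 2 by (simp add: flat_def)
    then show ?thesis
      by (rule has_field_derivative_transform_within_open[of _ _ _ "{..<0}"]) (use 2 in \<open>auto simp: flat_def\<close>)
  next
    case 3
    \<comment> \<open>With y = 1/h the difference quotient is y^(k+1) / exp y, which tends to 0 as y
      tends to infinity.\<close>
    have "((\<lambda>h. flat k h / h) \<longlongrightarrow> 0) (at_right 0)"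
    proof (rule Lim_transform_eventually)
      show "((\<lambda>h. inverse h ^ Suc k / exp (inverse h)) \<longlongrightarrow> 0) (at_right (0::real))"
        by (rule filterlim_compose[OF tendsto_power_div_exp_0 filterlim_inverse_at_top_right])
      show "\<forall>\<^sub>F h in at_right 0. inverse h ^ Suc k / exp (inverse h) = flat k h / h"
        using eventually_at_right_less[of 0]
        by eventually_elim (simp add: flat_def divide_inverse exp_minus mult_ac)
    qed
    moreover have "((\<lambda>h. flat k h / h) \<longlongrightarrow> 0) (at_left 0)"
    proof (rule Lim_transform_eventually[OF tendsto_const])
      show "\<forall>\<^sub>F h in at_left 0. 0 = flat k h / h"
        by (auto simp: eventually_at_left_field flat_def intro!: exI[of _ "-1"])
    qed
    ultimately have "((\<lambda>h. flat k h / h) \<longlongrightarrow> 0) (at 0)"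
      using filterlim_split_at by blast
    then show ?thesis
      using 3 by (simp add: DERIV_def flat_def)
  qed
qed

lemma smooth_on_flat: "smooth_on UNIV (flat k)"
  unfolding smooth_on_def
proof
  have d: "(flat k has_derivative (\<lambda>v. (flat (k + 2) x - real k * flat (k + 1) x) * v)) (at x)" for k x
    using flat_has_derivative[of k x] by (simp add: has_field_derivative_def)
  show "C_k_on m UNIV (flat k)" for m
  proof (induction m arbitrary: k)
    case 0
    show ?case
      using differentiable_imp_continuous_within[OF differentiableI[OF d]]
      by (auto intro!: continuous_at_imp_continuous_on)
  next
    case (Suc m)
    have "C_k_on m UNIV (\<lambda>x. (flat (k + 2) x + (- real k) * flat (k + 1) x) * v)" for v
      by (intro C_k_on_mult C_k_on_add C_k_on_const Suc open_UNIV)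
    then have "C_k_on m UNIV (\<lambda>x. frechet_derivative (flat k) (at x) v)" for v
      by (simp add: frechet_derivative_eqI[OF d])
    then show ?case
      using d by (auto simp: differentiable_def)
  qed
qed

lemma smooth_on_Un:
  assumes "open S" "open T" "smooth_on S f" "smooth_on T f"
  shows "smooth_on (S \<union> T) f"
proof -
  have "C_k_on m S f \<Longrightarrow> C_k_on m T f \<Longrightarrow> C_k_on m (S \<union> T) f" for m
    by (induction m arbitrary: f) (auto intro: continuous_on_open_Un assms(1,2))
  then show ?thesis
    using assms(3,4) by (simp add: smooth_on_def)
qed

text \<open>The squared distance is written as a sum of squares of coordinates, which is polynomial
  and hence smooth also at the centre.\<close>

definition bump :: "real^'n::finite \<Rightarrow> real \<Rightarrow> real^'n \<Rightarrow> real" where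
  "bump x0 r x = flat 0 (r\<^sup>2 - (\<Sum>i\<in>UNIV. (x $ i - x0 $ i)\<^sup>2))"

lemma smooth_on_bump: "smooth_on UNIV (bump x0 r)"
  unfolding bump_def[abs_def]
  by (rule smooth_on_compose[OF open_UNIV _ subset_UNIV smooth_on_flat])
    (auto intro!: smooth_on_diff smooth_on_sum smooth_on_power smooth_on_const smooth_on_vec_nth)

lemma bump_center: "r > 0 \<Longrightarrow> bump x0 r x0 > 0"
  by (simp add: bump_def flat_def)

lemma bump_outside: 
  assumes "r > 0" "x \<notin> cball x0 r"
  shows "bump x0 r x = 0"
proof -
  have "r\<^sup>2 < (norm (x - x0))\<^sup>2"
    using assms by (intro power_strict_mono) (auto simp: dist_norm norm_minus_commute)
  also have "\<dots> = (\<Sum>i\<in>UNIV. (x $ i - x0 $ i)\<^sup>2)"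
    by (simp add: norm_vec_def L2_set_def sum_nonneg)
  finally show ?thesis
    by (simp add: bump_def flat_def)
qed

text \<open>Extension by zero. The preimage of the closed ball is compact, hence closed in the
  Hausdorff space, so its complement is open. In any other chart the function is smooth on the
  overlap and zero off this compact set, and these two open sets cover the chart.\<close>

lemma (in pr_manifold) smooth_function_extend:
  assumes h: "smooth_on (cimage a) h" and r: "r > 0" and cb: "cball x0 r \<subseteq> cimage a"
    and z: "\<And>x. x \<in> cimage a \<Longrightarrow> x \<notin> cball x0 r \<Longrightarrow> h x = 0"
  shows "smooth_function A (\<lambda>q. if q \<in> cdom a then h (chart A a q) else 0)"
  unfolding smooth_function_def
proof
  fix b
  define f where "f = (\<lambda>q. if q \<in> cdom a then h (chart A a q) else 0)"
  define C where "C = param A a ` cball x0 r"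
  have "continuous_on (cball x0 r) (param A a)"
    using homeomorphism_cont2[OF chart_homeo[of a]] cb continuous_on_subset by metis
  then have "closed C"
    unfolding C_def by (intro compact_imp_closed compact_continuous_image compact_cball)
  have Ca: "C \<subseteq> cdom a"
    using cb param_cdom by (auto simp: C_def)
  define V1 where "V1 = chart A b ` (cdom b \<inter> cdom a)"
  define V2 where "V2 = chart A b ` (cdom b - C)"
  have V1: "open V1"
    unfolding V1_def by (rule open_overlap)
  have V2: "open V2"
  proof -
    have "openin (top_of_set (cdom b)) (cdom b - C)"
      using \<open>closed C\<close> open_cdom[of b] by (auto simp: openin_open_eq)
    then have "openin (top_of_set (cimage b)) V2"
      unfolding V2_def by (rule homeomorphism_imp_open_map[OF chart_homeo])
    then show ?thesis
      using open_cimage openin_open_eq by blast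
  qed
  have un: "cimage b = V1 \<union> V2"
    using Ca by (auto simp: V1_def V2_def)
  have tr: "smooth_on V1 (chart A a \<circ> param A b)"
    using atlas unfolding smooth_atlas_def V1_def by blast
  have im: "(\<lambda>y. chart A a (param A b y)) ` V1 \<subseteq> cimage a"
    by (auto simp: V1_def param_chart)
  have "smooth_on V1 (\<lambda>y. h (chart A a (param A b y)))"
    using smooth_on_nth[OF V1 tr] by (intro smooth_on_compose_vec[OF V1 _ im h]) (simp add: comp_def)
  then have s1: "smooth_on V1 (f \<circ> param A b)"
    by (rule smooth_on_cong[OF V1, THEN iffD1, rotated]) (auto simp: f_def V1_def param_chart)
  have zero: "(f \<circ> param A b) y = 0" if y: "y \<in> V2" for y
  proof -
    obtain q where q: "q \<in> cdom b" "q \<notin> C" "y = chart A b q"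
      using y by (auto simp: V2_def)
    have "h (chart A a q) = 0" if qa: "q \<in> cdom a"
    proof (rule z)
      show "chart A a q \<in> cimage a" using qa by blast
      show "chart A a q \<notin> cball x0 r"
        using q(2) qa param_chart[OF qa] unfolding C_def by (metis imageI)
    qed
    then show ?thesis
      using q by (simp add: f_def param_chart)
  qed
  have s2: "smooth_on V2 (f \<circ> param A b)"
    by (rule smooth_on_cong[OF V2, THEN iffD1, OF _ smooth_on_const[of V2 0]]) (simp only: zero)
  show "smooth_on (cimage b) ((\<lambda>q. if q \<in> cdom a then h (chart A a q) else 0) \<circ> param A b)"
    using smooth_on_Un[OF V1 V2 s1 s2] unfolding un f_def .
qed

section \<open>The order of powers of the Laplacian\<close>

text \<open>\<open>L\<close> has constant gradient \<xi>. One derivative costs one power of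
  \<open>L\<close>; the remaining factor is smooth, and where \<open>L\<close> vanishes it is the
  exponent times \<xi> i times \<open>B\<close>.\<close>

lemma pd_linear_power_mult:
  fixes L :: "real^'n::finite \<Rightarrow> real"
  assumes L: "smooth_on S L" "\<And>i x. x \<in> S \<Longrightarrow> pd i L x = \<xi> i" and B: "smooth_on S B" and S: "open S" "x \<in> S"
  shows "pd i (\<lambda>x. L x ^ Suc m * B x) x = L x ^ m * (real (Suc m) * \<xi> i * B x + L x * pd i B x)"
proof -
  have d: "pd i (\<lambda>x. L x ^ m) x = real m * L x ^ (m - 1) * \<xi> i" for m
  proof (induction m)
    case (Suc m)
    have "pd i (\<lambda>x. L x * L x ^ m) x = L x * pd i (\<lambda>x. L x ^ m) x + \<xi> i * L x ^ m"
      using pd_mult[OF smooth_on_differentiable[OF L(1) S(2)] smooth_on_differentiable[OF smooth_on_power[OF S(1) L(1)] S(2)]]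
        L(2)[OF S(2)] by simp
    then show ?case
      using Suc by (cases m) (simp_all add: algebra_simps)
  qed simp
  have "(\<lambda>x. L x ^ Suc m) differentiable at x" "B differentiable at x"
    using smooth_on_differentiable[OF smooth_on_power[OF S(1) L(1)] S(2)] smooth_on_differentiable[OF B S(2)] by blast+
  from pd_mult[OF this, of i] show ?thesis
    using d[of "Suc m"] by (simp add: algebra_simps)
qed

text \<open>Consequently derivatives of order less than \<open>m\<close> vanish on the zero set of
  \<open>L\<close>. An operator of lower order cannot see the test function at such a point.\<close>

lemma pds_linear_power_mult:
  fixes L :: "real^'n::finite \<Rightarrow> real"
  assumes L: "smooth_on S L" "\<And>i x. x \<in> S \<Longrightarrow> pd i L x = \<xi> i" and B: "smooth_on S B" and S: "open S"
  shows "length l \<le> m \<Longrightarrow> \<exists>B'. smooth_on S B' \<and>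
     (\<forall>x\<in>S. pds l (\<lambda>x. L x ^ m * B x) x = L x ^ (m - length l) * B' x)"
proof (induction l)
  case Nil
  then show ?case using B by auto
next
  case (Cons i l)
  then obtain B' where B': "smooth_on S B'"
    "\<And>x. x \<in> S \<Longrightarrow> pds l (\<lambda>x. L x ^ m * B x) x = L x ^ (m - length l) * B' x"
    by auto
  obtain j where j: "m - length l = Suc j" "m - length (i # l) = j"
    using Cons.prems by (metis Suc_diff_Suc Suc_le_eq length_Cons)
  have "pds (i # l) (\<lambda>x. L x ^ m * B x) x = L x ^ j * (real (Suc j) * \<xi> i * B' x + L x * pd i B' x)"
    if "x \<in> S" for x
  proof -
    have "pds (i # l) (\<lambda>x. L x ^ m * B x) x = pd i (\<lambda>x. L x ^ Suc j * B' x) x"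
      unfolding pds_Cons by (rule pd_cong[OF S that]) (simp only: B'(2) j(1))
    then show ?thesis
      using pd_linear_power_mult[OF L B'(1) S that] by simp
  qed
  moreover have "smooth_on S (\<lambda>x. real (Suc j) * \<xi> i * B' x + L x * pd i B' x)"
    by (intro smooth_on_add smooth_on_mult smooth_on_const S L(1) B'(1) smooth_on_pd)
  ultimately show ?case
    unfolding j(2) by blast
qed

text \<open>The principal symbol at work: on the zero set of \<open>L\<close> the Laplacian lowers
  the power by two and multiplies the cofactor by (m + 1)(m + 2) times the squared length of the
  covector \<xi>.\<close>

lemma coord_laplacian_linear_power_mult:
  fixes L :: "real^'n::finite \<Rightarrow> real"
  assumes G: "coord_metric S G"
    and L: "smooth_on S L" "\<And>i x. x \<in> S \<Longrightarrow> pd i L x = \<xi> i" "x0 \<in> S" "L x0 = 0"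
    and B: "smooth_on S B"
  shows "\<exists>B'. smooth_on S B' \<and> (\<forall>x\<in>S. coord_laplacian G (\<lambda>x. L x ^ (m + 2) * B x) x = L x ^ m * B' x) \<and>
     B' x0 = real ((m + 1) * (m + 2)) * (\<Sum>i\<in>UNIV. \<Sum>j\<in>UNIV. matrix_inv (G x0) $ i $ j * \<xi> i * \<xi> j) * B x0"
proof -
  note S = coord_metricD(1)[OF G]
  define B1 where "B1 = (\<lambda>j x. real (Suc (Suc m)) * \<xi> j * B x + L x * pd j B x)"
  have B1: "smooth_on S (B1 j)" for j
    unfolding B1_def by (intro smooth_on_add smooth_on_mult smooth_on_const S L(1) B smooth_on_pd)
  have d1: "pd j (\<lambda>x. L x ^ (m + 2) * B x) x = L x ^ Suc m * B1 j x" if "x \<in> S" for j x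
    using pd_linear_power_mult[OF L(1,2) B S that, of j "Suc m"] by (simp add: B1_def)
  have d2: "pd i (pd j (\<lambda>x. L x ^ (m + 2) * B x)) x = L x ^ m * (real (Suc m) * \<xi> i * B1 j x + L x * pd i (B1 j) x)"
    if "x \<in> S" for i j x
  proof -
    have "pd i (pd j (\<lambda>x. L x ^ (m + 2) * B x)) x = pd i (\<lambda>x. L x ^ Suc m * B1 j x) x"
      by (rule pd_cong[OF S that d1])
    then show ?thesis
      using pd_linear_power_mult[OF L(1,2) B1 S that] by simp
  qed
  \<comment> \<open>The first-order terms and the derivatives of \<open>B1\<close> keep an extra
    factor \<open>L\<close>, so at \<open>x0\<close> only the product of the two gradients
    remains.\<close>
  define B' where "B' = (\<lambda>x. \<Sum>i\<in>UNIV. \<Sum>j\<in>UNIV. matrix_inv (G x) $ i $ j *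
    (real (Suc m) * \<xi> i * B1 j x + L x * pd i (B1 j) x - (\<Sum>k\<in>UNIV. christoffel G k i j x * (L x * B1 k x))))"
  have "smooth_on S B'"
    unfolding B'_def
    by (intro smooth_on_sum smooth_on_mult smooth_on_diff smooth_on_add smooth_on_const S B1 L(1) smooth_on_pd
        smooth_on_metric_inv[OF G] smooth_on_christoffel[OF G])
  moreover have "coord_laplacian G (\<lambda>x. L x ^ (m + 2) * B x) x = L x ^ m * B' x" if "x \<in> S" for x
    unfolding coord_laplacian_def d1[OF that] d2[OF that] B'_def
    by (simp add: sum_distrib_left algebra_simps)
  moreover have "B' x0 = real ((m + 1) * (m + 2)) *
      (\<Sum>i\<in>UNIV. \<Sum>j\<in>UNIV. matrix_inv (G x0) $ i $ j * \<xi> i * \<xi> j) * B x0"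
    unfolding B'_def B1_def L(4) by (simp add: sum_distrib_left sum_distrib_right algebra_simps)
  ultimately show ?thesis
    by blast
qed

text \<open>Null covectors may exist in indefinite signature, but if all were null, polarization
  would make the symmetric inverse metric zero.\<close>

lemma nondegenerate_covector:
  assumes "coord_metric S G" "x \<in> S"
  shows "\<exists>\<xi>. (\<Sum>i\<in>UNIV. \<Sum>j\<in>UNIV. matrix_inv (G x) $ i $ j * \<xi> i * \<xi> j) \<noteq> 0"
proof (rule ccontr)
  define K where "K = matrix_inv (G x)"
  assume "\<not> ?thesis"
  then have q: "(\<Sum>i\<in>UNIV. \<Sum>j\<in>UNIV. K $ i $ j * \<xi> i * \<xi> j) = 0" for \<xi>
    by (auto simp: K_def)
  have inv: "invertible (G x)" "transpose (G x) = G x"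
    using assms by (auto simp: coord_metric_def)
  have "transpose K ** G x = mat 1"
    using arg_cong[OF matrix_inv_right[OF inv(1)], of transpose] inv(2)
    by (simp add: matrix_transpose_mul K_def transpose_mat)
  then have "transpose K = K"
    using matrix_inv_eqI K_def by metis
  then have sym: "K $ i $ j = K $ j $ i" for i j
    by (metis (no_types, lifting) transpose_def vec_lambda_beta)
  have q': "x \<bullet> (K *v x) = 0" for x
    using q[of "\<lambda>k. x $ k"]
    by (simp add: inner_vec_def matrix_vector_mult_def sum_distrib_left algebra_simps)
  have ax: "axis a 1 \<bullet> (K *v axis b 1) = K $ a $ b" for a b
    by (simp add: inner_axis' matrix_vector_mult_basis column_def)
  \<comment> \<open>Polarization on the pairs of basis vectors.\<close>
  have "K $ a $ b = 0" for a b
    using q'[of "axis a 1 + axis b 1"] q'[of "axis a 1"] q'[of "axis b 1"] sym[of a b]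
    by (simp add: matrix_vector_right_distrib inner_add_left inner_add_right ax)
  then have "K = 0"
    by (simp add: vec_eq_iff)
  then have "mat 1 = (0 :: real^'a^'a)"
    using matrix_inv_left[OF inv(1)] by (simp add: K_def)
  from arg_cong[OF this, of "\<lambda>M. M $ undefined $ undefined"] show False
    by (simp add: mat_def)
qed

context pr_manifold
begin

text \<open>The test function is \<open>L\<^sup>2\<^sup>k\<close> times a bump function, \<open>L\<close> an affine function of the coordinates
  that vanishes at the point and whose differential is not null.\<close>

lemma laplacian_power_order:
  assumes "manifold_of A \<noteq> {}" "k \<ge> 1"
  shows "\<not> diff_op A (2 * k - 1) (shifted_prod (replicate k 0))"
proof
  assume D: "diff_op A (2 * k - 1) (shifted_prod (replicate k 0))"
  obtain p a where p: "p \<in> cdom a"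
    using assms(1) by (auto simp: manifold_of_def)
  define x0 where "x0 = chart A a p"
  define S where "S = cimage a"
  have x0: "x0 \<in> S"
    using p by (simp add: x0_def S_def)
  have S: "open S" and G: "coord_metric S (g a)"
    using open_cimage metric_cimage by (auto simp: S_def)
  obtain r where r: "r > 0" "cball x0 r \<subseteq> S"
    using S x0 open_contains_cball by blast
  obtain \<xi> where \<xi>: "(\<Sum>i\<in>UNIV. \<Sum>j\<in>UNIV. matrix_inv (g a x0) $ i $ j * \<xi> i * \<xi> j) \<noteq> 0"
    using nondegenerate_covector[OF G x0] by blast
  define L where "L = (\<lambda>x. \<Sum>i\<in>UNIV. \<xi> i * (x $ i - x0 $ i))"
  have L: "smooth_on S L"
    unfolding L_def by (intro smooth_on_sum smooth_on_mult smooth_on_diff smooth_on_const smooth_on_vec_nth S)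
  have dL: "pd i L x = \<xi> i" for i x
  proof -
    have d: "(\<lambda>x. x $ j) differentiable at x" for j
      by (simp add: bounded_linear_imp_differentiable bounded_linear_vec_nth)
    have "pd i L x = (\<Sum>j\<in>UNIV. \<xi> j * (if i = j then 1 else 0))"
      unfolding L_def by (simp add: pd_sum pd_cmult pd_diff d)
    then show ?thesis
      by (simp add: if_distrib cong: if_cong)
  qed
  have L0: "L x0 = 0"
    by (simp add: L_def)
  define h where "h = (\<lambda>x. L x ^ (2 * k) * bump x0 r x)"
  define f where "f = (\<lambda>q. if q \<in> cdom a then h (chart A a q) else 0)"
  have b: "smooth_on S (bump x0 r)"
    using smooth_on_bump smooth_on_subset by blast
  have hs: "smooth_on S h"
    unfolding h_def by (intro smooth_on_mult smooth_on_power S L b)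
  have f: "smooth_function A f"
    unfolding f_def
    by (rule smooth_function_extend[OF hs[unfolded S_def] r(1) r(2)[unfolded S_def]])
      (simp add: h_def bump_outside[OF r(1)])
  have fh: "(f \<circ> param A a) x = h x" if "x \<in> S" for x
    using that param_cdom chart_param by (simp add: f_def S_def)
  \<comment> \<open>Each Laplacian removes two powers of \<open>L\<close> and keeps the cofactor
    non-zero at \<open>x0\<close>. After \<open>k\<close> of them no power is left, so the result
    does not vanish at the point.\<close>
  have "\<exists>B. smooth_on S B \<and> B x0 \<noteq> 0 \<and>
     (\<forall>x\<in>S. (shifted_prod (replicate j 0) f \<circ> param A a) x = L x ^ (2 * (k - j)) * B x)" if "j \<le> k" for j
    using that
  proof (induction j)
    case 0
    show ?case
      using b bump_center[OF r(1), of x0] fh by (intro exI[of _ "bump x0 r"]) (auto simp: h_def)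
  next
    case (Suc j)
    let ?f = "shifted_prod (replicate j 0) f"
    obtain B where B: "smooth_on S B" "B x0 \<noteq> 0"
      "\<And>x. x \<in> S \<Longrightarrow> (?f \<circ> param A a) x = L x ^ (2 * (k - j)) * B x"
      using Suc by auto
    define m where "m = 2 * (k - Suc j)"
    have m: "2 * (k - j) = m + 2"
      using Suc.prems by (simp add: m_def)
    obtain B' where B': "smooth_on S B'"
      "\<And>x. x \<in> S \<Longrightarrow> coord_laplacian (g a) (\<lambda>x. L x ^ (m + 2) * B x) x = L x ^ m * B' x"
      "B' x0 = real ((m + 1) * (m + 2)) * (\<Sum>i\<in>UNIV. \<Sum>j\<in>UNIV. matrix_inv (g a x0) $ i $ j * \<xi> i * \<xi> j) * B x0"
      using coord_laplacian_linear_power_mult[OF G L dL x0 L0 B(1), of m] by blast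
    have lap: "laplacian A g ?f (param A a x) = L x ^ m * B' x" if "x \<in> S" for x
    proof -
      have x: "x \<in> cimage a" using that by (simp add: S_def)
      have "laplacian A g ?f (param A a x) = coord_laplacian (g a) (?f \<circ> param A a) x"
        using laplacian_chart[OF smooth_function_shifted_prod[OF f] param_cdom[OF x]] chart_param[OF x] by simp
      also have "\<dots> = coord_laplacian (g a) (\<lambda>x. L x ^ (m + 2) * B x) x"
        by (rule coord_laplacian_cong[OF S _ that]) (simp only: B(3) m)
      finally show ?thesis
        using B'(2)[OF that] by simp
    qed
    have "smooth_on S (\<lambda>x. - B' x)"
      by (rule smooth_on_uminus[OF S B'(1)])
    moreover have "- B' x0 \<noteq> 0"
      using \<xi> B(2) unfolding B'(3) by (simp del: of_nat_mult of_nat_add of_nat_Suc)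
    ultimately show ?case
      using lap unfolding m_def[symmetric]
      by (intro exI[of _ "\<lambda>x. - B' x"]) (auto simp: shifted_def minus_laplacian_def)
  qed
  from this[of k] obtain B where B: "B x0 \<noteq> 0"
    "\<And>x. x \<in> S \<Longrightarrow> shifted_prod (replicate k 0) f (param A a x) = B x"
    by auto
  have ne: "shifted_prod (replicate k 0) f p \<noteq> 0"
    using B(2)[OF x0] B(1) p by (simp add: x0_def param_chart)
  obtain c where "shifted_prod (replicate k 0) f p =
      (\<Sum>l | length l \<le> 2 * k - 1. c l (chart A a p) * pds l (f \<circ> param A a) (chart A a p))"
    using D f p unfolding diff_op_def by blast
  also have "\<dots> = (\<Sum>l :: 'n list | length l \<le> 2 * k - 1. 0)"
  proof (rule sum.cong[OF refl])
    fix l :: "'n list" assume l: "l \<in> {l. length l \<le> 2 * k - 1}"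
    then have l2: "length l \<le> 2 * k" "2 * k - length l > 0"
      \<comment> \<open>The strict inequality leaves at least one factor \<open>L\<close> in every
        derivative that an operator of order \<open>2 * k - 1\<close> can use.\<close>
      using assms(2) by auto
    obtain B' where B': "\<And>x. x \<in> S \<Longrightarrow> pds l h x = L x ^ (2 * k - length l) * B' x"
      using pds_linear_power_mult[OF L dL b S l2(1)] unfolding h_def by blast
    have "pds l (f \<circ> param A a) x0 = pds l h x0"
      by (rule pds_cong[OF S fh x0])
    also have "\<dots> = 0"
      using B'[OF x0] L0 l2(2) by simp
    finally show "c l (chart A a p) * pds l (f \<circ> param A a) (chart A a p) = 0"
      by (simp add: x0_def)
  qed
  finally show False
    using ne by simp
qed

end

section \<open>Normalization of the obstruction and the product formula\<close>

theorem proposition7p9: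
  fixes A :: "('i, 'm::{t2_space,second_countable_topology}, 'n::finite) atlas"
    and g :: "('i, 'n) tensor2" and lam :: real and k :: nat and c :: "nat \<Rightarrow> real"
  assumes "CARD('n) \<ge> 3"
    and "smooth_atlas A"
    and "pseudo_riemannian_metric A g"
    and "einstein_with A g (2 * lam * (real CARD('n) - 1))"
    and "k \<ge> 1"
    and "\<And>j. c j = (real CARD('n) / 2 + real j - 1) * (real CARD('n) / 2 - real j)"
    and "smooth_function A f" and "p \<in> manifold_of A"
  shows "gjms A g lam k f p =
           op_prod k (\<lambda>j h q. minus_laplacian A g h q + 2 * lam * c j * h q) f p"
proof -
  interpret pr_manifold A g
    by unfold_locales (fact assms(2,3))+
  define ss where "ss = map (\<lambda>j. 2 * lam * c j) [1..<Suc k]"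
  have len: "length ss = k" and ss: "ss \<noteq> []"
    using assms(5) by (auto simp: ss_def)
  obtain \<kappa> where \<kappa>: "\<kappa> \<noteq> 0" "\<And>f p. smooth_function A f \<Longrightarrow> p \<in> manifold_of A \<Longrightarrow>
      obstruction A g lam k f p = \<kappa> * shifted_prod ss f p"
    using obstruction_eq[OF assms(6), of lam "k - 1"] assms(5) unfolding ss_def by auto
  let ?D = "shifted_prod (replicate k 0)"
  have P: "diff_op A (2 * k) (shifted_prod ss)" and D: "diff_op A (2 * k) ?D"
    using diff_op_shifted_prod[of ss] diff_op_shifted_prod[of "replicate k 0"] by (simp_all add: len)
  have PD: "diff_op A (2 * k - 1) (\<lambda>f p. shifted_prod ss f p - ?D f p)"
    using shifted_prod_principal_part[OF ss] by (simp add: len)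
  \<comment> \<open>\<open>gjms\<close> selects its constant by a definite description, so exactly
    one scaling of the obstruction must have the required principal part.\<close>
  have "same_principal_part A (2 * k) (\<lambda>h q. b * obstruction A g lam k h q) (minus_laplacian A g ^^ k)
      \<longleftrightarrow> b = 1 / \<kappa>" for b
  proof
    assume b: "b = 1 / \<kappa>"
    have "diff_op A (2 * k) (\<lambda>h q. b * obstruction A g lam k h q)"
      by (rule diff_op_cong[OF _ P]) (simp add: b \<kappa>)
    moreover have "diff_op A (2 * k - 1) (\<lambda>h q. b * obstruction A g lam k h q - ?D h q)"
      by (rule diff_op_cong[OF _ PD]) (simp add: b \<kappa>)
    ultimately show "same_principal_part A (2 * k) (\<lambda>h q. b * obstruction A g lam k h q) (minus_laplacian A g ^^ k)"
      using D by (simp add: same_principal_part_def minus_laplacian_power)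
  next
    assume "same_principal_part A (2 * k) (\<lambda>h q. b * obstruction A g lam k h q) (minus_laplacian A g ^^ k)"
    then have 1: "diff_op A (2 * k - 1) (\<lambda>h q. b * obstruction A g lam k h q - ?D h q)"
      by (simp add: same_principal_part_def minus_laplacian_power)
    show "b = 1 / \<kappa>"
    proof (rule ccontr)
      assume "b \<noteq> 1 / \<kappa>"
      then have ne: "b * \<kappa> - 1 \<noteq> 0"
        using \<kappa>(1) by (auto simp: field_simps)
      have "diff_op A (2 * k - 1) ?D"
      \<comment> \<open>With T the product, both b \<kappa> T - D and T - D have order at most 2k -
        1. Eliminating T leaves (b \<kappa> - 1) D, so a second admissible constant would lower the
        order of the power D of the Laplacian.\<close>
      proof (rule diff_op_cong)
        show "diff_op A (2 * k - 1) (\<lambda>h q. 1 / (b * \<kappa> - 1) * (b * obstruction A g lam k h q - ?D h q)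
            + (- b * \<kappa> / (b * \<kappa> - 1)) * (shifted_prod ss h q - ?D h q))"
          by (rule diff_op_lincomb[OF 1 PD])
        show "1 / (b * \<kappa> - 1) * (b * obstruction A g lam k h q - ?D h q)
            + (- b * \<kappa> / (b * \<kappa> - 1)) * (shifted_prod ss h q - ?D h q) = ?D h q"
          if "smooth_function A h" "q \<in> manifold_of A" for h q
          using ne unfolding \<kappa>(2)[OF that] by (simp add: divide_simps) (simp add: algebra_simps)
      qed
      then show False
        using laplacian_power_order[OF _ assms(5)] assms(8) by blast
    qed
  qed
  then have "gjms A g lam k f p = 1 / \<kappa> * obstruction A g lam k f p"
    by (simp add: gjms_def)
  also have "\<dots> = shifted_prod ss f p"
    using \<kappa> assms(7,8) by simp
  \<comment> \<open>Both folds put the factor with index 1 outermost, so the order of composition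
    agrees.\<close>
  also have "shifted_prod ss = op_prod k (\<lambda>j h q. minus_laplacian A g h q + 2 * lam * c j * h q)"
    by (simp add: shifted_prod_def op_prod_def ss_def foldr_map comp_def shifted_def[abs_def])
  finally show ?thesis .
qed

end
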